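(* Let $(K,v)$ be a henselian valued field, let $F\in K[x]$ be monic irreducible of degree $>1$, and let $[\Phi_0,\dots,\Phi_r,\Phi_{r+1}=\{F\}]$ be an Okutsu frame of $F$. For all $0\le\ell\le r+1$, choose an arbitrary $\phi_\ell\in\Phi_\ell$ and denote $\gamma_\ell=v_F(\phi_\ell)$. Then the truncation of $v_F$ by $\phi_\ell$ is a valuation $\mu_\ell$, and these valuations fit into a Mac Lane–Vaquié (MLV) chain of $v_F$: $$\mu_0\ \stackrel{\phi_1,\gamma_1}{\longrightarrow}\ \mu_1\ \longrightarrow\ \cdots\ \stackrel{\phi_{r-1},\gamma_{r-1}}{\longrightarrow}\ \mu_{r-1}\ \stackrel{\phi_{r},\gamma_{r}}{\longrightarrow}\ \mu_{r}\ \stackrel{F,\infty}{\longrightarrow}\ \mu_{r+1}=v_F,$$ where, for $0\le\ell\le r$: - If $\Phi_\ell=\{\phi_\ell\}$, then $\mu_{\ell+1}=[\mu_\ell;\,\phi_{\ell+1},\gamma_{\ell+1}]$ is an ordinary augmentation. - If $\Phi_\ell=\{\chi_i\mid i\in I_\ell\}$ (the case where $\Phi_\ell$ is not a one-element set), then $\mu_{\ell+1}=[\mathcal{A}_\ell;\,\phi_{\ell+1},\gamma_{\ell+1}]$ is a limit augmentation with respect to the essential continuous family $\mathcal{A}_\ell=\{\mu_\ell\}\cup(\rho_i)_{i\in A_\ell}$, where $\rho_i=[\mu_\ell;\,\chi_i,v_F(\chi_i)]$ and $A_\ell\subset I_\ell$ contains the indices $i$ such that $v_F(\chi_i)>\g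amma_\ell$.
   Context: **Valuations.** $(K,v)$ is a henselian valued field, $\Gamma=v(K^* )$, $\Gamma_{\mathbb{Q}}=\Gamma\otimes\mathbb{Q}$; $v$ also denotes its unique extension to an algebraic closure $\overline{K}$. For $F\in K[x]$ monic irreducible, $v_F(f)=v(f(\theta))$ for $f\in K[x]$, where $\theta\in\overline K$ is any root of $F$; it is a valuation with support $FK[x]$. All valuations considered are valuations $\mu\colon K[x]\to\Gamma_{\mathbb{Q}}\cup\{\infty\}$ with $\mu|_K=v$ (nonzero support $\mu^{-1}(\infty)$ allowed), ordered by $\mu\le\nu\iff\mu(f)\le\nu(f)$ for all $f$. For $g\in K[x]\setminus K$ the truncation $\mu_g$ of $\mu$ by $g$ is the function sending $f=\sum_s a_sg^s$ ($\deg a_s<\deg g$) to $\min_s\mu(a_sg^s)$ (in general not a valuation). **Key polynomials.** For $\alpha\in\Gamma_\mu$ let $\mathcal{P}_\alpha=\{g\mid\mu(g)\ge\alpha\}\supset\mathcal{P}_\alpha^+=\{g\mid\mu(g)>\alpha\}$, $\mathcal{G}_\mu=\bigoplus_{\alpha}\mathcal{P}_\alpha/\mathcal{P}_\alpha^+$; $\mathrm{in}_\mu g$ is the class of $g$ in $\mathcal{P}_{\mu(g)}/\mathcal{P}^+_{\mu(g)}$ if $\mu(g)<\infty$ and $0$ otherwise. $g\sim_\mu h$ means $\mathrm{in}_\mu g=\mathrm{in}_\mu h$; $h\mid_\mu g$ means $\mathrm{in}_\mu h\mid\mathrm{in}_\mu g$ in $\mathcal{G}_\mu$. A key polynomial for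 $\mu$ is a monic $\phi$ such that $\mathrm{in}_\mu\phi$ generates a nonzero prime ideal ($\mu$-irreducible) and $\phi\nmid_\mu f$ for all nonzero $f$ with $\deg f<\deg\phi$ ($\mu$-minimal). $\mathrm{KP}(\mu)$ is the set of key polynomials; if nonempty, $\deg(\mu)$ is the minimal degree of a key polynomial. If $\mu$ has support $GK[x]\neq0$ with $G$ monic irreducible, then $\deg(\mu)=\deg(G)$. For $\mu<\nu$, $\mathbf{t}(\mu,\nu)$ is the set of monic $\phi$ of minimal degree with $\mu(\phi)<\nu(\phi)$. **Augmentations.** For $\phi\in\mathrm{KP}(\mu)$ and $\gamma\in\Gamma_{\mathbb{Q}}\cup\{\infty\}$ with $\gamma>\mu(\phi)$, the ordinary augmentation $[\mu;\phi,\gamma]$ sends $f=\sum_s a_s\phi^s$ ($\deg a_s<\deg\phi$) to $\min_s\{\mu(a_s)+s\gamma\}$. Let $\mathcal{A}=(\rho_i)_{i\in A}$ be a totally ordered family of valuations without maximal element, $i\mapsto\rho_i$ being an isomorphism of ordered sets. $f$ is $\mathcal{A}$-stable if for some $i$, $\rho_i(f)=\rho_j(f)$ for all $j>i$, and then $\rho_{\mathcal{A}}(f)$ is this stable value. $\mathrm{KP}_\infty(\mathcal{A})$ is the set of monic $\mathcal{A}$-unstable polynomials of minimal degree; that degree is $\deg_\infty(\mathcal{A})$ ($\infty$ if there are none). $\mathcal{A}$ is an essential continuous family if $\deg(\rho_i)$ is constant, equal to $\deg(\mathcal{A})$, for all large $i$ and $\deg(\mathcal{A})<\deg_\infty(\mathcal{A})<\infty$.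 For $\phi\in\mathrm{KP}_\infty(\mathcal{A})$ and $\gamma\in\Gamma_{\mathbb{Q}}\cup\{\infty\}$ with $\gamma>\rho_i(\phi)$ for all $i$, the limit augmentation $[\mathcal{A};\phi,\gamma]$ sends $\sum_s a_s\phi^s$ to $\min_s\{\rho_{\mathcal{A}}(a_s)+s\gamma\}$. **MLV chains.** An MLV chain of $\nu$ is a finite chain $\mu_0\stackrel{\phi_1,\gamma_1}{\longrightarrow}\mu_1\to\cdots\stackrel{\phi_s,\gamma_s}{\longrightarrow}\mu_s=\nu$ with $\deg(\mu_0)=1$, a chosen key polynomial $\phi_0\in\mathrm{KP}(\mu_0)$ of degree $1$ with $\gamma_0=\mu_0(\phi_0)$, in which each step is either an ordinary augmentation $\mu_{n+1}=[\mu_n;\phi_{n+1},\gamma_{n+1}]$ with $\phi_{n+1}\in\mathrm{KP}(\mu_n)$ and $\deg(\mu_n)<\deg(\mu_{n+1})$; or a limit augmentation $\mu_{n+1}=[\mathcal{A}_n;\phi_{n+1},\gamma_{n+1}]$ with $\phi_{n+1}\in\mathrm{KP}_\infty(\mathcal{A}_n)$, where $\mathcal{A}_n$ is an essential continuous family having $\mu_n$ as its first valuation, with $\deg(\mu_n)=\deg(\mathcal{A}_n)$ and $\phi_n\notin\mathbf{t}(\mu_n,\mu_{n+1})$. **Okutsu frames.** Let $n=\deg F>1$. For non-constant $g$ put $\mathrm{wt}(g)=v_F(g)/\deg(g)$. For $1<m\le n$ let $W_m=\{\mathrm{wt}(g)\mid g\in K[x]\text{ monic},\ 0<\deg g<m\}$.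 An Okutsu frame of $F$ is a list $[\Phi_0,\dots,\Phi_r,\Phi_{r+1}=\{F\}]$ of nonempty sets of monic irreducible polynomials such that all polynomials in $\Phi_\ell$ have the same degree $m_\ell$, $1=m_0<m_1<\cdots<m_{r+1}=n$, and for every $0\le\ell\le r$ and every monic $g$ with $0<\deg g<m_{\ell+1}$ there is $\phi\in\Phi_\ell$ with $\mathrm{wt}(g)\le\mathrm{wt}(\phi)$. Okutsu frames are always assumed to satisfy moreover, for $0\le\ell\le r$: (OF1) $\#\Phi_\ell=1$ whenever $\max(W_{m_{\ell+1}})$ exists; (OF2) if $\max(W_{m_{\ell+1}})$ does not exist, $\Phi_\ell$ is totally ordered by $\phi<\phi'\iff v_F(\phi)<v_F(\phi')$ (distinct elements have distinct $v_F$-values), and $I_\ell$ denotes a totally ordered set indexing $\Phi_\ell=\{\chi_i\mid i\in I_\ell\}$ compatibly with this order; (OF3) $\mathrm{wt}(\phi)<\mathrm{wt}(\varphi)$ for all $\phi\in\Phi_\ell$, $\varphi\in\Phi_{\ell+1}$. *)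

theory Defs
  imports
    "HOL-Algebra.Algebraic_Closure_Type"
    "HOL-Library.Poly_Mapping"
    "HOL-Library.Extended_Nat"
    "HOL-Library.Option_ord"
begin

hide_const (open) Divisibility.irreducible

section \<open>Values: an ordered group with a top element adjoined\<close>

datatype 'g vinf = Fin 'g | Infty

instantiation vinf :: (type) infinity
begin
definition infinity_vinf :: "'a vinf" where "\<infinity> = Infty"
instance ..
end

instantiation vinf :: (linorder) linorder
begin

fun less_eq_vinf :: "'a vinf \<Rightarrow> 'a vinf \<Rightarrow> bool" where
  "less_eq_vinf x Infty = True"
| "less_eq_vinf Infty (Fin b) = False"
| "less_eq_vinf (Fin a) (Fin b) = (a \<le> b)"

definition less_vinf :: "'a vinf \<Rightarrow> 'a vinf \<Rightarrow> bool" where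
  "less_vinf x y \<longleftrightarrow> x \<le> y \<and> \<not> y \<le> x"

instance
proof
  fix x y z :: "'a vinf"
  show "x < y \<longleftrightarrow> x \<le> y \<and> \<not> y \<le> x"
    by (rule less_vinf_def)
  show "x \<le> x"
    by (cases x) auto
  show "x \<le> y \<Longrightarrow> y \<le> z \<Longrightarrow> x \<le> z"
    by (cases x; cases y; cases z) auto
  show "x \<le> y \<Longrightarrow> y \<le> x \<Longrightarrow> x = y"
    by (cases x; cases y) auto
  show "x \<le> y \<or> y \<le> x"
    by (cases x; cases y) auto
qed

end

instantiation vinf :: (comm_monoid_add) comm_monoid_add
begin

definition zero_vinf :: "'a vinf" where "0 = Fin 0"

fun plus_vinf :: "'a vinf \<Rightarrow> 'a vinf \<Rightarrow> 'a vinf" where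
  "plus_vinf (Fin a) (Fin b) = Fin (a + b)"
| "plus_vinf Infty y = Infty"
| "plus_vinf x Infty = Infty"

instance
proof
  fix x y z :: "'a vinf"
  show "x + y + z = x + (y + z)"
    by (cases x; cases y; cases z) (auto simp: ac_simps)
  show "x + y = y + x"
    by (cases x; cases y) (auto simp: ac_simps)
  show "0 + x = x"
    by (cases x) (auto simp: zero_vinf_def)
qed

end

lemma less_vinf_simps [simp]:
  "Fin a < Fin b \<longleftrightarrow> a < b" "Fin a < Infty" "\<not> Infty < x"
  by (auto simp: less_vinf_def)

lemma vinf_add_mono:
  fixes x y :: "'g::linordered_ab_group_add vinf"
  shows "Fin a \<le> x \<Longrightarrow> Fin b \<le> y \<Longrightarrow> Fin (a + b) \<le> x + y"
    and "Fin a \<le> x \<Longrightarrow> Fin b < y \<Longrightarrow> Fin (a + b) < x + y"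
  by (cases x; cases y; simp add: add_mono add_le_less_mono; fail)+

text \<open>The multiple \<open>n x\<close>; in particular \<open>0 \<cdot> \<infinity> = 0\<close>.\<close>

definition nmult :: "nat \<Rightarrow> 'a::comm_monoid_add \<Rightarrow> 'a" where
  "nmult n x = (\<Sum>_<n. x)"

text \<open>Division by a positive integer, meant for divisible groups. An ordered group is torsion
  free, so the quotient is unique.\<close>

fun ndiv :: "'g::linordered_ab_group_add vinf \<Rightarrow> nat \<Rightarrow> 'g vinf" where
  "ndiv (Fin a) n = Fin (THE b. nmult n b = a)"
| "ndiv Infty n = Infty"


section \<open>Valuations\<close>

text \<open>The support \<open>\<mu>\<^sup>-\<^sup>1(\<infinity>)\<close> may be nonzero; on a field it is automatically zero, because \<open>\<mu> 1 = 0\<close>.\<close>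

definition is_valuation :: "('a::comm_ring_1 \<Rightarrow> 'g::linordered_ab_group_add vinf) \<Rightarrow> bool" where
  "is_valuation \<mu> \<longleftrightarrow>
     \<mu> 0 = \<infinity> \<and> \<mu> 1 = 0 \<and>
     (\<forall>a b. \<mu> (a * b) = \<mu> a + \<mu> b) \<and>
     (\<forall>a b. min (\<mu> a) (\<mu> b) \<le> \<mu> (a + b))"

lemma is_valuation_uminus:
  fixes \<mu> :: "'a::comm_ring_1 \<Rightarrow> 'g::linordered_ab_group_add vinf"
  assumes "is_valuation \<mu>"
  shows "\<mu> (- a) = \<mu> a"
proof -
  have "\<mu> (- 1) + \<mu> (- 1) = Fin 0"
    using assms by (auto simp: is_valuation_def zero_vinf_def)
       (metis minus_mult_minus mult_1)
  hence "\<mu> (- 1) = Fin 0"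
    by (cases "\<mu> (- 1)") auto
  moreover have "\<mu> (- 1 * a) = \<mu> (- 1) + \<mu> a"
    using assms unfolding is_valuation_def by blast
  ultimately show ?thesis
    by (simp flip: zero_vinf_def)
qed

text \<open>The type \<open>'g\<close> plays the role of \<open>\<Gamma>\<^sub>\<rat> = \<Gamma> \<otimes> \<rat>\<close>, where \<open>\<Gamma> = v(K\<^sup>*)\<close>: it is a divisible ordered
  group containing \<open>\<Gamma>\<close> (as the set of finite values of \<open>v\<close>) and it is torsion modulo \<open>\<Gamma>\<close>. This
  determines it up to a unique isomorphism over \<open>\<Gamma>\<close>.\<close>

definition values_in_divisible_hull :: "('k::field \<Rightarrow> 'g::linordered_ab_group_add vinf) \<Rightarrow> bool" where
  "values_in_divisible_hull v \<longleftrightarrow>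
     (\<forall>(\<gamma>::'g) n. n > 0 \<longrightarrow> (\<exists>\<delta>. nmult n \<delta> = \<gamma>)) \<and>
     (\<forall>\<gamma>::'g. \<exists>n>0. \<exists>a. a \<noteq> 0 \<and> v a = Fin (nmult n \<gamma>))"

definition extends_to_closure ::
    "('k::field \<Rightarrow> 'g::linordered_ab_group_add vinf) \<Rightarrow> ('k alg_closure \<Rightarrow> 'g vinf) \<Rightarrow> bool" where
  "extends_to_closure v w \<longleftrightarrow> is_valuation w \<and> (\<forall>a. w (to_ac a) = v a)"

text \<open>An extension of \<open>v\<close> to the algebraic closure has value group inside \<open>\<Gamma>\<^sub>\<rat>\<close>, so under
  \<^term>\<open>values_in_divisible_hull v\<close> no extension is lost by considering \<open>'g\<close>-valued ones only.\<close>

definition henselian :: "('k::field \<Rightarrow> 'g::linordered_ab_group_add vinf) \<Rightarrow> bool" where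
  "henselian v \<longleftrightarrow> is_valuation v \<and> (\<exists>!w. extends_to_closure v w)"

definition vbar :: "('k::field \<Rightarrow> 'g::linordered_ab_group_add vinf) \<Rightarrow> 'k alg_closure \<Rightarrow> 'g vinf" where
  "vbar v = (THE w. extends_to_closure v w)"

text \<open>\<open>v\<^sub>F\<close>; for henselian \<open>v\<close> and irreducible \<open>F\<close> the choice of the root of \<open>F\<close> is immaterial.\<close>

definition val_of_poly ::
    "('k::field \<Rightarrow> 'g::linordered_ab_group_add vinf) \<Rightarrow> 'k poly \<Rightarrow> 'k poly \<Rightarrow> 'g vinf" where
  "val_of_poly v F f =
     vbar v (poly (map_poly to_ac f) (SOME \<theta>. poly (map_poly to_ac F) \<theta> = 0))"

text \<open>Valuations on \<open>K[x]\<close> extending \<open>v\<close>. They are compared by the pointwise order \<open>\<mu> \<le> \<nu>\<close> of functions.\<close>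

definition valuation_over ::
    "('k::field \<Rightarrow> 'g::linordered_ab_group_add vinf) \<Rightarrow> ('k poly \<Rightarrow> 'g vinf) \<Rightarrow> bool" where
  "valuation_over v \<mu> \<longleftrightarrow> is_valuation \<mu> \<and> (\<forall>a. \<mu> [:a:] = v a)"


section \<open>Expansions and truncations\<close>

definition exp_coeff :: "'k::field poly \<Rightarrow> 'k poly \<Rightarrow> nat \<Rightarrow> 'k poly" where
  "exp_coeff g f s = (f div g ^ s) mod g"

text \<open>These are the coefficients of the \<open>g\<close>-expansion of \<open>f\<close>; they vanish for \<open>s > degree f\<close>.\<close>

lemma exp_coeff_degree:
  fixes f g :: "'k::field poly"
  assumes "degree g > 0"
  shows "degree (exp_coeff g f s) < degree g"
proof -
  have "g \<noteq> 0"
    using assms by auto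
  thus ?thesis
    using assms degree_mod_less[of g "f div g ^ s"] by (auto simp: exp_coeff_def)
qed

lemma exp_coeff_sum:
  fixes f g :: "'k::field poly"
  assumes "degree g > 0"
  shows "f = (\<Sum>s\<le>degree f. exp_coeff g f s * g ^ s)"
proof -
  have *: "f = (\<Sum>s<n. exp_coeff g f s * g ^ s) + (f div g ^ n) * g ^ n" for n
  proof (induction n)
    case (Suc n)
    have "f div g ^ n = (f div g ^ n) div g * g + exp_coeff g f n"
      by (simp add: exp_coeff_def)
    also have "(f div g ^ n) div g = f div g ^ Suc n"
      by (simp only: power_Suc2 poly_div_mult_right)
    finally have "f div g ^ n * g ^ n = exp_coeff g f n * g ^ n + (f div g ^ Suc n) * g ^ Suc n"
      by (metis (no_types, lifting) add.commute distrib_right mult.assoc power_Suc)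
    with Suc show ?case
      by (simp add: add.assoc)
  qed simp
  have "degree f < Suc (degree f) * 1"
    by simp
  also have "\<dots> \<le> Suc (degree f) * degree g"
    using assms by (intro mult_le_mono2) simp
  also have "\<dots> = degree (g ^ Suc (degree f))"
    using assms by (subst degree_power_eq) auto
  finally have "degree f < degree (g ^ Suc (degree f))" .
  hence "f div g ^ Suc (degree f) = 0"
    by (rule div_poly_less)
  with *[of "Suc (degree f)"] show ?thesis
    by (simp add: lessThan_Suc_atMost)
qed

definition truncation ::
    "('k::field poly \<Rightarrow> 'g::linordered_ab_group_add vinf) \<Rightarrow> 'k poly \<Rightarrow> 'k poly \<Rightarrow> 'g vinf" where
  "truncation \<mu> g f = (MIN s\<in>{..degree f}. \<mu> (exp_coeff g f s * g ^ s))"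

text \<open>The map underlying both kinds of augmentation.\<close>

definition augment ::
    "('k::field poly \<Rightarrow> 'g::linordered_ab_group_add vinf) \<Rightarrow> 'k poly \<Rightarrow> 'g vinf \<Rightarrow> 'k poly \<Rightarrow> 'g vinf" where
  "augment \<mu> \<phi> \<gamma> f = (MIN s\<in>{..degree f}. \<mu> (exp_coeff \<phi> f s) + nmult s \<gamma>)"


section \<open>Graded algebra and key polynomials\<close>

text \<open>
  The graded algebra \<open>\<Oplus>\<^sub>\<alpha> P\<^sub>\<alpha> / P\<^sub>\<alpha>\<^sup>+\<close> is realised as the quotient of the ring \<open>\<Oplus>\<^sub>\<alpha> P\<^sub>\<alpha>\<close> by its ideal
  \<open>\<Oplus>\<^sub>\<alpha> P\<^sub>\<alpha>\<^sup>+\<close>. Elements of \<open>\<Oplus>\<^sub>\<alpha> P\<^sub>\<alpha>\<close> are finitely supported families \<open>(p\<^sub>\<alpha>)\<close> with \<open>p\<^sub>\<alpha> \<in> P\<^sub>\<alpha>\<close>, multiplied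
  by convolution. The index \<open>\<alpha>\<close> runs over the whole group \<open>'g\<close>, which makes no difference because
  \<open>P\<^sub>\<alpha> = P\<^sub>\<alpha>\<^sup>+\<close> if \<open>\<alpha>\<close> is not a value of \<open>\<mu>\<close>.
\<close>

definition P_ge :: "('k::field poly \<Rightarrow> 'g::linordered_ab_group_add vinf) \<Rightarrow> 'g \<Rightarrow> 'k poly set" where
  "P_ge \<mu> \<alpha> = {g. Fin \<alpha> \<le> \<mu> g}"

definition P_gt :: "('k::field poly \<Rightarrow> 'g::linordered_ab_group_add vinf) \<Rightarrow> 'g \<Rightarrow> 'k poly set" where
  "P_gt \<mu> \<alpha> = {g. Fin \<alpha> < \<mu> g}"

definition sum_P_ge ::
    "('k::field poly \<Rightarrow> 'g::linordered_ab_group_add vinf) \<Rightarrow> ('g \<Rightarrow>\<^sub>0 'k poly) ring" where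
  "sum_P_ge \<mu> = ring_of_type_algebra\<lparr>carrier := {p. \<forall>\<alpha>. Poly_Mapping.lookup p \<alpha> \<in> P_ge \<mu> \<alpha>}\<rparr>"

definition sum_P_gt ::
    "('k::field poly \<Rightarrow> 'g::linordered_ab_group_add vinf) \<Rightarrow> ('g \<Rightarrow>\<^sub>0 'k poly) set" where
  "sum_P_gt \<mu> = {p. \<forall>\<alpha>. Poly_Mapping.lookup p \<alpha> \<in> P_gt \<mu> \<alpha>}"

definition graded_algebra ::
    "('k::field poly \<Rightarrow> 'g::linordered_ab_group_add vinf) \<Rightarrow> ('g \<Rightarrow>\<^sub>0 'k poly) set ring" where
  "graded_algebra \<mu> = sum_P_ge \<mu> Quot sum_P_gt \<mu>"

lemma P_closed:
  fixes \<mu> :: "'k::field poly \<Rightarrow> 'g::linordered_ab_group_add vinf"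
  assumes "is_valuation \<mu>"
  shows "0 \<in> P_ge \<mu> \<alpha>" "0 \<in> P_gt \<mu> \<alpha>"
    "f \<in> P_ge \<mu> \<alpha> \<Longrightarrow> g \<in> P_ge \<mu> \<alpha> \<Longrightarrow> f + g \<in> P_ge \<mu> \<alpha>"
    "f \<in> P_gt \<mu> \<alpha> \<Longrightarrow> g \<in> P_gt \<mu> \<alpha> \<Longrightarrow> f + g \<in> P_gt \<mu> \<alpha>"
    "f \<in> P_ge \<mu> \<alpha> \<Longrightarrow> - f \<in> P_ge \<mu> \<alpha>"
    "f \<in> P_gt \<mu> \<alpha> \<Longrightarrow> - f \<in> P_gt \<mu> \<alpha>"
    "f \<in> P_ge \<mu> \<alpha> \<Longrightarrow> g \<in> P_ge \<mu> \<beta> \<Longrightarrow> f * g \<in> P_ge \<mu> (\<alpha> + \<beta>)"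
    "f \<in> P_ge \<mu> \<alpha> \<Longrightarrow> g \<in> P_gt \<mu> \<beta> \<Longrightarrow> f * g \<in> P_gt \<mu> (\<alpha> + \<beta>)"
    "1 \<in> P_ge \<mu> 0"
proof -
  have v: "\<mu> 0 = Infty" "\<mu> 1 = Fin 0" "\<And>a b. \<mu> (a * b) = \<mu> a + \<mu> b"
          "\<And>a b. min (\<mu> a) (\<mu> b) \<le> \<mu> (a + b)"
    using assms by (auto simp: is_valuation_def zero_vinf_def infinity_vinf_def)
  show "0 \<in> P_ge \<mu> \<alpha>" "0 \<in> P_gt \<mu> \<alpha>" "1 \<in> P_ge \<mu> 0"
    by (auto simp: P_ge_def P_gt_def v)
  show "f \<in> P_ge \<mu> \<alpha> \<Longrightarrow> g \<in> P_ge \<mu> \<alpha> \<Longrightarrow> f + g \<in> P_ge \<mu> \<alpha>"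
    using v(4)[of f g] by (auto simp: P_ge_def min_def split: if_splits)
  show "f \<in> P_gt \<mu> \<alpha> \<Longrightarrow> g \<in> P_gt \<mu> \<alpha> \<Longrightarrow> f + g \<in> P_gt \<mu> \<alpha>"
    using v(4)[of f g] by (auto simp: P_gt_def min_def split: if_splits)
  show "f \<in> P_ge \<mu> \<alpha> \<Longrightarrow> - f \<in> P_ge \<mu> \<alpha>" "f \<in> P_gt \<mu> \<alpha> \<Longrightarrow> - f \<in> P_gt \<mu> \<alpha>"
    by (auto simp: P_ge_def P_gt_def is_valuation_uminus[OF assms])
  show "f \<in> P_ge \<mu> \<alpha> \<Longrightarrow> g \<in> P_ge \<mu> \<beta> \<Longrightarrow> f * g \<in> P_ge \<mu> (\<alpha> + \<beta>)"
       "f \<in> P_ge \<mu> \<alpha> \<Longrightarrow> g \<in> P_gt \<mu> \<beta> \<Longrightarrow> f * g \<in> P_gt \<mu> (\<alpha> + \<beta>)"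
    by (auto simp: P_ge_def P_gt_def v intro: vinf_add_mono)
qed

lemma lookup_mult_closed:
  fixes p q :: "'g::ab_group_add \<Rightarrow>\<^sub>0 'k::field poly"
  assumes "0 \<in> S" "\<And>f g. f \<in> S \<Longrightarrow> g \<in> S \<Longrightarrow> f + g \<in> S"
    and "\<And>\<beta>. Poly_Mapping.lookup p \<beta> * Poly_Mapping.lookup q (\<alpha> - \<beta>) \<in> S"
  shows "Poly_Mapping.lookup (p * q) \<alpha> \<in> S"
proof -
  have "(\<lambda>\<gamma>. Poly_Mapping.lookup q \<gamma> when \<alpha> = \<beta> + \<gamma>) =
        (\<lambda>\<gamma>. Poly_Mapping.lookup q \<gamma> when \<gamma> = \<alpha> - \<beta>)" for \<beta>
    by (intro ext arg_cong2[where f = "(when)"]) auto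
  hence eq: "Sum_any (\<lambda>\<gamma>. Poly_Mapping.lookup q \<gamma> when \<alpha> = \<beta> + \<gamma>) =
             Poly_Mapping.lookup q (\<alpha> - \<beta>)" for \<beta>
    by (simp only: Sum_any_when_equal)
  have "(\<Sum>\<beta>\<in>B. Poly_Mapping.lookup p \<beta> * Poly_Mapping.lookup q (\<alpha> - \<beta>)) \<in> S" if "finite B" for B
    using that by (induction B) (auto intro: assms)
  thus ?thesis
    by (cases "finite {\<beta>. Poly_Mapping.lookup p \<beta> * Poly_Mapping.lookup q (\<alpha> - \<beta>) \<noteq> 0}")
       (simp_all add: lookup_mult eq Sum_any.expand_set assms(1))
qed

lemma cring_sum_P_ge:
  fixes \<mu> :: "'k::field poly \<Rightarrow> 'g::linordered_ab_group_add vinf"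
  assumes "is_valuation \<mu>"
  shows "cring (sum_P_ge \<mu>)"
proof -
  interpret R: cring "ring_of_type_algebra :: ('g \<Rightarrow>\<^sub>0 'k poly) ring"
    by (rule cring_from_type_algebra)
  note c = P_closed[OF assms]
  have mult: "p * q \<in> {p. \<forall>\<alpha>. Poly_Mapping.lookup p \<alpha> \<in> P_ge \<mu> \<alpha>}"
    if "p \<in> {p. \<forall>\<alpha>. Poly_Mapping.lookup p \<alpha> \<in> P_ge \<mu> \<alpha>}"
       "q \<in> {p. \<forall>\<alpha>. Poly_Mapping.lookup p \<alpha> \<in> P_ge \<mu> \<alpha>}" for p q
  proof (safe intro!: lookup_mult_closed c)
    fix \<alpha> \<beta>
    show "Poly_Mapping.lookup p \<beta> * Poly_Mapping.lookup q (\<alpha> - \<beta>) \<in> P_ge \<mu> \<alpha>"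
      using that c(7)[of "Poly_Mapping.lookup p \<beta>" \<beta> "Poly_Mapping.lookup q (\<alpha> - \<beta>)" "\<alpha> - \<beta>"] by simp
  qed
  show ?thesis
    unfolding sum_P_ge_def
  proof (rule cringI)
    show "abelian_group (ring_of_type_algebra\<lparr>carrier := {p. \<forall>\<alpha>. Poly_Mapping.lookup p \<alpha> \<in> P_ge \<mu> \<alpha>}\<rparr>)"
    proof (rule abelian_groupI)
      fix x assume "x \<in> carrier (ring_of_type_algebra\<lparr>carrier := {p. \<forall>\<alpha>. Poly_Mapping.lookup p \<alpha> \<in> P_ge \<mu> \<alpha>}\<rparr>)"
      thus "\<exists>y\<in>carrier (ring_of_type_algebra\<lparr>carrier := {p. \<forall>\<alpha>. Poly_Mapping.lookup p \<alpha> \<in> P_ge \<mu> \<alpha>}\<rparr>).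
               y \<oplus>\<^bsub>ring_of_type_algebra\<lparr>carrier := {p. \<forall>\<alpha>. Poly_Mapping.lookup p \<alpha> \<in> P_ge \<mu> \<alpha>}\<rparr>\<^esub> x =
               \<zero>\<^bsub>ring_of_type_algebra\<lparr>carrier := {p. \<forall>\<alpha>. Poly_Mapping.lookup p \<alpha> \<in> P_ge \<mu> \<alpha>}\<rparr>\<^esub>"
        by (intro bexI[of _ "- x"]) (auto simp: ring_of_type_algebra_def c)
    qed (auto simp: ring_of_type_algebra_def c lookup_add add.assoc add.commute)
  next
    show "comm_monoid (ring_of_type_algebra\<lparr>carrier := {p. \<forall>\<alpha>. Poly_Mapping.lookup p \<alpha> \<in> P_ge \<mu> \<alpha>}\<rparr>)"
    proof (rule comm_monoidI)
      show "\<one>\<^bsub>ring_of_type_algebra\<lparr>carrier := {p. \<forall>\<alpha>. Poly_Mapping.lookup p \<alpha> \<in> P_ge \<mu> \<alpha>}\<rparr>\<^esub> \<in>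
            carrier (ring_of_type_algebra\<lparr>carrier := {p. \<forall>\<alpha>. Poly_Mapping.lookup p \<alpha> \<in> P_ge \<mu> \<alpha>}\<rparr>)"
        by (auto simp: ring_of_type_algebra_def lookup_one when_def c)
    qed (use mult in \<open>auto simp: ring_of_type_algebra_def mult.assoc mult.commute\<close>)
  qed (auto simp: ring_of_type_algebra_def distrib_right)
qed

lemma ideal_sum_P_gt:
  fixes \<mu> :: "'k::field poly \<Rightarrow> 'g::linordered_ab_group_add vinf"
  assumes "is_valuation \<mu>"
  shows "ideal (sum_P_gt \<mu>) (sum_P_ge \<mu>)"
proof -
  interpret R: cring "sum_P_ge \<mu>"
    by (rule cring_sum_P_ge[OF assms])
  note c = P_closed[OF assms]
  have simps: "carrier (sum_P_ge \<mu>) = {p. \<forall>\<alpha>. Poly_Mapping.lookup p \<alpha> \<in> P_ge \<mu> \<alpha>}"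
    "p \<oplus>\<^bsub>sum_P_ge \<mu>\<^esub> q = p + q" "p \<otimes>\<^bsub>sum_P_ge \<mu>\<^esub> q = p * q" "\<zero>\<^bsub>sum_P_ge \<mu>\<^esub> = 0" for p q
    by (auto simp: sum_P_ge_def ring_of_type_algebra_def)
  have sub: "sum_P_gt \<mu> \<subseteq> carrier (sum_P_ge \<mu>)"
    by (auto simp: sum_P_gt_def simps P_gt_def P_ge_def intro: less_imp_le)
  have mult: "p * q \<in> sum_P_gt \<mu>" if "p \<in> carrier (sum_P_ge \<mu>)" "q \<in> sum_P_gt \<mu>" for p q
    unfolding sum_P_gt_def
  proof (safe intro!: lookup_mult_closed c)
    fix \<alpha> \<beta>
    show "Poly_Mapping.lookup p \<beta> * Poly_Mapping.lookup q (\<alpha> - \<beta>) \<in> P_gt \<mu> \<alpha>"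
      using that c(8)[of "Poly_Mapping.lookup p \<beta>" \<beta> "Poly_Mapping.lookup q (\<alpha> - \<beta>)" "\<alpha> - \<beta>"]
      by (simp add: simps sum_P_gt_def)
  qed
  show ?thesis
  proof (rule idealI)
    show "subgroup (sum_P_gt \<mu>) (add_monoid (sum_P_ge \<mu>))"
    proof (rule group.subgroupI)
      show "sum_P_gt \<mu> \<noteq> {}"
        by (auto simp: sum_P_gt_def c intro!: exI[of _ 0])
      show "inv\<^bsub>add_monoid (sum_P_ge \<mu>)\<^esub> a \<in> sum_P_gt \<mu>" if a: "a \<in> sum_P_gt \<mu>" for a
      proof -
        have "- a \<in> sum_P_gt \<mu>"
          using a by (auto simp: sum_P_gt_def c)
        moreover have "\<ominus>\<^bsub>sum_P_ge \<mu>\<^esub> a = - a"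
          using a \<open>- a \<in> _\<close> sub by (intro R.minus_equality) (auto simp: simps(2,4))
        ultimately show ?thesis
          by (simp add: a_inv_def)
      qed
    qed (use sub R.add.is_group in \<open>auto simp: sum_P_gt_def simps(2) lookup_add c\<close>)
    show "a \<otimes>\<^bsub>sum_P_ge \<mu>\<^esub> x \<in> sum_P_gt \<mu>"
      if "a \<in> sum_P_gt \<mu>" "x \<in> carrier (sum_P_ge \<mu>)" for a x
      using mult[OF that(2,1)] by (simp add: simps(3) mult.commute)
  qed (use mult R.ring_axioms in \<open>auto simp: simps(3)\<close>)
qed

lemma cring_graded_algebra:
  fixes \<mu> :: "'k::field poly \<Rightarrow> 'g::linordered_ab_group_add vinf"
  assumes "is_valuation \<mu>"
  shows "cring (graded_algebra \<mu>)"
  unfolding graded_algebra_def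
  by (rule ideal.quotient_is_cring[OF ideal_sum_P_gt[OF assms] cring_sum_P_ge[OF assms]])

definition initial_form ::
    "('k::field poly \<Rightarrow> 'g::linordered_ab_group_add vinf) \<Rightarrow> 'k poly \<Rightarrow> ('g \<Rightarrow>\<^sub>0 'k poly) set" where
  "initial_form \<mu> g =
     (case \<mu> g of
        Fin \<alpha> \<Rightarrow> sum_P_gt \<mu> +>\<^bsub>sum_P_ge \<mu>\<^esub> Poly_Mapping.single \<alpha> g
      | Infty \<Rightarrow> \<zero>\<^bsub>graded_algebra \<mu>\<^esub>)"

abbreviation monic :: "'k::field poly \<Rightarrow> bool" where
  "monic f \<equiv> lead_coeff f = 1"

definition val_dvd ::
    "('k::field poly \<Rightarrow> 'g::linordered_ab_group_add vinf) \<Rightarrow> 'k poly \<Rightarrow> 'k poly \<Rightarrow> bool" where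
  "val_dvd \<mu> h g \<longleftrightarrow> initial_form \<mu> h divides\<^bsub>graded_algebra \<mu>\<^esub> initial_form \<mu> g"

definition val_irreducible ::
    "('k::field poly \<Rightarrow> 'g::linordered_ab_group_add vinf) \<Rightarrow> 'k poly \<Rightarrow> bool" where
  "val_irreducible \<mu> \<phi> \<longleftrightarrow>
     primeideal (Idl\<^bsub>graded_algebra \<mu>\<^esub> {initial_form \<mu> \<phi>}) (graded_algebra \<mu>) \<and>
     Idl\<^bsub>graded_algebra \<mu>\<^esub> {initial_form \<mu> \<phi>} \<noteq> {\<zero>\<^bsub>graded_algebra \<mu>\<^esub>}"

definition val_minimal ::
    "('k::field poly \<Rightarrow> 'g::linordered_ab_group_add vinf) \<Rightarrow> 'k poly \<Rightarrow> bool" where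
  "val_minimal \<mu> \<phi> \<longleftrightarrow> (\<forall>f. f \<noteq> 0 \<and> degree f < degree \<phi> \<longrightarrow> \<not> val_dvd \<mu> \<phi> f)"

definition KP :: "('k::field poly \<Rightarrow> 'g::linordered_ab_group_add vinf) \<Rightarrow> 'k poly set" where
  "KP \<mu> = {\<phi>. monic \<phi> \<and> val_irreducible \<mu> \<phi> \<and> val_minimal \<mu> \<phi>}"

definition support :: "('k::field poly \<Rightarrow> 'g::linordered_ab_group_add vinf) \<Rightarrow> 'k poly set" where
  "support \<mu> = {f. \<mu> f = \<infinity>}"

text \<open>The degree of \<open>\<mu>\<close>. The value \<open>\<infinity>\<close> means that the degree is not defined, i.e. that the support is zero
  and there are no key polynomials.\<close>

definition vdeg :: "('k::field poly \<Rightarrow> 'g::linordered_ab_group_add vinf) \<Rightarrow> enat" where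
  "vdeg \<mu> =
     (if support \<mu> = {0} then INF \<phi>\<in>KP \<mu>. enat (degree \<phi>)
      else INF G\<in>{G. monic G \<and> irreducible G \<and> support \<mu> = {f. G dvd f}}. enat (degree G))"

definition tset ::
    "('k::field poly \<Rightarrow> 'g::linordered_ab_group_add vinf) \<Rightarrow> ('k poly \<Rightarrow> 'g vinf) \<Rightarrow> 'k poly set" where
  "tset \<mu> \<nu> =
     {\<phi>. monic \<phi> \<and> \<mu> \<phi> < \<nu> \<phi> \<and> (\<forall>g. monic g \<and> \<mu> g < \<nu> g \<longrightarrow> degree \<phi> \<le> degree g)}"


section \<open>Augmentations\<close>

definition ordinary_augmentation ::
    "('k::field poly \<Rightarrow> 'g::linordered_ab_group_add vinf) \<Rightarrow> 'k poly \<Rightarrow> 'g vinf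
       \<Rightarrow> ('k poly \<Rightarrow> 'g vinf) \<Rightarrow> bool" where
  "ordinary_augmentation \<mu> \<phi> \<gamma> \<mu>' \<longleftrightarrow> \<phi> \<in> KP \<mu> \<and> \<mu> \<phi> < \<gamma> \<and> \<mu>' = augment \<mu> \<phi> \<gamma>"

definition valuation_family ::
    "('k::field \<Rightarrow> 'g::linordered_ab_group_add vinf) \<Rightarrow> 'i::linorder set
       \<Rightarrow> ('i \<Rightarrow> 'k poly \<Rightarrow> 'g vinf) \<Rightarrow> bool" where
  "valuation_family v A \<rho> \<longleftrightarrow>
     A \<noteq> {} \<and> (\<forall>i\<in>A. \<exists>j\<in>A. i < j) \<and>
     (\<forall>i\<in>A. valuation_over v (\<rho> i)) \<and>
     (\<forall>i\<in>A. \<forall>j\<in>A. i \<le> j \<longleftrightarrow> \<rho> i \<le> \<rho> j)"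

definition stable ::
    "'i::linorder set \<Rightarrow> ('i \<Rightarrow> 'k::field poly \<Rightarrow> 'g::linordered_ab_group_add vinf) \<Rightarrow> 'k poly \<Rightarrow> bool" where
  "stable A \<rho> f \<longleftrightarrow> (\<exists>i\<in>A. \<forall>j\<in>A. i < j \<longrightarrow> \<rho> i f = \<rho> j f)"

definition stable_val ::
    "'i::linorder set \<Rightarrow> ('i \<Rightarrow> 'k::field poly \<Rightarrow> 'g::linordered_ab_group_add vinf) \<Rightarrow> 'k poly \<Rightarrow> 'g vinf" where
  "stable_val A \<rho> f = (THE w. \<exists>i\<in>A. \<rho> i f = w \<and> (\<forall>j\<in>A. i < j \<longrightarrow> \<rho> j f = w))"

definition KP_inf ::
    "'i::linorder set \<Rightarrow> ('i \<Rightarrow> 'k::field poly \<Rightarrow> 'g::linordered_ab_group_add vinf) \<Rightarrow> 'k poly set" where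
  "KP_inf A \<rho> =
     {\<phi>. monic \<phi> \<and> \<not> stable A \<rho> \<phi> \<and> (\<forall>g. monic g \<and> \<not> stable A \<rho> g \<longrightarrow> degree \<phi> \<le> degree g)}"

definition deg_inf ::
    "'i::linorder set \<Rightarrow> ('i \<Rightarrow> 'k::field poly \<Rightarrow> 'g::linordered_ab_group_add vinf) \<Rightarrow> enat" where
  "deg_inf A \<rho> = (INF \<phi>\<in>KP_inf A \<rho>. enat (degree \<phi>))"

text \<open>\<open>family_deg A \<rho> d\<close> says that the degree of the family is defined and equal to \<open>d\<close>.\<close>

definition family_deg ::
    "'i::linorder set \<Rightarrow> ('i \<Rightarrow> 'k::field poly \<Rightarrow> 'g::linordered_ab_group_add vinf) \<Rightarrow> enat \<Rightarrow> bool" where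
  "family_deg A \<rho> d \<longleftrightarrow> (\<exists>i\<in>A. \<forall>j\<in>A. i \<le> j \<longrightarrow> vdeg (\<rho> j) = d)"

definition essential_continuous_family ::
    "('k::field \<Rightarrow> 'g::linordered_ab_group_add vinf) \<Rightarrow> 'i::linorder set
       \<Rightarrow> ('i \<Rightarrow> 'k poly \<Rightarrow> 'g vinf) \<Rightarrow> bool" where
  "essential_continuous_family v A \<rho> \<longleftrightarrow>
     valuation_family v A \<rho> \<and>
     (\<exists>d. family_deg A \<rho> d \<and> d < deg_inf A \<rho> \<and> deg_inf A \<rho> < \<infinity>)"

definition limit_augmentation ::
    "'i::linorder set \<Rightarrow> ('i \<Rightarrow> 'k::field poly \<Rightarrow> 'g::linordered_ab_group_add vinf) \<Rightarrow> 'k poly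
       \<Rightarrow> 'g vinf \<Rightarrow> ('k poly \<Rightarrow> 'g vinf) \<Rightarrow> bool" where
  "limit_augmentation A \<rho> \<phi> \<gamma> \<mu>' \<longleftrightarrow>
     \<phi> \<in> KP_inf A \<rho> \<and> (\<forall>i\<in>A. \<rho> i \<phi> < \<gamma>) \<and> \<mu>' = augment (stable_val A \<rho>) \<phi> \<gamma>"


section \<open>Mac Lane--Vaquie chains\<close>

datatype (dead 'i, dead 'w) mlv_step =
  Ordinary
| Limit "'i set" "'i \<Rightarrow> 'w"

text \<open>\<open>MLV_chain v s \<mu> \<phi> \<gamma> st \<nu>\<close>: the valuations \<open>\<mu>\<^sub>0, \<dots>, \<mu>\<^sub>s = \<nu>\<close> form an MLV chain over \<open>v\<close>, where
  \<open>st n\<close> tells whether the step from \<open>\<mu>\<^sub>n\<close> to \<open>\<mu>\<^sub>n\<^sub>+\<^sub>1\<close> is an ordinary augmentation or a limit augmentation with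
  respect to a given family. Values of \<open>\<mu>\<close>, \<open>\<phi>\<close>, \<open>\<gamma>\<close> beyond index \<open>s\<close> are irrelevant.\<close>

definition MLV_chain ::
    "('k::field \<Rightarrow> 'g::linordered_ab_group_add vinf) \<Rightarrow> nat \<Rightarrow> (nat \<Rightarrow> 'k poly \<Rightarrow> 'g vinf)
       \<Rightarrow> (nat \<Rightarrow> 'k poly) \<Rightarrow> (nat \<Rightarrow> 'g vinf) \<Rightarrow> (nat \<Rightarrow> ('i::linorder, 'k poly \<Rightarrow> 'g vinf) mlv_step)
       \<Rightarrow> ('k poly \<Rightarrow> 'g vinf) \<Rightarrow> bool" where
  "MLV_chain v s \<mu> \<phi> \<gamma> st \<nu> \<longleftrightarrow>
     (\<forall>n\<le>s. valuation_over v (\<mu> n)) \<and> \<mu> s = \<nu> \<and>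
     vdeg (\<mu> 0) = 1 \<and> \<phi> 0 \<in> KP (\<mu> 0) \<and> degree (\<phi> 0) = 1 \<and> \<gamma> 0 = \<mu> 0 (\<phi> 0) \<and>
     (\<forall>n<s. case st n of
        Ordinary \<Rightarrow>
          ordinary_augmentation (\<mu> n) (\<phi> (Suc n)) (\<gamma> (Suc n)) (\<mu> (Suc n)) \<and>
          vdeg (\<mu> n) < vdeg (\<mu> (Suc n)) \<and> vdeg (\<mu> (Suc n)) < \<infinity>
      | Limit A \<rho> \<Rightarrow>
          essential_continuous_family v A \<rho> \<and>
          (\<exists>i\<in>A. (\<forall>j\<in>A. i \<le> j) \<and> \<rho> i = \<mu> n) \<and>
          family_deg A \<rho> (vdeg (\<mu> n)) \<and>
          \<phi> n \<notin> tset (\<mu> n) (\<mu> (Suc n)) \<and>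
          limit_augmentation A \<rho> (\<phi> (Suc n)) (\<gamma> (Suc n)) (\<mu> (Suc n)))"


section \<open>Okutsu frames\<close>

text \<open>In this section \<open>\<nu>\<close> stands for \<open>v\<^sub>F\<close>.\<close>

definition wt :: "('k::field poly \<Rightarrow> 'g::linordered_ab_group_add vinf) \<Rightarrow> 'k poly \<Rightarrow> 'g vinf" where
  "wt \<nu> g = ndiv (\<nu> g) (degree g)"

definition weights :: "('k::field poly \<Rightarrow> 'g::linordered_ab_group_add vinf) \<Rightarrow> nat \<Rightarrow> 'g vinf set" where
  "weights \<nu> m = {wt \<nu> g | g. monic g \<and> 0 < degree g \<and> degree g < m}"

definition has_max :: "'a::linorder set \<Rightarrow> bool" where
  "has_max W \<longleftrightarrow> (\<exists>w\<in>W. \<forall>w'\<in>W. w' \<le> w)"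

text \<open>The frame is \<open>[\<Phi> 0, \<dots>, \<Phi> (r + 1)]\<close>. The last three conditions are (OF1), (OF2) and (OF3).\<close>

definition okutsu_frame ::
    "('k::field \<Rightarrow> 'g::linordered_ab_group_add vinf) \<Rightarrow> 'k poly \<Rightarrow> nat \<Rightarrow> (nat \<Rightarrow> 'k poly set) \<Rightarrow> bool" where
  "okutsu_frame v F r \<Phi> \<longleftrightarrow>
     (let \<nu> = val_of_poly v F in
      \<Phi> (Suc r) = {F} \<and>
      (\<forall>l\<le>Suc r. \<Phi> l \<noteq> {} \<and> (\<forall>\<phi>\<in>\<Phi> l. monic \<phi> \<and> irreducible \<phi>)) \<and>
      (\<exists>m. m 0 = 1 \<and> m (Suc r) = degree F \<and> (\<forall>l\<le>r. m l < m (Suc l)) \<and>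
         (\<forall>l\<le>Suc r. \<forall>\<phi>\<in>\<Phi> l. degree \<phi> = m l) \<and>
         (\<forall>l\<le>r. \<forall>g. monic g \<and> 0 < degree g \<and> degree g < m (Suc l) \<longrightarrow>
            (\<exists>\<phi>\<in>\<Phi> l. wt \<nu> g \<le> wt \<nu> \<phi>)) \<and>
         (\<forall>l\<le>r. has_max (weights \<nu> (m (Suc l))) \<longrightarrow> is_singleton (\<Phi> l)) \<and>
         (\<forall>l\<le>r. \<not> has_max (weights \<nu> (m (Suc l))) \<longrightarrow> inj_on \<nu> (\<Phi> l)) \<and>
         (\<forall>l\<le>r. \<forall>\<phi>\<in>\<Phi> l. \<forall>\<psi>\<in>\<Phi> (Suc l). wt \<nu> \<phi> < wt \<nu> \<psi>)))"

definition indexes ::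
    "('k::field poly \<Rightarrow> 'g::linordered_ab_group_add vinf) \<Rightarrow> 'i::linorder set \<Rightarrow> ('i \<Rightarrow> 'k poly)
       \<Rightarrow> 'k poly set \<Rightarrow> bool" where
  "indexes \<nu> I \<chi> S \<longleftrightarrow>
     bij_betw \<chi> I S \<and> (\<forall>i\<in>I. \<forall>j\<in>I. i < j \<longleftrightarrow> \<nu> (\<chi> i) < \<nu> (\<chi> j))"

text \<open>The family \<open>{\<mu>} \<union> (\<rho>\<^sub>i)\<close> with \<open>\<rho>\<^sub>i = [\<mu>; \<chi>\<^sub>i, \<nu>(\<chi>\<^sub>i)]\<close> for \<open>i \<in> A\<close>. It is indexed by \<open>A\<close> together with a
  new first index \<open>None\<close> that stands for \<open>\<mu>\<close>.\<close>

definition frame_indices :: "'i::linorder set \<Rightarrow> 'i option set" where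
  "frame_indices A = insert None (Some ` A)"

definition frame_family ::
    "('k::field poly \<Rightarrow> 'g::linordered_ab_group_add vinf) \<Rightarrow> ('i \<Rightarrow> 'k poly) \<Rightarrow> ('k poly \<Rightarrow> 'g vinf)
       \<Rightarrow> 'i option \<Rightarrow> 'k poly \<Rightarrow> 'g vinf" where
  "frame_family \<nu> \<chi> \<mu> x =
     (case x of None \<Rightarrow> \<mu> | Some i \<Rightarrow> augment \<mu> (\<chi> i) (\<nu> (\<chi> i)))"

end

theory Submission
  imports Defs
begin

text \<open>
  Fix a root \<open>\<theta>\<close> of \<open>F\<close>. For \<open>d \<in> \<Gamma>\<^sub>\<rat> \<union> {\<infinity>}\<close> let \<open>w\<^sub>d\<close> be the restriction to \<open>K[x]\<close> of the Gauss valuation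
  on \<open>K\<^sup>a\<^sup>c[x]\<close> of the ball of radius \<open>d\<close> around \<open>\<theta>\<close>, which sends \<open>x - \<beta>\<close> to \<open>min (v (\<theta> - \<beta>)) d\<close>. Thus
  \<open>w\<^sub>\<infinity> = v\<^sub>F\<close>, and \<open>w\<^sub>d g = v\<^sub>F g\<close> holds iff \<open>\<delta>(g) \<le> d\<close>, where \<open>\<delta>(g)\<close> is the largest \<open>v (\<theta> - \<beta>)\<close> over the
  roots \<open>\<beta>\<close> of \<open>g\<close>.

  Since conjugate elements have the same value, counting \<open>v (\<theta>' - \<beta>')\<close> over all roots \<open>\<theta>'\<close> of \<open>F\<close> and
  \<open>\<beta>'\<close> of an irreducible \<open>g\<close> in two ways gives \<open>deg F \<cdot> wt(g) = w\<^sub>\<delta>\<^sub>(\<^sub>g\<^sub>) F\<close>. So the weight of an irreducible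
  polynomial is a strictly increasing function of \<open>\<delta>\<close>, and an Okutsu frame is a statement about \<open>\<delta>\<close>:
  each \<open>\<phi> \<in> \<Phi>\<^sub>l\<close> satisfies \<open>\<delta>(g) < \<delta>(\<phi>)\<close> for all \<open>g\<close> of smaller degree.

  For such \<open>\<phi>\<close> the truncation of \<open>v\<^sub>F\<close> by \<open>\<phi>\<close> is \<open>w\<^sub>\<delta>\<^sub>(\<^sub>\<phi>\<^sub>)\<close>: if \<open>\<alpha>\<close> is a root of \<open>\<phi>\<close> closest to \<open>\<theta>\<close>, then
  \<open>w\<^sub>\<delta>\<^sub>(\<^sub>\<phi>\<^sub>) f \<le> v (f(\<alpha>)) = v (a\<^sub>0(\<alpha>)) = w\<^sub>\<delta>\<^sub>(\<^sub>\<phi>\<^sub>) a\<^sub>0\<close> for the constant term \<open>a\<^sub>0\<close> of the \<open>\<phi>\<close>-expansion of \<open>f\<close>, and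
  the other terms follow by induction. All valuations of the chain and of the limit families are therefore
  of the form \<open>w\<^sub>d\<close>, increasing with \<open>d\<close>. Finally, for \<open>\<mu> \<le> \<nu>\<close> a monic \<open>\<psi>\<close> of least degree with \<open>\<mu> \<psi> < \<nu> \<psi>\<close> is
  a key polynomial for \<open>\<mu>\<close>, because \<open>in\<^sub>\<mu> \<psi>\<close> generates the kernel of the map from \<open>G\<^sub>\<mu>\<close> to the domain \<open>G\<^sub>\<nu>\<close>.
\<close>

section \<open>Arithmetic of values with a top element\<close>

instance vinf :: (linordered_ab_group_add) ordered_comm_monoid_add
proof
  fix a b c :: "'a vinf"
  assume "a \<le> b"
  thus "c + a \<le> c + b"
    by (cases a; cases b; cases c) auto
qed

lemma vinf_add_Infty [simp]: "x + Infty = Infty" "Infty + x = Infty"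
  for x :: "'g::linordered_ab_group_add vinf"
  by (cases x; simp)+

lemma vinf_le_Infty [simp]: "Infty \<le> x \<longleftrightarrow> x = Infty"
  by (cases x) auto

lemma vinf_add_eq_Infty [simp]: "x + y = Infty \<longleftrightarrow> x = Infty \<or> y = Infty"
  for x :: "'g::linordered_ab_group_add vinf"
  by (cases x; cases y) auto

lemma vinf_add_less_le: "x < y \<Longrightarrow> x' \<le> y' \<Longrightarrow> x' \<noteq> Infty \<Longrightarrow> x + x' < y + y'"
  for x :: "'g::linordered_ab_group_add vinf"
  by (cases x; cases y; cases x'; cases y') (auto intro: add_less_le_mono)

lemma vinf_add_le_less: "x < y \<Longrightarrow> x' \<le> y' \<Longrightarrow> x' \<noteq> Infty \<Longrightarrow> x' + x < y' + y"
  for x :: "'g::linordered_ab_group_add vinf"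
  using vinf_add_less_le[of x y x' y'] by (simp add: add.commute)

lemma vinf_less_add_cancel: "x + z < y + z \<Longrightarrow> x < y" "z + x < z + y \<Longrightarrow> x < y"
  for x :: "'g::linordered_ab_group_add vinf"
  by (cases x; cases y; cases z; simp; fail)+

lemma vinf_less_not_Infty: "x < y \<Longrightarrow> x \<noteq> Infty"
  for x :: "'g::linordered_ab_group_add vinf"
  by auto

lemma vinf_sum_mset_mono: "(\<And>x. x \<in># M \<Longrightarrow> f x \<le> g x) \<Longrightarrow> (\<Sum>x\<in>#M. f x) \<le> (\<Sum>x\<in>#M. g x)"
  for f :: "'a \<Rightarrow> 'g::linordered_ab_group_add vinf"
  by (induction M) (auto intro: add_mono)

lemma vinf_sum_mset_eq_Infty: "(\<Sum>x\<in>#M. f x) = Infty \<longleftrightarrow> (\<exists>x\<in>#M. f x = Infty)"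
  for f :: "'a \<Rightarrow> 'g::linordered_ab_group_add vinf"
  by (induction M) (auto simp: zero_vinf_def)

text \<open>Split off the entry y where the inequality is strict; the remaining sum on the left is
  finite, and this keeps it strict, since adding \<open>Infty\<close> would erase the
  difference.\<close>

lemma vinf_sum_mset_strict_mono:
  fixes f :: "'a \<Rightarrow> 'g::linordered_ab_group_add vinf"
  assumes "\<And>x. x \<in># M \<Longrightarrow> f x \<le> g x" "y \<in># M" "f y < g y" "\<And>x. x \<in># M \<Longrightarrow> f x \<noteq> Infty"
  shows "(\<Sum>x\<in>#M. f x) < (\<Sum>x\<in>#M. g x)"
proof -
  obtain N where M: "M = add_mset y N"
    using assms(2) by (metis insert_DiffM)
  have "(\<Sum>x\<in>#N. f x) \<le> (\<Sum>x\<in>#N. g x)" "(\<Sum>x\<in>#N. f x) \<noteq> Infty"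
    using assms by (auto simp: M vinf_sum_mset_eq_Infty intro!: vinf_sum_mset_mono)
  thus ?thesis
    using assms(3) by (simp add: M vinf_add_less_le)
qed

section \<open>Multiples and quotients of values\<close>

lemma nmult_0 [simp]: "nmult 0 x = 0"
  by (simp add: nmult_def)

lemma nmult_Suc [simp]: "nmult (Suc n) x = x + nmult n x"
  by (simp add: nmult_def add.commute)

lemma nmult_add: "nmult (m + n) x = nmult m x + nmult n x"
  by (induction m) (auto simp: add.assoc)

lemma nmult_mult: "nmult (m * n) x = nmult m (nmult n x)"
  by (induction m) (auto simp: nmult_add)

lemma nmult_Fin: "nmult n (Fin a) = Fin (nmult n a)"
  by (induction n) (auto simp: zero_vinf_def)

lemma nmult_Infty: "nmult n (Infty :: 'g::linordered_ab_group_add vinf) = (if n = 0 then 0 else Infty)"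
  by (cases n) auto

lemma nmult_mono: "x \<le> y \<Longrightarrow> nmult n x \<le> nmult n y"
  for x :: "'g::linordered_ab_group_add vinf"
  by (induction n) (auto intro: add_mono)

lemma nmult_strict_mono: "x < y \<Longrightarrow> n > 0 \<Longrightarrow> nmult n x < nmult n y"
  for x :: "'g::linordered_ab_group_add vinf"
proof (induction n)
  case (Suc n)
  have "nmult n x \<noteq> Infty"
    using Suc.prems(1) by (cases x) (auto simp: nmult_Fin)
  thus ?case
    using Suc.prems(1) nmult_mono[of x y n] by (auto intro!: vinf_add_less_le)
qed simp

lemma nmult_le_iff: "n > 0 \<Longrightarrow> nmult n x \<le> nmult n y \<longleftrightarrow> x \<le> y"
  for x :: "'g::linordered_ab_group_add vinf"
  by (metis nmult_mono nmult_strict_mono not_le)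

lemma nmult_eq_iff: "n > 0 \<Longrightarrow> nmult n x = nmult n y \<longleftrightarrow> x = y"
  for x :: "'g::linordered_ab_group_add vinf"
  by (metis nmult_le_iff order_antisym order_refl)

lemma nmult_eq_iff_group: "n > 0 \<Longrightarrow> nmult n a = nmult n b \<longleftrightarrow> a = b"
  for a :: "'g::linordered_ab_group_add"
  using nmult_eq_iff[of n "Fin a" "Fin b"] by (simp add: nmult_Fin)

lemma sum_mset_const_nmult: "(\<Sum>x\<in>#M. c) = nmult (size M) c"
  by (induction M) auto

text \<open>Divisibility provides a quotient and torsion-freeness makes it unique, so the
  description in \<open>ndiv\<close> denotes it.\<close>

lemma nmult_ndiv:
  fixes x :: "'g::linordered_ab_group_add vinf"
  assumes "\<And>(\<gamma>::'g) n. n > 0 \<Longrightarrow> \<exists>\<delta>. nmult n \<delta> = \<gamma>" "n > 0"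
  shows "nmult n (ndiv x n) = x"
proof (cases x)
  case (Fin a)
  obtain b where b: "nmult n b = a"
    using assms by blast
  have "(THE b. nmult n b = a) = b"
    using b nmult_eq_iff_group[OF assms(2)] by blast
  thus ?thesis
    using b by (simp add: Fin nmult_Fin)
qed (use assms in \<open>simp add: nmult_Infty\<close>)

section \<open>General facts on valuations\<close>

lemma is_valuationD:
  assumes "is_valuation \<mu>"
  shows "\<mu> 0 = Infty" "\<mu> 1 = 0" "\<mu> (a * b) = \<mu> a + \<mu> b" "min (\<mu> a) (\<mu> b) \<le> \<mu> (a + b)"
    "\<mu> (- a) = \<mu> a" "min (\<mu> a) (\<mu> b) \<le> \<mu> (a - b)"
proof -
  have *: "\<mu> 0 = Infty" "\<mu> 1 = 0" "\<mu> (a * b) = \<mu> a + \<mu> b" "min (\<mu> a) (\<mu> c) \<le> \<mu> (a + c)" for c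
    using assms by (auto simp: is_valuation_def infinity_vinf_def)
  show "\<mu> 0 = Infty" "\<mu> 1 = 0" "\<mu> (a * b) = \<mu> a + \<mu> b" "min (\<mu> a) (\<mu> b) \<le> \<mu> (a + b)"
    using * by blast+
  show "\<mu> (- a) = \<mu> a"
    by (rule is_valuation_uminus[OF assms])
  show "min (\<mu> a) (\<mu> b) \<le> \<mu> (a - b)"
    using *(4)[of "- b"] is_valuation_uminus[OF assms, of b] by simp
qed

text \<open>If a + b had larger value than a, then a = (a + b) - b would be a difference of two
  elements of value above that of a.\<close>

lemma valuation_less_add:
  assumes "is_valuation \<mu>" "\<mu> a < \<mu> b"
  shows "\<mu> (a + b) = \<mu> a" "\<mu> (b + a) = \<mu> a" "\<mu> (a - b) = \<mu> a" "\<mu> (b - a) = \<mu> a"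
proof -
  have *: "\<mu> (a + b) = \<mu> a" if "\<mu> a < \<mu> b" for a b
    using is_valuationD(4)[OF assms(1), of a b] is_valuationD(6)[OF assms(1), of "a + b" b] that
    by (auto simp: min_def split: if_splits)
  show "\<mu> (a + b) = \<mu> a" "\<mu> (a - b) = \<mu> a" "\<mu> (b + a) = \<mu> a"
    using *[of a b] *[of a "- b"] assms is_valuationD(5)[OF assms(1)] by (auto simp: add.commute)
  thus "\<mu> (b - a) = \<mu> a"
    using is_valuationD(5)[OF assms(1), of "a - b"] by simp
qed

lemma valuation_sum_ge:
  assumes "is_valuation \<mu>" "\<And>i. i \<in> A \<Longrightarrow> x \<le> \<mu> (f i)"
  shows "x \<le> \<mu> (sum f A)"
  using assms(2)
proof (induction A rule: infinite_finite_induct)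
  case (insert i A)
  thus ?case
    using order_trans[OF _ is_valuationD(4)[OF assms(1), of "f i" "sum f A"], of x] by auto
qed (auto simp: is_valuationD(1)[OF assms(1)])

text \<open>The empty sum has value \<open>Infty\<close>, so a strict bound asks for a finite
  x.\<close>

lemma valuation_sum_gt:
  assumes "is_valuation \<mu>" "\<And>i. i \<in> A \<Longrightarrow> x < \<mu> (f i)" "x \<noteq> Infty"
  shows "x < \<mu> (sum f A)"
  using assms(2)
proof (induction A rule: infinite_finite_induct)
  case (insert i A)
  thus ?case
    using less_le_trans[OF _ is_valuationD(4)[OF assms(1), of "f i" "sum f A"], of x] by auto
qed (use assms(3) in \<open>cases x; auto simp: is_valuationD(1)[OF assms(1)]\<close>)+

lemma valuation_power: "is_valuation \<mu> \<Longrightarrow> \<mu> (a ^ n) = nmult n (\<mu> a)"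
  by (induction n) (auto simp: is_valuationD)

lemma valuation_prod_mset: "is_valuation \<mu> \<Longrightarrow> \<mu> (\<Prod>x\<in>#M. f x) = (\<Sum>x\<in>#M. \<mu> (f x))"
  by (induction M) (auto simp: is_valuationD)

lemma valuation_field_eq_Infty:
  fixes \<mu> :: "'a::field \<Rightarrow> 'g::linordered_ab_group_add vinf"
  assumes "is_valuation \<mu>"
  shows "\<mu> a = Infty \<longleftrightarrow> a = 0"
proof
  assume a: "\<mu> a = Infty"
  show "a = 0"
  proof (rule ccontr)
    assume "a \<noteq> 0"
    hence "\<mu> 1 = \<mu> a + \<mu> (inverse a)"
      by (metis is_valuationD(3)[OF assms] right_inverse)
    thus False
      by (simp add: a is_valuationD[OF assms] zero_vinf_def)
  qed
qed (simp add: is_valuationD[OF assms])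


subsection \<open>Augmentations and expansions\<close>

lemma exp_coeff_eq_0: "degree g > 0 \<Longrightarrow> s > degree f \<Longrightarrow> exp_coeff g f s = 0"
  for g :: "'k::field poly"
proof -
  assume g: "degree g > 0" and s: "s > degree f"
  have "degree f < s * degree g"
    using g s by (metis Suc_leI less_le_trans mult_le_mono2 nat_mult_1_right One_nat_def)
  also have "\<dots> = degree (g ^ s)"
    using g by (subst degree_power_eq) auto
  finally show ?thesis
    by (simp add: exp_coeff_def div_poly_less)
qed

lemma exp_coeff_0: "exp_coeff g f 0 = f mod g"
  by (simp add: exp_coeff_def)

lemma exp_coeff_Suc: "exp_coeff g f (Suc s) = exp_coeff g (f div g) s"
  by (simp add: exp_coeff_def poly_div_mult_right)

text \<open>Coefficients beyond \<open>degree f\<close> are 0 and have value \<open>Infty\<close>.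
  With s unbounded, lower bounds can be proved by induction on s with f replaced by
  \<open>f div g\<close>.\<close>

lemma le_augment_iff:
  assumes "degree g > 0" "\<mu> 0 = Infty"
  shows "x \<le> augment \<mu> g \<gamma> f \<longleftrightarrow> (\<forall>s. x \<le> \<mu> (exp_coeff g f s) + nmult s \<gamma>)"
proof -
  have "x \<le> augment \<mu> g \<gamma> f \<longleftrightarrow> (\<forall>s\<le>degree f. x \<le> \<mu> (exp_coeff g f s) + nmult s \<gamma>)"
    by (auto simp: augment_def)
  moreover have "x \<le> \<mu> (exp_coeff g f s) + nmult s \<gamma>" if "\<not> s \<le> degree f" for s
    using that assms by (simp add: exp_coeff_eq_0)
  ultimately show ?thesis
    by blast
qed

lemma augment_cong:
  assumes "degree g > 0" "\<And>a. degree a < degree g \<Longrightarrow> \<mu> a = \<mu>' a"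
  shows "augment \<mu> g \<gamma> = augment \<mu>' g \<gamma>"
  using assms by (auto simp: augment_def exp_coeff_degree intro!: ext)

lemma truncation_eq_augment:
  assumes "is_valuation \<mu>"
  shows "truncation \<mu> g = augment \<mu> g (\<mu> g)"
  by (auto simp: truncation_def augment_def is_valuationD(3)[OF assms] valuation_power[OF assms] intro!: ext)

text \<open>This is how augmentations are identified: no valuation property has to be checked for them.\<close>

lemma augment_self:
  assumes w: "is_valuation w" and g: "degree g > 0" and le: "\<And>f. w f \<le> w (f mod g)"
  shows "augment w g (w g) = w"
proof (rule ext, rule order_antisym)
  note v = is_valuationD[OF w]
  fix f
  have "augment w g (w g) f \<le> w (\<Sum>s\<le>degree f. exp_coeff g f s * g ^ s)"
    using le_augment_iff[of g w, OF g v(1), of "augment w g (w g) f" "w g" f]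
    by (intro valuation_sum_ge[OF w]) (auto simp: v(3) valuation_power[OF w])
  thus "augment w g (w g) f \<le> w f"
    using exp_coeff_sum[OF g, of f] by simp
  have "w f \<le> w (exp_coeff g f s) + nmult s (w g)" for s
  proof (induction s arbitrary: f)
    case (Suc s)
    \<comment> \<open>The remainder has value at least that of f, so removing it does not lower the
      value. What is left is g times \<open>f div g\<close>, whose expansion is that of f shifted by
      one.\<close>
    have "w f \<le> w (f - f mod g)"
      using le[of f] v(6)[of f "f mod g"] by (auto simp: min_def)
    also have "\<dots> = w (f div g) + w g"
      by (simp add: minus_mod_eq_div_mult v(3))
    also have "\<dots> \<le> (w (exp_coeff g (f div g) s) + nmult s (w g)) + w g"
      by (intro add_mono Suc.IH order_refl)
    finally show ?case
      by (simp add: exp_coeff_Suc ac_simps)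
  qed (auto simp: exp_coeff_0 le)
  thus "w f \<le> augment w g (w g) f"
    by (simp add: le_augment_iff[of g w, OF g v(1)])
qed


subsection \<open>Gauss valuations\<close>

definition gauss :: "('l::field \<Rightarrow> 'g::linordered_ab_group_add vinf) \<Rightarrow> 'g vinf \<Rightarrow> 'l poly \<Rightarrow> 'g vinf" where
  "gauss V d f = (MIN s\<in>{..degree f}. V (coeff f s) + nmult s d)"

text \<open>Composition with \<open>[:\<theta>, 1:]\<close> rewrites f in powers of x - \<theta>,
  which moves the centre of the Gauss valuation from 0 to \<theta>.\<close>

definition ball_val ::
    "('l::field \<Rightarrow> 'g::linordered_ab_group_add vinf) \<Rightarrow> 'l \<Rightarrow> 'g vinf \<Rightarrow> 'l poly \<Rightarrow> 'g vinf" where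
  "ball_val V \<theta> d f = gauss V d (f \<circ>\<^sub>p [:\<theta>, 1:])"

context
  fixes V :: "'l::field \<Rightarrow> 'g::linordered_ab_group_add vinf"
  assumes V: "is_valuation V"
begin

lemma le_gauss_iff: "x \<le> gauss V d f \<longleftrightarrow> (\<forall>s. x \<le> V (coeff f s) + nmult s d)"
proof -
  have "x \<le> gauss V d f \<longleftrightarrow> (\<forall>s\<le>degree f. x \<le> V (coeff f s) + nmult s d)"
    by (auto simp: gauss_def)
  moreover have "x \<le> V (coeff f s) + nmult s d" if "\<not> s \<le> degree f" for s
    using that by (simp add: coeff_eq_0 is_valuationD(1)[OF V])
  ultimately show ?thesis
    by blast
qed

lemma gauss_le: "gauss V d f \<le> V (coeff f s) + nmult s d"
  using le_gauss_iff[of "gauss V d f" d f] by simp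

text \<open>Choosing the first index at which the minimum is attained makes all earlier terms
  strictly larger, as the product formula requires.\<close>

lemma gauss_attained:
  "\<exists>s. gauss V d f = V (coeff f s) + nmult s d \<and> (\<forall>i<s. gauss V d f < V (coeff f i) + nmult i d)"
proof -
  have "gauss V d f \<in> (\<lambda>s. V (coeff f s) + nmult s d) ` {..degree f}"
    unfolding gauss_def by (rule Min_in) auto
  hence ex: "\<exists>s. V (coeff f s) + nmult s d = gauss V d f"
    by force
  define s where "s = (LEAST s. V (coeff f s) + nmult s d = gauss V d f)"
  have "V (coeff f s) + nmult s d = gauss V d f"
    unfolding s_def by (rule LeastI_ex[OF ex])
  moreover have "gauss V d f \<noteq> V (coeff f i) + nmult i d" if "i < s" for i
    using not_less_Least[OF that[unfolded s_def]] by auto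
  hence "\<forall>i<s. gauss V d f < V (coeff f i) + nmult i d"
    using gauss_le[of d f] by (simp add: order_less_le)
  ultimately show ?thesis
    by (intro exI[of _ s]) simp
qed

text \<open>Gauss's lemma. One inequality bounds each coefficient of the product by its smallest
  summand. For the other, let i and j be the first indices attaining the minima of f and g: in the
  coefficient of index i + j exactly one summand has the lowest value.\<close>

lemma gauss_mult: "gauss V d (f * g) = gauss V d f + gauss V d g"
proof (rule order_antisym)
  note v = is_valuationD[OF V]
  have summand: "V (coeff f i * coeff g j) + nmult (i + j) d
      = (V (coeff f i) + nmult i d) + (V (coeff g j) + nmult j d)" for i j
    by (simp add: v(3) nmult_add ac_simps)
  show "gauss V d f + gauss V d g \<le> gauss V d (f * g)"
    unfolding le_gauss_iff
  proof
    fix s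
    obtain i where i: "i \<le> s" "\<And>i'. i' \<le> s \<Longrightarrow> V (coeff f i * coeff g (s - i)) \<le> V (coeff f i' * coeff g (s - i'))"
      using arg_min_least[of "{..s}" _ "\<lambda>i. V (coeff f i * coeff g (s - i))"]
        arg_min_if_finite(1)[of "{..s}" "\<lambda>i. V (coeff f i * coeff g (s - i))"] by fastforce
    have "gauss V d f + gauss V d g \<le> (V (coeff f i) + nmult i d) + (V (coeff g (s - i)) + nmult (s - i) d)"
      by (intro add_mono gauss_le)
    also have "\<dots> = V (coeff f i * coeff g (s - i)) + nmult s d"
      using summand[of i "s - i"] i(1) by simp
    also have "V (coeff f i * coeff g (s - i)) \<le> V (coeff (f * g) s)"
      unfolding coeff_mult by (rule valuation_sum_ge[OF V]) (use i in auto)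
    finally show "gauss V d f + gauss V d g \<le> V (coeff (f * g) s) + nmult s d"
      by (auto simp: add_right_mono)
  qed
  show "gauss V d (f * g) \<le> gauss V d f + gauss V d g"
  proof (cases "gauss V d f = Infty \<or> gauss V d g = Infty")
    case False
    obtain i where i: "gauss V d f = V (coeff f i) + nmult i d"
      "\<And>k. k < i \<Longrightarrow> gauss V d f < V (coeff f k) + nmult k d"
      using gauss_attained[of d f] by auto
    obtain j where j: "gauss V d g = V (coeff g j) + nmult j d"
      "\<And>k. k < j \<Longrightarrow> gauss V d g < V (coeff g k) + nmult k d"
      using gauss_attained[of d g] by auto
    \<comment> \<open>Any other summand has k < i or i + j - k < j, and there one of the two factors
      exceeds its minimum.\<close>
    have less: "V (coeff f i * coeff g j) < V (coeff f k * coeff g (i + j - k))"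
      if "k \<le> i + j" "k \<noteq> i" for k
    proof -
      have "gauss V d f + gauss V d g
          < (V (coeff f k) + nmult k d) + (V (coeff g (i + j - k)) + nmult (i + j - k) d)"
      proof (cases "k < i")
        case True
        thus ?thesis
          using False by (intro vinf_add_less_le i gauss_le) auto
      next
        case k: False
        hence "i + j - k < j"
          using that by linarith
        thus ?thesis
          using False by (intro vinf_add_le_less j gauss_le) auto
      qed
      also have "\<dots> = V (coeff f k * coeff g (i + j - k)) + nmult (i + j) d"
        using summand[of k "i + j - k"] that by simp
      also have "gauss V d f + gauss V d g = V (coeff f i * coeff g j) + nmult (i + j) d"
        using summand[of i j] by (simp add: i j)
      finally show ?thesis
        by (rule vinf_less_add_cancel)
    qed
    have fin: "V (coeff f i * coeff g j) \<noteq> Infty"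
      using False by (auto simp: i j v(3))
    have "coeff (f * g) (i + j)
        = coeff f i * coeff g j + (\<Sum>k\<in>{..i+j} - {i}. coeff f k * coeff g (i + j - k))"
      unfolding coeff_mult by (subst sum.remove[of _ i]) auto
    also have "V \<dots> = V (coeff f i * coeff g j)"
      by (intro valuation_less_add[OF V] valuation_sum_gt[OF V] less fin) auto
    finally have "V (coeff (f * g) (i + j)) + nmult (i + j) d = gauss V d f + gauss V d g"
      using summand[of i j] by (simp add: i j)
    thus ?thesis
      using gauss_le by metis
  qed auto
qed

lemma is_valuation_gauss: "is_valuation (gauss V d)"
proof -
  note v = is_valuationD[OF V]
  have "min (gauss V d f) (gauss V d g) \<le> gauss V d (f + g)" for f g
    unfolding le_gauss_iff
  proof
    fix s
    have "min (gauss V d f) (gauss V d g) \<le> min (V (coeff f s)) (V (coeff g s)) + nmult s d"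
      using gauss_le[of d f s] gauss_le[of d g s] by (auto simp: min_def split: if_splits)
    also have "\<dots> \<le> V (coeff (f + g) s) + nmult s d"
      using v(4) by (auto simp: add_right_mono)
    finally show "min (gauss V d f) (gauss V d g) \<le> V (coeff (f + g) s) + nmult s d" .
  qed
  thus ?thesis
    unfolding is_valuation_def using gauss_mult by (auto simp: gauss_def v infinity_vinf_def)
qed

lemma is_valuation_ball_val: "is_valuation (ball_val V \<theta> d)"
  using is_valuation_gauss[of d]
  by (auto simp: is_valuation_def ball_val_def pcompose_mult pcompose_add pcompose_1)

lemma ball_val_const: "ball_val V \<theta> d [:c:] = V c"
  by (simp add: ball_val_def gauss_def)

lemma ball_val_linear: "ball_val V \<theta> d [:- \<beta>, 1:] = min (V (\<theta> - \<beta>)) d"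
proof -
  have "[:- \<beta>, 1:] \<circ>\<^sub>p [:\<theta>, 1:] = [:\<theta> - \<beta>, 1:]"
    by (simp add: pcompose_pCons)
  moreover have "{..Suc 0} = {0, Suc 0}"
    by auto
  ultimately show ?thesis
    by (simp add: ball_val_def gauss_def is_valuationD[OF V] min.commute)
qed

lemma ball_val_mono: "d \<le> d' \<Longrightarrow> ball_val V \<theta> d f \<le> ball_val V \<theta> d' f"
  unfolding ball_val_def le_gauss_iff
  by (meson add_left_mono gauss_le nmult_mono order_trans)

text \<open>Since \<alpha> lies in the ball, each term of the expansion of f(\<alpha>) in powers of
  \<alpha> - \<theta> has at least the value that the Gauss valuation assigns to it.\<close>

lemma ball_val_le_eval:
  assumes "d \<le> V (\<alpha> - \<theta>)"
  shows "ball_val V \<theta> d f \<le> V (poly f \<alpha>)"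
proof -
  define h where "h = f \<circ>\<^sub>p [:\<theta>, 1:]"
  have "poly f \<alpha> = poly h (\<alpha> - \<theta>)"
    by (simp add: h_def poly_pcompose)
  also have "\<dots> = (\<Sum>i\<le>degree h. coeff h i * (\<alpha> - \<theta>) ^ i)"
    by (rule poly_altdef)
  finally have "poly f \<alpha> = (\<Sum>i\<le>degree h. coeff h i * (\<alpha> - \<theta>) ^ i)" .
  moreover have "gauss V d h \<le> V (\<Sum>i\<le>degree h. coeff h i * (\<alpha> - \<theta>) ^ i)"
  proof (rule valuation_sum_ge[OF V])
    fix i
    have "gauss V d h \<le> V (coeff h i) + nmult i d"
      by (rule gauss_le)
    also have "\<dots> \<le> V (coeff h i * (\<alpha> - \<theta>) ^ i)"
      using nmult_mono[OF assms, of i]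
      by (auto simp: is_valuationD(3)[OF V] valuation_power[OF V] intro!: add_left_mono)
    finally show "gauss V d h \<le> V (coeff h i * (\<alpha> - \<theta>) ^ i)" .
  qed
  ultimately show ?thesis
    by (simp add: ball_val_def h_def)
qed

lemma ball_val_Infty: "ball_val V \<theta> Infty f = V (poly f \<theta>)"
proof -
  have "gauss V Infty h = V (coeff h 0)" for h
  proof (rule order_antisym)
    show "gauss V Infty h \<le> V (coeff h 0)"
      using gauss_le[of Infty h 0] by simp
    show "V (coeff h 0) \<le> gauss V Infty h"
      unfolding le_gauss_iff by (auto simp: nmult_Infty)
  qed
  thus ?thesis
    by (simp add: ball_val_def)
qed

end

text \<open>The polynomial splits, and multiplicativity turns the product over its roots into a sum.
  The multiset B is fixed before \<theta>, d and x, so that values for different centres and radii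
  can be compared summand by summand.\<close>

lemma ball_val_eq_sum:
  fixes V :: "'l::alg_closed_field \<Rightarrow> 'g::linordered_ab_group_add vinf"
  assumes "is_valuation V" "f \<noteq> 0"
  obtains B where "size B = degree f" "\<And>\<beta>. \<beta> \<in># B \<longleftrightarrow> poly f \<beta> = 0"
    "\<And>\<theta> d. ball_val V \<theta> d f = V (lead_coeff f) + (\<Sum>\<beta>\<in>#B. min (V (\<theta> - \<beta>)) d)"
    "\<And>x. V (poly f x) = V (lead_coeff f) + (\<Sum>\<beta>\<in>#B. V (x - \<beta>))"
proof -
  obtain B where B: "size B = degree f" "f = smult (lead_coeff f) (\<Prod>\<beta>\<in>#B. [:- \<beta>, 1:])"
    using alg_closed_imp_factorization[OF assms(2)] by blast
  have ev: "poly f x = lead_coeff f * (\<Prod>\<beta>\<in>#B. x - \<beta>)" for x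
    by (subst B(2)) (simp add: poly_prod_mset)
  have f: "f = [:lead_coeff f:] * (\<Prod>\<beta>\<in>#B. [:- \<beta>, 1:])"
    using B(2) by simp
  have 1: "ball_val V \<theta> d f = V (lead_coeff f) + (\<Sum>\<beta>\<in>#B. min (V (\<theta> - \<beta>)) d)" for \<theta> d
    by (subst f) (simp only: is_valuationD(3)[OF is_valuation_ball_val[OF assms(1)]]
        valuation_prod_mset[OF is_valuation_ball_val[OF assms(1)]]
        ball_val_const[OF assms(1)] ball_val_linear[OF assms(1)])
  have 2: "V (poly f x) = V (lead_coeff f) + (\<Sum>\<beta>\<in>#B. V (x - \<beta>))" for x
    by (simp add: ev is_valuationD(3)[OF assms(1)] valuation_prod_mset[OF assms(1)])
  have 3: "\<beta> \<in># B \<longleftrightarrow> poly f \<beta> = 0" for \<beta>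
    by (auto simp: ev assms(2) prod_mset_zero_iff)
  show ?thesis
    by (rule that[OF B(1) 3 1 2])
qed

context
  fixes V :: "'l::alg_closed_field \<Rightarrow> 'g::linordered_ab_group_add vinf" and \<theta> :: 'l
  assumes V: "is_valuation V"
begin

text \<open>No root is closer to the centre than d, so d cuts off none of the minima.\<close>

lemma ball_val_eq_eval_centre:
  assumes "\<And>\<beta>. poly f \<beta> = 0 \<Longrightarrow> V (\<theta> - \<beta>) \<le> d"
  shows "ball_val V \<theta> d f = V (poly f \<theta>)"
proof (cases "f = 0")
  case False
  obtain B where B: "size B = degree f" "\<And>\<beta>. \<beta> \<in># B \<longleftrightarrow> poly f \<beta> = 0"
    "\<And>\<theta> d. ball_val V \<theta> d f = V (lead_coeff f) + (\<Sum>\<beta>\<in>#B. min (V (\<theta> - \<beta>)) d)"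
    "\<And>x. V (poly f x) = V (lead_coeff f) + (\<Sum>\<beta>\<in>#B. V (x - \<beta>))"
    by (rule ball_val_eq_sum[OF V False]) (rule that)
  have "image_mset (\<lambda>\<beta>. min (V (\<theta> - \<beta>)) d) B = image_mset (\<lambda>\<beta>. V (\<theta> - \<beta>)) B"
    using assms by (intro image_mset_cong) (auto simp: B(2) min_def)
  thus ?thesis
    unfolding B(3,4) by simp
qed (simp add: is_valuationD[OF V] is_valuationD[OF is_valuation_ball_val[OF V]])

text \<open>Every summand is monotone in d, and the one of the root \<beta> is still cut off at d,
  hence grows strictly.\<close>

lemma ball_val_strict_mono:
  assumes "f \<noteq> 0" "poly f \<beta> = 0" "d < d'" "d < V (\<theta> - \<beta>)"
  shows "ball_val V \<theta> d f < ball_val V \<theta> d' f"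
proof -
  obtain B where B: "size B = degree f" "\<And>\<beta>. \<beta> \<in># B \<longleftrightarrow> poly f \<beta> = 0"
    "\<And>\<theta> d. ball_val V \<theta> d f = V (lead_coeff f) + (\<Sum>\<beta>\<in>#B. min (V (\<theta> - \<beta>)) d)"
    "\<And>x. V (poly f x) = V (lead_coeff f) + (\<Sum>\<beta>\<in>#B. V (x - \<beta>))"
    by (rule ball_val_eq_sum[OF V assms(1)]) (rule that)
  have "d \<noteq> Infty"
    using assms(3) by auto
  hence "(\<Sum>\<beta>\<in>#B. min (V (\<theta> - \<beta>)) d) < (\<Sum>\<beta>\<in>#B. min (V (\<theta> - \<beta>)) d')"
    using assms by (intro vinf_sum_mset_strict_mono[of _ _ _ \<beta>]) (auto simp: B(2) min_def)
  thus ?thesis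
    unfolding B(3) using valuation_field_eq_Infty[OF V] assms(1) by (intro vinf_add_le_less) auto
qed

lemma ball_val_eq_Infty: "d \<noteq> Infty \<Longrightarrow> ball_val V \<theta> d f = Infty \<longleftrightarrow> f = 0"
proof (cases "f = 0")
  case False
  assume d: "d \<noteq> Infty"
  obtain B where B: "size B = degree f" "\<And>\<beta>. \<beta> \<in># B \<longleftrightarrow> poly f \<beta> = 0"
    "\<And>\<theta> d. ball_val V \<theta> d f = V (lead_coeff f) + (\<Sum>\<beta>\<in>#B. min (V (\<theta> - \<beta>)) d)"
    "\<And>x. V (poly f x) = V (lead_coeff f) + (\<Sum>\<beta>\<in>#B. V (x - \<beta>))"
    by (rule ball_val_eq_sum[OF V False]) (rule that)
  show ?thesis
    using False d by (auto simp: B(3) valuation_field_eq_Infty[OF V] is_valuationD(1)[OF V] vinf_sum_mset_eq_Infty min_def)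
qed (simp add: is_valuationD[OF is_valuation_ball_val[OF V]])

text \<open>The relation \<open>D\<close> between g(\<theta>) and g(\<alpha>) is stable under
  products and holds for nonzero constants. For a linear factor the difference of the two values is
  \<theta> - \<alpha>, so \<open>D\<close> is the hypothesis on its root.\<close>

lemma eval_diff_less:
  assumes "f \<noteq> 0" "\<And>\<beta>. poly f \<beta> = 0 \<Longrightarrow> V (\<theta> - \<beta>) < V (\<theta> - \<alpha>)"
  shows "V (poly f \<theta>) < V (poly f \<theta> - poly f \<alpha>)"
proof -
  note v = is_valuationD[OF V]
  define D where "D g \<longleftrightarrow> V (poly g \<theta>) < V (poly g \<theta> - poly g \<alpha>)" for g
  have D_mult: "D (g * h)" if "D g" "D h" for g h
  proof -
    have eq: "V (poly h \<alpha>) = V (poly h \<theta>)"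
      using that(2) valuation_less_add(3)[OF V, of "poly h \<theta>" "poly h \<theta> - poly h \<alpha>"]
      by (simp add: D_def)
    have fin: "V (poly g \<theta>) \<noteq> Infty" "V (poly h \<theta>) \<noteq> Infty"
      using that by (auto simp: D_def)
    have "V (poly g \<theta>) + V (poly h \<theta>)
        < min (V (poly g \<theta> * (poly h \<theta> - poly h \<alpha>))) (V ((poly g \<theta> - poly g \<alpha>) * poly h \<alpha>))"
      using that fin by (auto simp: D_def v(3) eq intro: vinf_add_less_le vinf_add_le_less)
    also have "\<dots> \<le> V (poly g \<theta> * (poly h \<theta> - poly h \<alpha>) + (poly g \<theta> - poly g \<alpha>) * poly h \<alpha>)"
      by (rule v(4))
    also have "\<dots> = V (poly (g * h) \<theta> - poly (g * h) \<alpha>)"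
      by (simp add: algebra_simps)
    finally show ?thesis
      by (simp add: D_def v(3))
  qed
  obtain B where B: "f = smult (lead_coeff f) (\<Prod>\<beta>\<in>#B. [:- \<beta>, 1:])"
    using alg_closed_imp_factorization[OF assms(1)] by blast
  have D_const: "D [:c:]" if "c \<noteq> 0" for c
    using that valuation_field_eq_Infty[OF V, of c] by (cases "V c") (auto simp: D_def v(1))
  have roots: "V (\<theta> - \<beta>) < V (\<theta> - \<alpha>)" if "\<beta> \<in># B" for \<beta>
    using that assms(1) by (intro assms(2), subst B) (auto simp: poly_prod_mset prod_mset_zero_iff)
  have "D (\<Prod>\<beta>\<in>#B. [:- \<beta>, 1:])"
    using roots
  proof (induction B)
    case (add \<beta> B)
    have "D [:- \<beta>, 1:]"
      using add.prems[of \<beta>] by (simp add: D_def)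
    moreover have "D (\<Prod>\<beta>\<in>#B. [:- \<beta>, 1:])"
      using add by simp
    ultimately show ?case
      using D_mult by (simp del: mult_pCons_left)
  qed (use D_const[of 1] in \<open>simp add: one_pCons\<close>)
  hence "D ([:lead_coeff f:] * (\<Prod>\<beta>\<in>#B. [:- \<beta>, 1:]))"
    using assms(1) by (intro D_mult D_const) auto
  thus ?thesis
    using B by (simp add: D_def)
qed

end


subsection \<open>Key polynomials\<close>

lemma lookup_mult_eq_sum:
  fixes p q :: "'g::ab_group_add \<Rightarrow>\<^sub>0 'a::comm_ring_1"
  assumes "finite B" "Poly_Mapping.keys p \<subseteq> B"
  shows "Poly_Mapping.lookup (p * q) \<alpha> =
    (\<Sum>\<beta>\<in>B. Poly_Mapping.lookup p \<beta> * Poly_Mapping.lookup q (\<alpha> - \<beta>))"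
proof -
  have "(\<lambda>\<gamma>. Poly_Mapping.lookup q \<gamma> when \<alpha> = \<beta> + \<gamma>) =
        (\<lambda>\<gamma>. Poly_Mapping.lookup q \<gamma> when \<gamma> = \<alpha> - \<beta>)" for \<beta>
    by (intro ext arg_cong2[where f = "(when)"]) auto
  hence eq: "Sum_any (\<lambda>\<gamma>. Poly_Mapping.lookup q \<gamma> when \<alpha> = \<beta> + \<gamma>) =
             Poly_Mapping.lookup q (\<alpha> - \<beta>)" for \<beta>
    by (simp only: Sum_any_when_equal)
  have "Poly_Mapping.lookup p \<beta> = 0" if "\<beta> \<notin> B" for \<beta>
    using that assms(2) by (meson in_keys_iff subsetD)
  hence "{\<beta>. Poly_Mapping.lookup p \<beta> * Poly_Mapping.lookup q (\<alpha> - \<beta>) \<noteq> 0} \<subseteq> B"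
    by force
  thus ?thesis
    unfolding lookup_mult eq by (rule Sum_any.expand_superset[OF assms(1)])
qed

lemma lookup_single_mult:
  "Poly_Mapping.lookup (Poly_Mapping.single \<gamma> c * q) \<alpha> = c * Poly_Mapping.lookup q (\<alpha> - \<gamma>)"
  for q :: "'g::ab_group_add \<Rightarrow>\<^sub>0 'a::comm_ring_1"
  by (subst lookup_mult_eq_sum[of "{\<gamma>}"]) auto

lemma sum_P_ge_simps:
  "carrier (sum_P_ge \<mu>) = {p. \<forall>\<alpha>. Poly_Mapping.lookup p \<alpha> \<in> P_ge \<mu> \<alpha>}"
  "p \<oplus>\<^bsub>sum_P_ge \<mu>\<^esub> q = p + q" "p \<otimes>\<^bsub>sum_P_ge \<mu>\<^esub> q = p * q"
  "\<zero>\<^bsub>sum_P_ge \<mu>\<^esub> = 0" "\<one>\<^bsub>sum_P_ge \<mu>\<^esub> = 1"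
  by (auto simp: sum_P_ge_def ring_of_type_algebra_def)

context
  fixes \<mu> :: "'k::field poly \<Rightarrow> 'g::linordered_ab_group_add vinf"
  assumes \<mu>: "is_valuation \<mu>"
begin

interpretation R: cring "sum_P_ge \<mu>"
  by (rule cring_sum_P_ge[OF \<mu>])

interpretation I: ideal "sum_P_gt \<mu>" "sum_P_ge \<mu>"
  by (rule ideal_sum_P_gt[OF \<mu>])

interpretation G: cring "graded_algebra \<mu>"
  by (rule cring_graded_algebra[OF \<mu>])

text \<open>The quotient map onto the graded algebra, through which computations there are carried
  out on representatives.\<close>

definition cls :: "('g \<Rightarrow>\<^sub>0 'k poly) \<Rightarrow> ('g \<Rightarrow>\<^sub>0 'k poly) set" where
  "cls p = sum_P_gt \<mu> +>\<^bsub>sum_P_ge \<mu>\<^esub> p"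

lemma cls_hom: "cls \<in> ring_hom (sum_P_ge \<mu>) (graded_algebra \<mu>)"
  unfolding graded_algebra_def cls_def using I.rcos_ring_hom .

lemma cls_mult:
  "p \<in> carrier (sum_P_ge \<mu>) \<Longrightarrow> q \<in> carrier (sum_P_ge \<mu>) \<Longrightarrow>
    cls p \<otimes>\<^bsub>graded_algebra \<mu>\<^esub> cls q = cls (p * q)"
  using ring_hom_mult[OF cls_hom, of p q] by (simp add: sum_P_ge_simps(3))

lemma cls_one: "cls 1 = \<one>\<^bsub>graded_algebra \<mu>\<^esub>"
  using ring_hom_one[OF cls_hom] by (simp add: sum_P_ge_simps(5))

lemma cls_zero: "cls 0 = \<zero>\<^bsub>graded_algebra \<mu>\<^esub>"
  using ring_hom_zero[OF cls_hom R.ring_axioms G.ring_axioms] by (simp add: sum_P_ge_simps(4))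

lemma carrier_graded: "carrier (graded_algebra \<mu>) = cls ` carrier (sum_P_ge \<mu>)"
  by (auto simp: graded_algebra_def FactRing_def A_RCOSETS_def' cls_def)

lemma cls_eq_iff:
  assumes "p \<in> carrier (sum_P_ge \<mu>)" "q \<in> carrier (sum_P_ge \<mu>)"
  shows "cls p = cls q \<longleftrightarrow> p - q \<in> sum_P_gt \<mu>"
proof -
  have "- q \<in> carrier (sum_P_ge \<mu>)"
    using assms(2) P_closed(5)[OF \<mu>] by (auto simp: sum_P_ge_simps)
  hence "\<ominus>\<^bsub>sum_P_ge \<mu>\<^esub> q = - q"
    using assms(2) by (intro R.minus_equality) (auto simp: sum_P_ge_simps(2,4))
  hence "p \<ominus>\<^bsub>sum_P_ge \<mu>\<^esub> q = p - q"
    by (simp add: a_minus_def sum_P_ge_simps)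
  thus ?thesis
    using R.quotient_eq_iff_same_a_r_cos[OF I.ideal_axioms assms] by (simp add: cls_def)
qed

lemma single_in_P:
  "Poly_Mapping.single \<alpha> f \<in> carrier (sum_P_ge \<mu>) \<longleftrightarrow> Fin \<alpha> \<le> \<mu> f"
  "Poly_Mapping.single \<alpha> f \<in> sum_P_gt \<mu> \<longleftrightarrow> Fin \<alpha> < \<mu> f"
  using P_closed(1,2)[OF \<mu>]
  by (auto simp: sum_P_ge_simps sum_P_gt_def lookup_single when_def P_ge_def P_gt_def)

lemma initial_form_eq: "\<mu> f = Fin \<alpha> \<Longrightarrow> initial_form \<mu> f = cls (Poly_Mapping.single \<alpha> f)"
  by (simp add: initial_form_def cls_def)

text \<open>The hypothesis says that f and q * h have the same initial form, and that of q * h is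
  the product of those of q and h, both of finite value.\<close>

lemma val_dvdI:
  assumes "\<mu> f \<noteq> Infty" "\<mu> f < \<mu> (f - q * h)"
  shows "val_dvd \<mu> h f"
proof -
  have qh: "\<mu> (q * h) = \<mu> f"
    using valuation_less_add(3)[OF \<mu> assms(2)] by simp
  obtain \<alpha> where \<alpha>: "\<mu> f = Fin \<alpha>"
    using assms(1) by (cases "\<mu> f") auto
  obtain \<beta> \<gamma> where \<beta>\<gamma>: "\<mu> h = Fin \<beta>" "\<mu> q = Fin \<gamma>"
    using qh \<alpha> unfolding is_valuationD(3)[OF \<mu>] by (cases "\<mu> h"; cases "\<mu> q") auto
  hence sum: "\<gamma> + \<beta> = \<alpha>"
    using qh \<alpha> by (simp add: is_valuationD(3)[OF \<mu>])
  have c: "Poly_Mapping.single \<beta> h \<in> carrier (sum_P_ge \<mu>)" "Poly_Mapping.single \<gamma> q \<in> carrier (sum_P_ge \<mu>)"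
    "Poly_Mapping.single \<alpha> (q * h) \<in> carrier (sum_P_ge \<mu>)" "Poly_Mapping.single \<alpha> f \<in> carrier (sum_P_ge \<mu>)"
    by (auto simp: single_in_P \<beta>\<gamma> qh \<alpha>)
  have "initial_form \<mu> f = cls (Poly_Mapping.single \<alpha> (q * h))"
    unfolding initial_form_eq[OF \<alpha>] cls_eq_iff[OF c(4,3)] using assms(2) \<alpha>
    by (simp add: single_diff[symmetric] single_in_P)
  also have "Poly_Mapping.single \<alpha> (q * h) = Poly_Mapping.single \<beta> h * Poly_Mapping.single \<gamma> q"
    by (simp add: mult_single sum[symmetric] ac_simps)
  also have "cls \<dots> = initial_form \<mu> h \<otimes>\<^bsub>graded_algebra \<mu>\<^esub> cls (Poly_Mapping.single \<gamma> q)"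
    using c by (simp add: cls_mult initial_form_eq[OF \<beta>\<gamma>(1)])
  finally show ?thesis
    using c(2) by (auto simp: val_dvd_def factor_def carrier_graded)
qed

text \<open>The initial form of 1 is the unit element, so its ideal is not proper. This excludes
  constant key polynomials.\<close>

lemma one_notin_KP: "1 \<notin> KP \<mu>"
proof
  assume "1 \<in> KP \<mu>"
  hence prime: "primeideal (Idl\<^bsub>graded_algebra \<mu>\<^esub> {initial_form \<mu> 1}) (graded_algebra \<mu>)"
    by (simp add: KP_def val_irreducible_def)
  have "initial_form \<mu> 1 = cls 1"
    by (subst initial_form_eq[of _ 0]) (auto simp: is_valuationD[OF \<mu>] zero_vinf_def)
  hence "Idl\<^bsub>graded_algebra \<mu>\<^esub> {initial_form \<mu> 1} = carrier (graded_algebra \<mu>)"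
    by (simp add: cls_one G.genideal_one)
  thus False
    using primeideal.I_notcarr[OF prime] by simp
qed

section \<open>Kernel of the map between the graded algebras of \<mu> and \<nu>\<close>

context
  fixes \<nu> :: "'k poly \<Rightarrow> 'g vinf" and \<psi> :: "'k poly"
  assumes \<nu>: "is_valuation \<nu>" and le: "\<And>f. \<mu> f \<le> \<nu> f" and less: "\<mu> \<psi> < \<nu> \<psi>"
    and small: "\<And>a. degree a < degree \<psi> \<Longrightarrow> \<mu> a = \<nu> a"
begin

text \<open>A nonzero constant is invertible, and its value and that of its inverse add up to 0
  under both valuations; a strict increase at one would force a decrease at the other.\<close>

lemma degree_pos: "degree \<psi> > 0"
proof (rule ccontr)
  assume "\<not> degree \<psi> > 0"
  then obtain c where c: "\<psi> = [:c:]"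
    by (metis degree_eq_zeroE gr0I)
  hence "c \<noteq> 0"
    using less is_valuationD(1)[OF \<mu>] by auto
  hence inv: "\<psi> * [:inverse c:] = 1"
    by (simp add: c one_pCons)
  have "\<mu> \<psi> + \<mu> [:inverse c:] = 0" "\<nu> \<psi> + \<nu> [:inverse c:] = 0"
    using inv is_valuationD(2,3)[OF \<mu>] is_valuationD(2,3)[OF \<nu>] by metis+
  moreover from this have "\<mu> [:inverse c:] \<noteq> Infty"
    by (auto simp: zero_vinf_def)
  ultimately show False
    using vinf_add_less_le[OF less le[of "[:inverse c:]"]] by simp
qed

text \<open>Suppose the remainder has value at most that of f under \<mu>. Then f and the multiple
  of \<psi> both have larger value than this under \<nu>, hence so has the remainder; but its degree
  is too small for its value to change. So the initial form of f is that of the multiple of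
  \<psi>.\<close>

lemma initial_division:
  assumes "\<mu> f < \<nu> f"
  shows "\<mu> f < \<mu> (f mod \<psi>)" "\<mu> (f div \<psi>) + \<mu> \<psi> = \<mu> f"
proof -
  have \<psi>: "\<psi> \<noteq> 0"
    using degree_pos by auto
  have "\<mu> (f mod \<psi>) = \<nu> (f mod \<psi>)"
    using degree_mod_less[OF \<psi>, of f] degree_pos by (intro small) auto
  have eq: "f - f mod \<psi> = f div \<psi> * \<psi>"
    by (simp add: minus_mod_eq_div_mult)
  show *: "\<mu> f < \<mu> (f mod \<psi>)"
  proof (rule ccontr)
    assume "\<not> \<mu> f < \<mu> (f mod \<psi>)"
    hence c: "\<mu> (f mod \<psi>) \<le> \<mu> f"
      by simp
    have fin: "\<mu> (f mod \<psi>) \<noteq> Infty"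
      using c assms by auto
    have "\<mu> (f mod \<psi>) \<le> \<mu> (f div \<psi> * \<psi>)"
      using is_valuationD(6)[OF \<mu>, of f "f mod \<psi>"] c by (simp add: eq min_def split: if_splits)
    also have "\<dots> = \<mu> (f div \<psi>) + \<mu> \<psi>"
      by (rule is_valuationD(3)[OF \<mu>])
    finally have 1: "\<mu> (f mod \<psi>) \<le> \<mu> (f div \<psi>) + \<mu> \<psi>" .
    have "\<mu> (f mod \<psi>) < \<nu> (f div \<psi>) + \<nu> \<psi>"
    proof (cases "\<mu> (f div \<psi>) = Infty")
      case True
      thus ?thesis
        using le[of "f div \<psi>"] fin by (cases "\<mu> (f mod \<psi>)") auto
    next
      case False
      from 1 show ?thesis
        using vinf_add_le_less[OF less le[of "f div \<psi>"] False] by simp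
    qed
    moreover have "\<mu> (f mod \<psi>) < \<nu> f"
      using c assms by simp
    ultimately have "\<mu> (f mod \<psi>) < \<nu> (f - f div \<psi> * \<psi>)"
      using less_le_trans[OF _ is_valuationD(6)[OF \<nu>, of f "f div \<psi> * \<psi>"], of "\<mu> (f mod \<psi>)"]
      by (simp add: is_valuationD(3)[OF \<nu>])
    moreover have "f - f div \<psi> * \<psi> = f mod \<psi>"
      using eq by (simp add: algebra_simps)
    ultimately show False
      using \<open>\<mu> (f mod \<psi>) = \<nu> (f mod \<psi>)\<close> by simp
  qed
  show "\<mu> (f div \<psi>) + \<mu> \<psi> = \<mu> f"
    using valuation_less_add(3)[OF \<mu> *] by (simp add: eq is_valuationD(3)[OF \<mu>])
qed

text \<open>The preimage in \<open>sum_P_ge \<mu>\<close> of the kernel of the map from the graded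
  algebra of \<mu> to that of \<nu>. Working with it avoids constructing the map.\<close>

definition J :: "('g \<Rightarrow>\<^sub>0 'k poly) set" where
  "J = carrier (sum_P_ge \<mu>) \<inter> sum_P_gt \<nu>"

lemma P_ge_mono: "carrier (sum_P_ge \<mu>) \<subseteq> carrier (sum_P_ge \<nu>)"
  using order_trans[OF _ le] by (auto simp: sum_P_ge_simps P_ge_def)

lemma I_subset_J: "sum_P_gt \<mu> \<subseteq> J"
  using less_le_trans[OF _ le] I.a_subset by (auto simp: J_def sum_P_gt_def P_gt_def)

text \<open>J contains the ideal that is divided out, so membership does not depend on the
  representative.\<close>

lemma cls_mem_J_iff: "p \<in> carrier (sum_P_ge \<mu>) \<Longrightarrow> cls p \<in> cls ` J \<longleftrightarrow> p \<in> J"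
proof
  assume p: "p \<in> carrier (sum_P_ge \<mu>)" and "cls p \<in> cls ` J"
  then obtain j where j: "j \<in> J" "cls p = cls j"
    by auto
  hence "p - j \<in> sum_P_gt \<mu>"
    using p by (subst cls_eq_iff[symmetric]) (auto simp: J_def)
  hence "p - j \<in> sum_P_gt \<nu>" "j \<in> sum_P_gt \<nu>"
    using j I_subset_J by (auto simp: J_def)
  hence "Poly_Mapping.lookup (p - j) \<alpha> + Poly_Mapping.lookup j \<alpha> \<in> P_gt \<nu> \<alpha>" for \<alpha>
    by (intro P_closed(4)[OF \<nu>]) (auto simp: sum_P_gt_def)
  hence "p \<in> sum_P_gt \<nu>"
    by (simp add: sum_P_gt_def lookup_minus)
  thus "p \<in> J"
    using p by (simp add: J_def)
qed auto

text \<open>Multiples of the initial form of \<psi> lie in the kernel because \<psi> gains value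
  under \<nu>. Conversely, \<open>initial_division\<close> is applied to each homogeneous component
  of an element of J.\<close>

lemma Idl_eq:
  "Idl\<^bsub>graded_algebra \<mu>\<^esub> {initial_form \<mu> \<psi>} = cls ` J"
proof -
  obtain \<gamma> where \<gamma>: "\<mu> \<psi> = Fin \<gamma>"
    using less by (cases "\<mu> \<psi>") auto
  let ?\<psi> = "Poly_Mapping.single \<gamma> \<psi>"
  have \<psi>: "?\<psi> \<in> carrier (sum_P_ge \<mu>)" "?\<psi> \<in> J"
    using less \<gamma> by (auto simp: single_in_P J_def sum_P_gt_def P_gt_def lookup_single when_def is_valuationD(1)[OF \<nu>])
  have "initial_form \<mu> \<psi> \<in> carrier (graded_algebra \<mu>)"
    using \<psi> by (auto simp: initial_form_eq[OF \<gamma>] carrier_graded)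
  hence "Idl\<^bsub>graded_algebra \<mu>\<^esub> {initial_form \<mu> \<psi>} = PIdl\<^bsub>graded_algebra \<mu>\<^esub> (initial_form \<mu> \<psi>)"
    by (simp add: G.cgenideal_eq_genideal)
  also have "\<dots> = {cls (q * ?\<psi>) | q. q \<in> carrier (sum_P_ge \<mu>)}"
    using \<psi>(1) by (force simp: cgenideal_def carrier_graded initial_form_eq[OF \<gamma>] cls_mult)
  also have "\<dots> = cls ` J"
  proof safe
    fix q assume q: "q \<in> carrier (sum_P_ge \<mu>)"
    have "q * ?\<psi> \<in> carrier (sum_P_ge \<mu>)"
      using R.m_closed[OF q \<psi>(1)] by (simp add: sum_P_ge_simps(3))
    moreover have "q \<otimes>\<^bsub>sum_P_ge \<nu>\<^esub> ?\<psi> \<in> sum_P_gt \<nu>"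
      using ideal.I_l_closed[OF ideal_sum_P_gt[OF \<nu>]] \<psi>(2) q P_ge_mono by (auto simp: J_def)
    ultimately show "cls (q * ?\<psi>) \<in> cls ` J"
      by (auto simp: J_def sum_P_ge_simps(3))
  next
    fix p assume p: "p \<in> J"
    \<comment> \<open>A component of value above its degree vanishes in the quotient and gets
      quotient 0; the others are divided by \<psi>.\<close>
    define h where "h \<alpha> = (if \<mu> (Poly_Mapping.lookup p \<alpha>) = Fin \<alpha> then Poly_Mapping.lookup p \<alpha> div \<psi> else 0)" for \<alpha>
    have "\<beta> \<in> (\<lambda>\<alpha>. \<alpha> - \<gamma>) ` Poly_Mapping.keys p" if "h (\<beta> + \<gamma>) \<noteq> 0" for \<beta>
      using that by (intro image_eqI[of _ _ "\<beta> + \<gamma>"]) (auto simp: h_def in_keys_iff split: if_splits)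
    hence "{\<beta>. h (\<beta> + \<gamma>) \<noteq> 0} \<subseteq> (\<lambda>\<alpha>. \<alpha> - \<gamma>) ` Poly_Mapping.keys p"
      by blast
    hence fin: "finite {\<beta>. h (\<beta> + \<gamma>) \<noteq> 0}"
      by (rule finite_subset) auto
    \<comment> \<open>As \<psi> sits in degree \<gamma>, the quotient of the component in degree
      \<beta> + \<gamma> belongs to degree \<beta>.\<close>
    define q where "q = Abs_poly_mapping (\<lambda>\<beta>. h (\<beta> + \<gamma>))"
    have lq: "Poly_Mapping.lookup q \<beta> = h (\<beta> + \<gamma>)" for \<beta>
      unfolding q_def using fin by (simp add: lookup_Abs_poly_mapping)
    have pJ: "Fin \<alpha> \<le> \<mu> (Poly_Mapping.lookup p \<alpha>)" "Fin \<alpha> < \<nu> (Poly_Mapping.lookup p \<alpha>)" for \<alpha>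
      using p by (auto simp: J_def sum_P_ge_simps P_ge_def sum_P_gt_def P_gt_def)
    have q: "q \<in> carrier (sum_P_ge \<mu>)"
      unfolding sum_P_ge_simps
    proof safe
      fix \<beta>
      show "Poly_Mapping.lookup q \<beta> \<in> P_ge \<mu> \<beta>"
      proof (cases "\<mu> (Poly_Mapping.lookup p (\<beta> + \<gamma>)) = Fin (\<beta> + \<gamma>)")
        case True
        have "\<mu> (Poly_Mapping.lookup p (\<beta> + \<gamma>) div \<psi>) + Fin \<gamma> = Fin (\<beta> + \<gamma>)"
          using initial_division(2)[of "Poly_Mapping.lookup p (\<beta> + \<gamma>)"] pJ(2)[of "\<beta> + \<gamma>"] by (simp add: True \<gamma>)
        thus ?thesis
          using True by (cases "\<mu> (Poly_Mapping.lookup p (\<beta> + \<gamma>) div \<psi>)") (auto simp: lq h_def P_ge_def)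
      qed (auto simp: lq h_def P_ge_def is_valuationD(1)[OF \<mu>])
    qed
    have q\<psi>: "q * ?\<psi> \<in> carrier (sum_P_ge \<mu>)"
      using R.m_closed[OF q \<psi>(1)] by (simp add: sum_P_ge_simps(3))
    have "p - q * ?\<psi> \<in> sum_P_gt \<mu>"
      unfolding sum_P_gt_def P_gt_def
    proof safe
      fix \<alpha>
      have "Poly_Mapping.lookup (q * ?\<psi>) \<alpha> = h \<alpha> * \<psi>"
        by (simp add: mult.commute[of q] lookup_single_mult lq mult.commute[of \<psi>])
      hence *: "Poly_Mapping.lookup (p - q * ?\<psi>) \<alpha> = Poly_Mapping.lookup p \<alpha> - h \<alpha> * \<psi>"
        by (simp add: lookup_minus)
      show "Fin \<alpha> < \<mu> (Poly_Mapping.lookup (p - q * ?\<psi>) \<alpha>)"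
      proof (cases "\<mu> (Poly_Mapping.lookup p \<alpha>) = Fin \<alpha>")
        case True
        hence "Fin \<alpha> < \<mu> (Poly_Mapping.lookup p \<alpha> mod \<psi>)"
          using initial_division(1)[of "Poly_Mapping.lookup p \<alpha>"] pJ(2)[of \<alpha>] by simp
        thus ?thesis
          unfolding * by (simp add: h_def True minus_div_mult_eq_mod)
      next
        case False
        thus ?thesis
          unfolding * using pJ(1)[of \<alpha>] by (simp add: h_def order_less_le)
      qed
    qed
    hence "cls p = cls (q * ?\<psi>)"
      using p q\<psi> by (subst cls_eq_iff) (auto simp: J_def)
    thus "\<exists>q. cls p = cls (q * ?\<psi>) \<and> q \<in> carrier (sum_P_ge \<mu>)"
      using q by blast
  qed
  finally show ?thesis .
qed

text \<open>The argument that a graded ring without homogeneous zero divisors has no zero divisors: the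
  product of the components of lowest degree outside \<open>J\<close> is the only contribution outside \<open>J\<close>.\<close>

lemma J_prime:
  assumes "p \<in> carrier (sum_P_ge \<mu>)" "q \<in> carrier (sum_P_ge \<mu>)" "p * q \<in> J"
  shows "p \<in> J \<or> q \<in> J"
proof (rule ccontr)
  assume neg: "\<not> (p \<in> J \<or> q \<in> J)"
  have lowest: "\<exists>\<alpha>. \<nu> (Poly_Mapping.lookup p \<alpha>) = Fin \<alpha> \<and> (\<forall>\<beta><\<alpha>. Fin \<beta> < \<nu> (Poly_Mapping.lookup p \<beta>))"
    if "p \<in> carrier (sum_P_ge \<mu>)" "p \<notin> J" for p
  proof -
    \<comment> \<open>The degrees of the components that survive modulo
      \<open>sum_P_gt \<nu>\<close>. They are finitely many, as such components are nonzero.\<close>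
    define S where "S = {\<alpha>. \<nu> (Poly_Mapping.lookup p \<alpha>) = Fin \<alpha>}"
    have ge: "Fin \<alpha> \<le> \<nu> (Poly_Mapping.lookup p \<alpha>)" for \<alpha>
      using that(1) P_ge_mono by (auto simp: sum_P_ge_simps P_ge_def)
    have "S \<subseteq> Poly_Mapping.keys p"
      by (auto simp: S_def in_keys_iff is_valuationD(1)[OF \<nu>])
    hence fin: "finite S"
      by (rule finite_subset) auto
    have "p \<notin> sum_P_gt \<nu>"
      using that by (simp add: J_def)
    then obtain \<alpha> where "\<not> Fin \<alpha> < \<nu> (Poly_Mapping.lookup p \<alpha>)"
      unfolding sum_P_gt_def P_gt_def by blast
    hence "\<alpha> \<in> S"
      using ge[of \<alpha>] by (simp add: S_def)
    hence "S \<noteq> {}"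
      by blast
    hence "Min S \<in> S"
      using fin by (intro Min_in)
    moreover have "Fin \<beta> < \<nu> (Poly_Mapping.lookup p \<beta>)" if "\<beta> < Min S" for \<beta>
    proof -
      have "\<beta> \<notin> S"
        using Min_le[OF fin, of \<beta>] that by auto
      thus ?thesis
        using ge[of \<beta>] by (auto simp: S_def)
    qed
    ultimately show ?thesis
      unfolding S_def by blast
  qed
  obtain \<alpha> where \<alpha>: "\<nu> (Poly_Mapping.lookup p \<alpha>) = Fin \<alpha>" "\<And>\<beta>. \<beta> < \<alpha> \<Longrightarrow> Fin \<beta> < \<nu> (Poly_Mapping.lookup p \<beta>)"
    using lowest[OF assms(1)] neg by blast
  obtain \<beta> where \<beta>: "\<nu> (Poly_Mapping.lookup q \<beta>) = Fin \<beta>" "\<And>\<gamma>. \<gamma> < \<beta> \<Longrightarrow> Fin \<gamma> < \<nu> (Poly_Mapping.lookup q \<gamma>)"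
    using lowest[OF assms(2)] neg by blast
  have ge: "Fin \<gamma> \<le> \<nu> (Poly_Mapping.lookup p \<gamma>)" "Fin \<gamma> \<le> \<nu> (Poly_Mapping.lookup q \<gamma>)" for \<gamma>
    using assms(1,2) P_ge_mono by (auto simp: sum_P_ge_simps P_ge_def)
  let ?t = "\<lambda>\<gamma>. Poly_Mapping.lookup p \<gamma> * Poly_Mapping.lookup q (\<alpha> + \<beta> - \<gamma>)"
  have "\<alpha> \<in> Poly_Mapping.keys p"
    using \<alpha>(1) by (auto simp: in_keys_iff is_valuationD(1)[OF \<nu>])
  hence "Poly_Mapping.lookup (p * q) (\<alpha> + \<beta>) = ?t \<alpha> + (\<Sum>\<gamma>\<in>Poly_Mapping.keys p - {\<alpha>}. ?t \<gamma>)"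
    by (subst lookup_mult_eq_sum[of "Poly_Mapping.keys p"]) (auto simp: sum.remove)
  moreover have "\<nu> (?t \<alpha>) = Fin (\<alpha> + \<beta>)"
    using \<alpha>(1) \<beta>(1) by (simp add: is_valuationD(3)[OF \<nu>])
  moreover have "Fin (\<alpha> + \<beta>) < \<nu> (\<Sum>\<gamma>\<in>Poly_Mapping.keys p - {\<alpha>}. ?t \<gamma>)"
  proof (rule valuation_sum_gt[OF \<nu>])
    fix \<gamma> assume "\<gamma> \<in> Poly_Mapping.keys p - {\<alpha>}"
    hence "\<gamma> < \<alpha> \<or> \<alpha> + \<beta> - \<gamma> < \<beta>"
      by (cases "\<gamma> < \<alpha>") (auto simp: diff_less_eq)
    hence "Fin (\<gamma> + (\<alpha> + \<beta> - \<gamma>)) < \<nu> (Poly_Mapping.lookup p \<gamma>) + \<nu> (Poly_Mapping.lookup q (\<alpha> + \<beta> - \<gamma>))"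
      using vinf_add_mono(2)[OF ge(2)[of "\<alpha> + \<beta> - \<gamma>"] \<alpha>(2)[of \<gamma>]] vinf_add_mono(2)[OF ge(1)[of \<gamma>] \<beta>(2)[of "\<alpha> + \<beta> - \<gamma>"]]
      by (auto simp: add.commute)
    thus "Fin (\<alpha> + \<beta>) < \<nu> (?t \<gamma>)"
      by (simp add: is_valuationD(3)[OF \<nu>])
  qed simp
  ultimately have "\<nu> (Poly_Mapping.lookup (p * q) (\<alpha> + \<beta>)) = Fin (\<alpha> + \<beta>)"
    using valuation_less_add(1)[OF \<nu>, of "?t \<alpha>"] by simp
  thus False
    using assms(3) by (auto simp: J_def sum_P_gt_def P_gt_def dest: spec[of _ "\<alpha> + \<beta>"])
qed

text \<open>Irreducibility is the primality of the kernel. For minimality, a multiple of the initial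
  form of \<psi> lies in the kernel, whereas polynomials of smaller degree keep their value. The
  assumption \<open>supp\<close> rules out initial form 0, which everything divides.\<close>

lemma in_KP:
  assumes monic: "monic \<psi>" and supp: "\<And>f. f \<noteq> 0 \<Longrightarrow> \<mu> f \<noteq> Infty"
  shows "\<psi> \<in> KP \<mu>"
proof -
  obtain \<gamma> where \<gamma>: "\<mu> \<psi> = Fin \<gamma>"
    using less by (cases "\<mu> \<psi>") auto
  have \<psi>: "Poly_Mapping.single \<gamma> \<psi> \<in> carrier (sum_P_ge \<mu>)"
    by (simp add: single_in_P \<gamma>)
  hence init: "initial_form \<mu> \<psi> \<in> carrier (graded_algebra \<mu>)"
    by (auto simp: initial_form_eq[OF \<gamma>] carrier_graded)
  hence ideal: "ideal (cls ` J) (graded_algebra \<mu>)"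
    using G.genideal_ideal[of "{initial_form \<mu> \<psi>}"] by (simp add: Idl_eq)
  have "primeideal (cls ` J) (graded_algebra \<mu>)"
  proof (rule primeidealI[OF ideal G.is_cring])
    have "1 \<in> carrier (sum_P_ge \<mu>)"
      using R.one_closed by (simp add: sum_P_ge_simps)
    moreover have "1 \<notin> sum_P_gt \<nu>"
    proof
      assume "1 \<in> sum_P_gt \<nu>"
      hence "Poly_Mapping.lookup 1 (0::'g) \<in> P_gt \<nu> 0"
        unfolding sum_P_gt_def by blast
      thus False
        by (simp add: P_gt_def lookup_one is_valuationD(2)[OF \<nu>] zero_vinf_def)
    qed
    hence "1 \<notin> J"
      by (simp add: J_def)
    ultimately show "carrier (graded_algebra \<mu>) \<noteq> cls ` J"
      unfolding carrier_graded by (metis cls_mem_J_iff imageI)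
    fix a b assume "a \<in> carrier (graded_algebra \<mu>)" "b \<in> carrier (graded_algebra \<mu>)"
      and ab: "a \<otimes>\<^bsub>graded_algebra \<mu>\<^esub> b \<in> cls ` J"
    then obtain p q where pq: "p \<in> carrier (sum_P_ge \<mu>)" "q \<in> carrier (sum_P_ge \<mu>)" "a = cls p" "b = cls q"
      by (auto simp: carrier_graded)
    have "p * q \<in> carrier (sum_P_ge \<mu>)"
      using R.m_closed[OF pq(1,2)] by (simp add: sum_P_ge_simps(3))
    hence "p * q \<in> J"
      using ab pq by (simp add: cls_mult cls_mem_J_iff)
    thus "a \<in> cls ` J \<or> b \<in> cls ` J"
      using J_prime[OF pq(1,2)] pq by auto
  qed
  moreover have "cls ` J \<noteq> {\<zero>\<^bsub>graded_algebra \<mu>\<^esub>}"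
  proof
    assume "cls ` J = {\<zero>\<^bsub>graded_algebra \<mu>\<^esub>}"
    moreover have "initial_form \<mu> \<psi> \<in> cls ` J"
      using G.genideal_self[of "{initial_form \<mu> \<psi>}"] init by (simp add: Idl_eq)
    ultimately have "cls (Poly_Mapping.single \<gamma> \<psi>) = cls 0"
      by (simp add: cls_zero initial_form_eq[OF \<gamma>])
    thus False
      using \<psi> by (subst (asm) cls_eq_iff) (auto simp: single_in_P \<gamma> sum_P_ge_simps P_closed(1)[OF \<mu>])
  qed
  moreover have "\<not> val_dvd \<mu> \<psi> f" if f: "f \<noteq> 0" "degree f < degree \<psi>" for f
  proof
    assume "val_dvd \<mu> \<psi> f"
    then obtain c where c: "c \<in> carrier (graded_algebra \<mu>)"
      "initial_form \<mu> f = initial_form \<mu> \<psi> \<otimes>\<^bsub>graded_algebra \<mu>\<^esub> c"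
      by (auto simp: val_dvd_def factor_def)
    obtain \<alpha> where \<alpha>: "\<mu> f = Fin \<alpha>"
      using supp[OF f(1)] by (cases "\<mu> f") auto
    have "initial_form \<mu> f \<in> cls ` J"
      unfolding c(2) Idl_eq[symmetric] using init G.genideal_self[of "{initial_form \<mu> \<psi>}"] c(1)
      by (intro ideal.I_r_closed[OF G.genideal_ideal]) auto
    hence "Poly_Mapping.single \<alpha> f \<in> J"
      by (simp add: initial_form_eq[OF \<alpha>] cls_mem_J_iff single_in_P \<alpha>)
    hence "Fin \<alpha> < \<nu> f"
      by (auto simp: J_def sum_P_gt_def P_gt_def dest: spec[of _ \<alpha>])
    thus False
      using small[OF f(2)] \<alpha> by simp
  qed
  ultimately show ?thesis
    using monic by (auto simp: KP_def val_irreducible_def val_minimal_def Idl_eq)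
qed

end

end


subsection \<open>Conjugate elements\<close>

abbreviation ac_poly :: "'k::field poly \<Rightarrow> 'k alg_closure poly" where
  "ac_poly \<equiv> map_poly to_ac"

lemma ac_poly_simps [simp]:
  "ac_poly (p + q) = ac_poly p + ac_poly q"
  "ac_poly (p * q) = ac_poly p * ac_poly q"
  "ac_poly (p - q) = ac_poly p - ac_poly q"
  "ac_poly (pCons c p) = pCons (to_ac c) (ac_poly p)"
  "degree (ac_poly p) = degree p"
  "ac_poly p = 0 \<longleftrightarrow> p = 0"
  by (auto intro!: poly_eqI simp: coeff_map_poly coeff_mult to_ac_sum map_poly_pCons
      degree_map_poly map_poly_eq_0_iff)

text \<open>A polynomial h of least degree vanishing at x divides both P and f. It is not a unit, so
  irreducibility gives that P divides h.\<close>

lemma irreducible_dvd_of_common_root: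
  fixes P f :: "'k::field poly" and x :: "'k alg_closure"
  assumes "irreducible P" "poly (ac_poly P) x = 0" "poly (ac_poly f) x = 0"
  shows "P dvd f"
proof -
  have "P \<noteq> 0"
    using assms(1) by auto
  then obtain h where h: "h \<noteq> 0" "poly (ac_poly h) x = 0"
    and least: "\<And>g. g \<noteq> 0 \<Longrightarrow> poly (ac_poly g) x = 0 \<Longrightarrow> degree h \<le> degree g"
    using ex_has_least_nat[of "\<lambda>h. h \<noteq> 0 \<and> poly (ac_poly h) x = 0" P degree] assms(2) by blast
  have dvd: "h dvd g" if "poly (ac_poly g) x = 0" for g
  proof -
    have "ac_poly g = ac_poly (g div h) * ac_poly h + ac_poly (g mod h)"
      by (simp flip: ac_poly_simps(1,2))
    hence "poly (ac_poly (g mod h)) x = 0"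
      using that h by simp
    hence "g mod h = 0"
      using least[of "g mod h"] degree_mod_less[OF h(1), of g] leD by blast
    thus ?thesis
      by (simp add: dvd_eq_mod_eq_0)
  qed
  have "\<not> is_unit h"
  proof
    assume "is_unit h"
    then obtain g where "1 = h * g"
      by (auto simp: dvd_def)
    hence "poly (ac_poly 1) x = poly (ac_poly h * ac_poly g) x"
      by (simp flip: ac_poly_simps(2))
    thus False
      using h by simp
  qed
  hence "P dvd h"
    using irreducibleD'[OF assms(1) dvd[OF assms(2)]] by blast
  thus ?thesis
    using dvd[OF assms(3)] by (rule dvd_trans)
qed

text \<open>The graph of a homomorphism over the base field from a subring of the algebraic closure.\<close>

definition partial_hom :: "('k::field alg_closure \<times> 'k alg_closure) set \<Rightarrow> bool" where
  "partial_hom R \<longleftrightarrow> (\<forall>c. (to_ac c, to_ac c) \<in> R) \<and>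
     (\<forall>a b a' b'. (a, b) \<in> R \<longrightarrow> (a', b') \<in> R \<longrightarrow> (a + a', b + b') \<in> R \<and> (a * a', b * b') \<in> R) \<and>
     (\<forall>b. (0, b) \<in> R \<longrightarrow> b = 0)"

text \<open>The action of the partial homomorphism on polynomials, coefficient by
  coefficient.\<close>

definition poly_pairs :: "('k::field alg_closure \<times> 'k alg_closure) set \<Rightarrow>
    ('k alg_closure poly \<times> 'k alg_closure poly) set" where
  "poly_pairs R = {(p, q). \<forall>i. (coeff p i, coeff q i) \<in> R}"

context
  fixes R :: "('k::field alg_closure \<times> 'k alg_closure) set"
  assumes R: "partial_hom R"
begin

lemma pair_const: "(to_ac c, to_ac c) \<in> R" "(0, 0) \<in> R" "(1, 1) \<in> R"
  using R to_ac_0 to_ac_1 unfolding partial_hom_def by metis+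

lemma pair_add: "(a, b) \<in> R \<Longrightarrow> (a', b') \<in> R \<Longrightarrow> (a + a', b + b') \<in> R"
  and pair_mult: "(a, b) \<in> R \<Longrightarrow> (a', b') \<in> R \<Longrightarrow> (a * a', b * b') \<in> R"
  and pair_zero: "(0, b) \<in> R \<Longrightarrow> b = 0"
  using R unfolding partial_hom_def by blast+

lemma pair_uminus: "(a, b) \<in> R \<Longrightarrow> (- a, - b) \<in> R"
  using pair_mult[OF pair_const(1)[of "- 1"]] by simp

lemma pair_diff: "(a, b) \<in> R \<Longrightarrow> (a', b') \<in> R \<Longrightarrow> (a - a', b - b') \<in> R"
  using pair_add[OF _ pair_uminus, of a b a' b'] by simp

text \<open>Closure under differences turns triviality over 0 into single-valuedness.\<close>

lemma pair_unique: "(a, b) \<in> R \<Longrightarrow> (a, b') \<in> R \<Longrightarrow> b = b'"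
  using pair_zero[of "b - b'"] pair_diff[of a b a b'] by simp

lemma pair_sum: "(\<And>i. i \<in> A \<Longrightarrow> (f i, g i) \<in> R) \<Longrightarrow> (sum f A, sum g A) \<in> R"
  by (induction A rule: infinite_finite_induct) (auto intro: pair_add pair_const)

lemma pair_eval: "(a, b) \<in> R \<Longrightarrow> (poly (ac_poly f) a, poly (ac_poly f) b) \<in> R"
  by (induction f) (auto intro: pair_add pair_mult pair_const)

lemma poly_pairs_pCons:
  "(pCons a p, pCons b q) \<in> poly_pairs R \<longleftrightarrow> (a, b) \<in> R \<and> (p, q) \<in> poly_pairs R"
  by (force simp: poly_pairs_def coeff_pCons split: nat.splits)

lemma poly_pairs_const: "(ac_poly f, ac_poly f) \<in> poly_pairs R" "(0, 0) \<in> poly_pairs R"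
  by (auto simp: poly_pairs_def coeff_map_poly pair_const)

lemma poly_pairs_add: "(p, q) \<in> poly_pairs R \<Longrightarrow> (p', q') \<in> poly_pairs R \<Longrightarrow> (p + p', q + q') \<in> poly_pairs R"
  by (auto simp: poly_pairs_def pair_add)

lemma poly_pairs_diff: "(p, q) \<in> poly_pairs R \<Longrightarrow> (p', q') \<in> poly_pairs R \<Longrightarrow> (p - p', q - q') \<in> poly_pairs R"
  by (auto simp: poly_pairs_def pair_diff)

lemma poly_pairs_smult: "(a, b) \<in> R \<Longrightarrow> (p, q) \<in> poly_pairs R \<Longrightarrow> (smult a p, smult b q) \<in> poly_pairs R"
  by (auto simp: poly_pairs_def pair_mult)

lemma poly_pairs_mult: "(p, q) \<in> poly_pairs R \<Longrightarrow> (p', q') \<in> poly_pairs R \<Longrightarrow> (p * p', q * q') \<in> poly_pairs R"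
  by (auto simp: poly_pairs_def coeff_mult intro!: pair_sum pair_mult)

lemma poly_pairs_zero: "(0, q) \<in> poly_pairs R \<Longrightarrow> q = 0"
  by (auto simp: poly_pairs_def intro!: poly_eqI pair_zero)

text \<open>Write a polynomial of least degree vanishing at a as c + x g. Then c is nonzero and the
  inverse of a is a polynomial in a over the base field; b satisfies the same equation, so the same
  formula inverts b.\<close>

lemma pair_inverse:
  assumes "(a, b) \<in> R" "a \<noteq> 0"
  shows "(inverse a, inverse b) \<in> R"
proof -
  obtain p :: "'k poly" where "p \<noteq> 0" "poly (ac_poly p) a = 0"
    using alg_closure_algebraic by blast
  then obtain h where h: "h \<noteq> 0" "poly (ac_poly h) a = 0"
    and least: "\<And>g. g \<noteq> 0 \<Longrightarrow> poly (ac_poly g) a = 0 \<Longrightarrow> degree h \<le> degree g"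
    using ex_has_least_nat[of "\<lambda>h. h \<noteq> 0 \<and> poly (ac_poly h) a = 0" p degree] by blast
  obtain c g where hg: "h = pCons c g"
    by (cases h) auto
  have c: "c \<noteq> 0"
  proof
    assume "c = 0"
    thus False
      using h least[of g] assms(2) by (auto simp: hg)
  qed
  have "(poly (ac_poly h) a, poly (ac_poly h) b) \<in> R"
    by (rule pair_eval[OF assms(1)])
  hence "poly (ac_poly h) b = 0"
    using h pair_zero by simp
  hence "a * poly (ac_poly g) a = - to_ac c" "b * poly (ac_poly g) b = - to_ac c"
    using h by (auto simp: hg eq_neg_iff_add_eq_0 add.commute)
  hence "a * (poly (ac_poly g) a * to_ac (- inverse c)) = 1" "b * (poly (ac_poly g) b * to_ac (- inverse c)) = 1"
    using c by (simp_all flip: mult.assoc)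
  hence "inverse a = poly (ac_poly g) a * to_ac (- inverse c)" "inverse b = poly (ac_poly g) b * to_ac (- inverse c)"
    by (metis inverse_unique)+
  thus ?thesis
    using pair_mult[OF pair_eval[OF assms(1), of g] pair_const(1)[of "- inverse c"]] by simp
qed

text \<open>Division by the monic \<open>p\<^sub>0\<close> uses only ring operations on
  coefficients, so each of its steps can be mirrored on the second components.\<close>

lemma poly_pairs_division:
  assumes "(p\<^sub>0, q\<^sub>0) \<in> poly_pairs R" "coeff p\<^sub>0 n = 1" "\<And>i. i > n \<Longrightarrow> coeff p\<^sub>0 i = 0" "n > 0"
    and "(p, q) \<in> poly_pairs R"
  shows "\<exists>s t r r'. (s, t) \<in> poly_pairs R \<and> (r, r') \<in> poly_pairs R \<and> p = s * p\<^sub>0 + r \<and> q = t * q\<^sub>0 + r' \<and>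
    (\<forall>i\<ge>n. coeff r i = 0)"
  using assms(5)
proof (induction p arbitrary: q)
  case 0
  thus ?case
    using poly_pairs_zero[of q] poly_pairs_const(2)
    by (intro exI[of _ 0]) auto
next
  case (pCons a p)
  obtain b q' where q: "q = pCons b q'"
    by (cases q) auto
  have ab: "(a, b) \<in> R" and pq: "(p, q') \<in> poly_pairs R"
    using pCons.prems by (auto simp: q poly_pairs_pCons)
  obtain s t r r' where IH: "(s, t) \<in> poly_pairs R" "(r, r') \<in> poly_pairs R" "p = s * p\<^sub>0 + r"
    "q' = t * q\<^sub>0 + r'" "\<And>i. i \<ge> n \<Longrightarrow> coeff r i = 0"
    using pCons.IH[OF pq] by blast
  \<comment> \<open>Shifting the old remainder can produce a coefficient at index n; subtracting c
    times \<open>p\<^sub>0\<close> removes it.\<close>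
  define c d where "c = coeff (pCons a r) n" and "d = coeff (pCons b r') n"
  have 1: "(pCons a r, pCons b r') \<in> poly_pairs R"
    using ab IH(2) by (simp add: poly_pairs_pCons)
  hence cd: "(c, d) \<in> R"
    by (simp add: poly_pairs_def c_def d_def)
  have "(pCons c s, pCons d t) \<in> poly_pairs R"
    using cd IH(1) by (simp add: poly_pairs_pCons)
  moreover have "(pCons a r - smult c p\<^sub>0, pCons b r' - smult d q\<^sub>0) \<in> poly_pairs R"
    by (intro poly_pairs_diff 1 poly_pairs_smult cd assms(1))
  moreover have "coeff (pCons a r - smult c p\<^sub>0) i = 0" if "i \<ge> n" for i
  proof (cases "i = n")
    case True
    thus ?thesis
      by (simp add: c_def assms(2))
  next
    case False
    hence "coeff (pCons a r) i = 0" "coeff p\<^sub>0 i = 0"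
      using that assms(3) IH(5) by (auto simp: coeff_pCons split: nat.splits)
    thus ?thesis
      by simp
  qed
  moreover have "pCons a p = pCons c s * p\<^sub>0 + (pCons a r - smult c p\<^sub>0)"
    "q = pCons d t * q\<^sub>0 + (pCons b r' - smult d q\<^sub>0)"
    by (simp_all add: IH q)
  ultimately show ?case
    by blast
qed

text \<open>The extension of an embedding by one element. Take p of least degree over the domain
  vanishing at x, with partner q; then x is sent to a root y of the normalised q, and R' collects
  the pairs of values at x and y.\<close>

lemma partial_hom_extend: "\<exists>R'. R \<subseteq> R' \<and> partial_hom R' \<and> x \<in> Domain R'"
proof -
  obtain p1 :: "'k poly" where "p1 \<noteq> 0" "poly (ac_poly p1) x = 0"
    using alg_closure_algebraic by blast
  hence "\<exists>q. (ac_poly p1, q) \<in> poly_pairs R \<and> ac_poly p1 \<noteq> 0 \<and> poly (ac_poly p1) x = 0"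
    using poly_pairs_const(1)[of p1] by auto
  then obtain p where p: "\<exists>q. (p, q) \<in> poly_pairs R \<and> p \<noteq> 0 \<and> poly p x = 0"
    and least': "\<And>p'. \<exists>q. (p', q) \<in> poly_pairs R \<and> p' \<noteq> 0 \<and> poly p' x = 0 \<Longrightarrow> degree p \<le> degree p'"
    using ex_has_least_nat[of "\<lambda>p. \<exists>q. (p, q) \<in> poly_pairs R \<and> p \<noteq> 0 \<and> poly p x = 0" "ac_poly p1" degree]
    by blast
  obtain q where pq: "(p, q) \<in> poly_pairs R" "p \<noteq> 0" "poly p x = 0"
    using p by blast
  define n where "n = degree p"
  have least: "p' = 0" if "(p', q') \<in> poly_pairs R" "poly p' x = 0" "\<forall>i\<ge>n. coeff p' i = 0" for p' q'
  proof (rule ccontr)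
    assume "p' \<noteq> 0"
    hence "degree p \<le> degree p'"
      using that by (intro least') auto
    thus False
      using that(3) \<open>p' \<noteq> 0\<close> by (auto simp: n_def)
  qed
  have "n > 0"
    using pq(2,3) by (auto simp: n_def intro!: Nat.gr0I elim!: degree_eq_zeroE)
  have lead: "(coeff p n, coeff q n) \<in> R" "coeff p n \<noteq> 0"
    using pq by (auto simp: poly_pairs_def n_def)
  define p\<^sub>0 q\<^sub>0 where "p\<^sub>0 = smult (inverse (coeff p n)) p" and "q\<^sub>0 = smult (inverse (coeff q n)) q"
  have p\<^sub>0: "(p\<^sub>0, q\<^sub>0) \<in> poly_pairs R" "coeff p\<^sub>0 n = 1" "\<And>i. i > n \<Longrightarrow> coeff p\<^sub>0 i = 0" "poly p\<^sub>0 x = 0"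
    using lead(2) pq pair_inverse[OF lead] unfolding p\<^sub>0_def q\<^sub>0_def
    by (auto intro!: poly_pairs_smult simp: n_def coeff_eq_0)
  have "(1, coeff q\<^sub>0 n) \<in> R"
    using p\<^sub>0(1,2) by (auto simp: poly_pairs_def dest: spec[of _ n])
  hence "coeff q\<^sub>0 n = 1"
    using pair_unique[OF pair_const(3)] by auto
  hence "degree q\<^sub>0 \<noteq> 0"
    using \<open>n > 0\<close> le_degree[of q\<^sub>0 n] by auto
  then obtain y where y: "poly q\<^sub>0 y = 0"
    using alg_closed_imp_poly_has_root by blast
  define R' where "R' = {(poly p x, poly q y) | p q. (p, q) \<in> poly_pairs R}"
  have "(a, b) \<in> R'" if "(a, b) \<in> R" for a b
    unfolding R'_def using that poly_pairs_const(2)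
    by (intro CollectI exI[of _ "[:a:]"] exI[of _ "[:b:]"]) (auto simp: poly_pairs_pCons)
  hence sub: "R \<subseteq> R'"
    by auto
  have "partial_hom R'"
    unfolding partial_hom_def
  proof (intro conjI allI impI)
    show "(to_ac c, to_ac c) \<in> R'" for c
      using pair_const(1) sub by blast
    fix a b a' b' assume "(a, b) \<in> R'" "(a', b') \<in> R'"
    then obtain p q p' q' where pq: "(p, q) \<in> poly_pairs R" "(p', q') \<in> poly_pairs R"
      "a = poly p x" "b = poly q y" "a' = poly p' x" "b' = poly q' y"
      by (auto simp: R'_def)
    show "(a + a', b + b') \<in> R'"
      unfolding R'_def using poly_pairs_add[OF pq(1,2)]
      by (intro CollectI exI[of _ "p + p'"] exI[of _ "q + q'"]) (auto simp: pq)
    show "(a * a', b * b') \<in> R'"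
      unfolding R'_def using poly_pairs_mult[OF pq(1,2)]
      by (intro CollectI exI[of _ "p * p'"] exI[of _ "q * q'"]) (auto simp: pq)
  next
    fix b assume "(0, b) \<in> R'"
    then obtain p q where pq: "(p, q) \<in> poly_pairs R" "poly p x = 0" "b = poly q y"
      by (auto simp: R'_def)
    obtain s t r r' where d: "(s, t) \<in> poly_pairs R" "(r, r') \<in> poly_pairs R" "p = s * p\<^sub>0 + r"
      "q = t * q\<^sub>0 + r'" "\<forall>i\<ge>n. coeff r i = 0"
      using poly_pairs_division[OF p\<^sub>0(1-3) \<open>n > 0\<close> pq(1)] by blast
    \<comment> \<open>Well-definedness: a polynomial vanishing at x leaves a remainder that vanishes
      at x too, against the minimality of p unless it is 0.\<close>
    have "r = 0"
      using d(3) pq(2) p\<^sub>0(4) by (intro least[OF d(2) _ d(5)]) simp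
    hence "r' = 0"
      using d(2) poly_pairs_zero by blast
    thus "b = 0"
      using d(4) pq(3) y by simp
  qed
  moreover have "(x, y) \<in> R'"
    unfolding R'_def using poly_pairs_const(2) pair_const
    by (intro CollectI exI[of _ "[:0, 1:]"]) (auto simp: poly_pairs_pCons)
  ultimately show ?thesis
    using sub by blast
qed

end

lemma partial_hom_Union:
  assumes "C \<noteq> {}" "subset.chain {R. R\<^sub>0 \<subseteq> R \<and> partial_hom R} C"
  shows "partial_hom (\<Union>C)"
proof -
  have C: "\<And>R. R \<in> C \<Longrightarrow> partial_hom R" "\<And>R R'. R \<in> C \<Longrightarrow> R' \<in> C \<Longrightarrow> R \<subseteq> R' \<or> R' \<subseteq> R"
    using assms(2) by (auto simp: subset_chain_def)
  show ?thesis
    unfolding partial_hom_def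
  proof (intro conjI allI impI)
    show "(to_ac c, to_ac c) \<in> \<Union>C" for c
      using assms(1) C(1) pair_const(1) by blast
    fix a b a' b' assume "(a, b) \<in> \<Union>C" "(a', b') \<in> \<Union>C"
    then obtain R where "R \<in> C" "(a, b) \<in> R" "(a', b') \<in> R"
      using C(2) by blast
    thus "(a + a', b + b') \<in> \<Union>C" "(a * a', b * b') \<in> \<Union>C"
      using C(1) pair_add pair_mult by blast+
  next
    fix b assume "(0, b) \<in> \<Union>C"
    thus "b = 0"
      using C(1) pair_zero by blast
  qed
qed

text \<open>The assignment of f(y) to f(x) is well defined because P divides every f vanishing at x.
  By Zorn's lemma its graph lies in a maximal one, which has full domain by
  \<open>partial_hom_extend\<close>.\<close>

lemma conjugation_exists:
  fixes P :: "'k::field poly" and x y :: "'k alg_closure"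
  assumes "irreducible P" "poly (ac_poly P) x = 0" "poly (ac_poly P) y = 0"
  obtains \<sigma> :: "'k alg_closure \<Rightarrow> 'k alg_closure"
  where "\<And>a b. \<sigma> (a + b) = \<sigma> a + \<sigma> b" "\<And>a b. \<sigma> (a * b) = \<sigma> a * \<sigma> b" "\<And>c. \<sigma> (to_ac c) = to_ac c" "\<sigma> x = y"
proof -
  define R\<^sub>0 where "R\<^sub>0 = {(poly (ac_poly f) x, poly (ac_poly f) y) | f. True}"
  have R\<^sub>0: "partial_hom R\<^sub>0"
    unfolding partial_hom_def
  proof (intro conjI allI impI)
    show "(to_ac c, to_ac c) \<in> R\<^sub>0" for c
      unfolding R\<^sub>0_def by (intro CollectI exI[of _ "[:c:]"]) auto
    fix a b a' b' assume "(a, b) \<in> R\<^sub>0" "(a', b') \<in> R\<^sub>0"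
    then obtain f g where fg: "a = poly (ac_poly f) x" "b = poly (ac_poly f) y"
      "a' = poly (ac_poly g) x" "b' = poly (ac_poly g) y"
      by (auto simp: R\<^sub>0_def)
    show "(a + a', b + b') \<in> R\<^sub>0"
      unfolding R\<^sub>0_def by (intro CollectI exI[of _ "f + g"]) (auto simp: fg)
    show "(a * a', b * b') \<in> R\<^sub>0"
      unfolding R\<^sub>0_def by (intro CollectI exI[of _ "f * g"]) (auto simp: fg)
  next
    fix b assume "(0, b) \<in> R\<^sub>0"
    then obtain f where f: "poly (ac_poly f) x = 0" "b = poly (ac_poly f) y"
      by (auto simp: R\<^sub>0_def)
    have "P dvd f"
      using irreducible_dvd_of_common_root[OF assms(1,2) f(1)] .
    thus "b = 0"
      using assms(3) f(2) by (auto simp: dvd_def)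
  qed
  have "\<exists>M\<in>{R. R\<^sub>0 \<subseteq> R \<and> partial_hom R}. \<forall>R\<in>{R. R\<^sub>0 \<subseteq> R \<and> partial_hom R}. M \<subseteq> R \<longrightarrow> R = M"
  proof (rule subset_Zorn_nonempty)
    show "{R. R\<^sub>0 \<subseteq> R \<and> partial_hom R} \<noteq> {}"
      using R\<^sub>0 by blast
    fix C assume C: "C \<noteq> {}" "subset.chain {R. R\<^sub>0 \<subseteq> R \<and> partial_hom R} C"
    obtain R where "R \<in> C"
      using C(1) by blast
    moreover have "C \<subseteq> {R. R\<^sub>0 \<subseteq> R \<and> partial_hom R}"
      using C(2) unfolding subset_chain_def by (rule conjunct1)
    ultimately have "R\<^sub>0 \<subseteq> \<Union>C"
      by blast
    thus "\<Union>C \<in> {R. R\<^sub>0 \<subseteq> R \<and> partial_hom R}"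
      using partial_hom_Union[OF C] by blast
  qed
  then obtain M where M': "M \<in> {R. R\<^sub>0 \<subseteq> R \<and> partial_hom R}"
    and max': "\<forall>R\<in>{R. R\<^sub>0 \<subseteq> R \<and> partial_hom R}. M \<subseteq> R \<longrightarrow> R = M"
    by (rule bexE)
  have M: "R\<^sub>0 \<subseteq> M" "partial_hom M"
    using M' by simp_all
  have max: "R = M" if "partial_hom R" "M \<subseteq> R" for R
    using bspec[OF max', of R] subset_trans[OF M(1) that(2)] that by simp
  have "\<exists>b. (a, b) \<in> M" for a
  proof -
    obtain R where R: "M \<subseteq> R" "partial_hom R" "a \<in> Domain R"
      using partial_hom_extend[OF M(2), of a] by blast
    have "R = M"
      by (rule max[OF R(2,1)])
    thus ?thesis
      using R(3) by blast
  qed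
  hence "\<forall>a. \<exists>b. (a, b) \<in> M"
    by (rule allI)
  from choice[OF this] obtain \<sigma> where \<sigma>: "\<And>a. (a, \<sigma> a) \<in> M"
    by (elim exE) (rule that, erule spec)
  note u = pair_unique[OF M(2) \<sigma>]
  show ?thesis
  proof (rule that)
    show "\<sigma> (a + b) = \<sigma> a + \<sigma> b" "\<sigma> (a * b) = \<sigma> a * \<sigma> b" for a b
      by (intro u pair_add[OF M(2)] pair_mult[OF M(2)] \<sigma>)+
    show "\<sigma> (to_ac c) = to_ac c" for c
      by (intro u pair_const[OF M(2)])
    have "(x, y) \<in> R\<^sub>0"
      unfolding R\<^sub>0_def by (intro CollectI exI[of _ "[:0, 1:]"]) auto
    thus "\<sigma> x = y"
      using M(1) by (intro u) auto
  qed
qed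

lemma extends_to_closureD:
  assumes "extends_to_closure v w"
  shows "is_valuation w" "w (to_ac a) = v a"
  using assms by (auto simp: extends_to_closure_def)

lemma vbar_extends: "henselian v \<Longrightarrow> extends_to_closure v (vbar v)"
  unfolding henselian_def vbar_def by (metis (mono_tags, lifting) theI')

text \<open>Composing \<open>vbar v\<close> with a conjugation again extends v, so uniqueness of the
  extension makes the conjugation preserve values.\<close>

lemma vbar_conjugate:
  fixes P :: "'k::field poly" and x y :: "'k alg_closure"
  assumes "henselian v" "irreducible P" "poly (ac_poly P) x = 0" "poly (ac_poly P) y = 0"
  obtains \<sigma> :: "'k alg_closure \<Rightarrow> 'k alg_closure"
  where "\<And>a b. \<sigma> (a - b) = \<sigma> a - \<sigma> b" "\<And>f z. \<sigma> (poly (ac_poly f) z) = poly (ac_poly f) (\<sigma> z)"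
    "\<sigma> x = y" "\<And>z. vbar v (\<sigma> z) = vbar v z"
proof -
  obtain \<sigma> :: "'k alg_closure \<Rightarrow> 'k alg_closure"
    where \<sigma>: "\<And>a b. \<sigma> (a + b) = \<sigma> a + \<sigma> b" "\<And>a b. \<sigma> (a * b) = \<sigma> a * \<sigma> b"
      "\<And>c. \<sigma> (to_ac c) = to_ac c" "\<sigma> x = y"
    by (rule conjugation_exists[OF assms(2-4)]) (rule that)
  note w = extends_to_closureD[OF vbar_extends[OF assms(1)]]
  have "\<sigma> 0 = 0" "\<sigma> 1 = 1"
    using \<sigma>(3)[of 0] \<sigma>(3)[of 1] by auto
  hence "extends_to_closure v (vbar v \<circ> \<sigma>)"
    using w by (auto simp: extends_to_closure_def is_valuation_def \<sigma>)
  hence "vbar v \<circ> \<sigma> = vbar v"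
    using vbar_extends[OF assms(1)] assms(1) unfolding henselian_def by blast
  hence 1: "vbar v (\<sigma> z) = vbar v z" for z
    by (metis comp_apply)
  have 2: "\<sigma> (a - b) = \<sigma> a - \<sigma> b" for a b
    using \<sigma>(1)[of "a - b" b] by (simp add: algebra_simps)
  have 3: "\<sigma> (poly (ac_poly f) z) = poly (ac_poly f) (\<sigma> z)" for f z
    by (induction f) (auto simp: \<sigma> \<open>\<sigma> 0 = 0\<close>)
  show ?thesis
    by (rule that[OF 2 3 \<sigma>(4) 1])
qed


subsection \<open>Valuations attached to balls around a root\<close>

locale henselian_poly =
  fixes v :: "'k::field \<Rightarrow> 'g::linordered_ab_group_add vinf" and F :: "'k poly"
  assumes henselian: "henselian v" and divisible: "values_in_divisible_hull v"
    and F: "monic F" "irreducible F" "degree F > 0"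
begin

abbreviation V :: "'k alg_closure \<Rightarrow> 'g vinf" where
  "V \<equiv> vbar v"

text \<open>The same choice of root as in \<open>val_of_poly\<close>, so that \<open>nu\<close> is
  evaluation at this root.\<close>

definition \<theta> :: "'k alg_closure" where
  "\<theta> = (SOME \<theta>. poly (ac_poly F) \<theta> = 0)"

abbreviation nu :: "'k poly \<Rightarrow> 'g vinf" where
  "nu \<equiv> val_of_poly v F"

definition ball :: "'g vinf \<Rightarrow> 'k poly \<Rightarrow> 'g vinf" where
  "ball d f = ball_val V \<theta> d (ac_poly f)"

text \<open>Meaningful for nonconstant g: a nonzero constant has no roots, and every element is a
  root of 0.\<close>

definition delta :: "'k poly \<Rightarrow> 'g vinf" where
  "delta g = Max ((\<lambda>\<beta>. V (\<theta> - \<beta>)) ` {\<beta>. poly (ac_poly g) \<beta> = 0})"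

lemma V: "is_valuation V" "V (to_ac a) = v a"
  using extends_to_closureD[OF vbar_extends[OF henselian]] by auto

lemma root_F: "poly (ac_poly F) \<theta> = 0"
proof -
  have "\<exists>x. poly (ac_poly F) x = 0"
    using F(3) by (intro alg_closed_imp_poly_has_root) simp
  thus ?thesis
    unfolding \<theta>_def by (rule someI_ex)
qed

lemma nu_eq: "nu f = V (poly (ac_poly f) \<theta>)"
  by (simp add: val_of_poly_def \<theta>_def)

lemma nu_eq_ball: "nu = ball Infty"
  by (rule ext) (simp add: nu_eq ball_def ball_val_Infty[OF V(1)])

lemma valuation_over_ball_val: "valuation_over v (\<lambda>f. ball_val V \<alpha> d (ac_poly f))"
  using is_valuation_ball_val[OF V(1), of \<alpha> d]
  by (auto simp: valuation_over_def is_valuation_def ball_val_const[OF V(1)] V(2))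

lemma valuation_over_ball: "valuation_over v (ball d)"
  using valuation_over_ball_val[of \<theta> d] by (simp add: ball_def[abs_def])

lemma is_valuation_ball: "is_valuation (ball d)"
  using valuation_over_ball by (auto simp: valuation_over_def)

lemma is_valuation_nu: "is_valuation nu"
  unfolding nu_eq_ball by (rule is_valuation_ball)

lemma ball_mono: "d \<le> d' \<Longrightarrow> ball d f \<le> ball d' f"
  unfolding ball_def by (rule ball_val_mono[OF V(1)])

lemma ball_le_nu: "ball d f \<le> nu f"
  unfolding nu_eq_ball by (rule ball_mono) simp

lemma finite_roots: "g \<noteq> 0 \<Longrightarrow> finite {\<beta>. poly (ac_poly g) \<beta> = 0}"
  by (rule poly_roots_finite) simp

lemma V_le_delta: "g \<noteq> 0 \<Longrightarrow> poly (ac_poly g) \<beta> = 0 \<Longrightarrow> V (\<theta> - \<beta>) \<le> delta g"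
  unfolding delta_def by (rule Max_ge) (auto intro: finite_roots)

lemma delta_attained:
  assumes "degree g > 0"
  obtains \<alpha> where "poly (ac_poly g) \<alpha> = 0" "V (\<theta> - \<alpha>) = delta g"
proof -
  have "\<exists>x. poly (ac_poly g) x = 0"
    using assms by (intro alg_closed_imp_poly_has_root) simp
  moreover have "g \<noteq> 0"
    using assms by auto
  ultimately have "delta g \<in> (\<lambda>\<beta>. V (\<theta> - \<beta>)) ` {\<beta>. poly (ac_poly g) \<beta> = 0}"
    unfolding delta_def by (intro Max_in) (auto intro: finite_roots)
  thus ?thesis
    using that by auto
qed

text \<open>No root of g is affected by the cut at d. The hypothesis is conditional because
  \<open>delta\<close> carries no information for constants.\<close>

lemma ball_eq_nu:
  assumes "degree g > 0 \<Longrightarrow> delta g \<le> d"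
  shows "ball d g = nu g"
proof (cases "g = 0")
  case False
  show ?thesis
    unfolding ball_def nu_eq
  proof (rule ball_val_eq_eval_centre[OF V(1)])
    fix \<beta> assume \<beta>: "poly (ac_poly g) \<beta> = 0"
    have "degree g > 0"
    proof (rule ccontr)
      assume "\<not> degree g > 0"
      then obtain c where "g = [:c:]"
        by (metis degree_eq_zeroE gr0I)
      thus False
        using \<beta> False by simp
    qed
    thus "V (\<theta> - \<beta>) \<le> d"
      using assms V_le_delta[OF False \<beta>] by simp
  qed
qed (simp add: is_valuationD(1)[OF is_valuation_ball] is_valuationD(1)[OF is_valuation_nu])

lemma ball_less:
  assumes "degree g > 0" "d < d'" "d < delta g"
  shows "ball d g < ball d' g"
proof -
  obtain \<alpha> where "poly (ac_poly g) \<alpha> = 0" "V (\<theta> - \<alpha>) = delta g"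
    by (rule delta_attained[OF assms(1)])
  thus ?thesis
    unfolding ball_def using assms by (intro ball_val_strict_mono[OF V(1)]) auto
qed

lemma ball_less_nu: "degree g > 0 \<Longrightarrow> d < delta g \<Longrightarrow> ball d g < nu g"
  unfolding nu_eq_ball by (rule ball_less) (cases d; auto)+

lemma ball_eq_Infty: "d \<noteq> Infty \<Longrightarrow> ball d f = Infty \<longleftrightarrow> f = 0"
  by (simp add: ball_def ball_val_eq_Infty[OF V(1)])

lemma nu_eq_Infty: "nu f = Infty \<longleftrightarrow> F dvd f"
proof
  assume "nu f = Infty"
  hence "poly (ac_poly f) \<theta> = 0"
    by (simp add: nu_eq valuation_field_eq_Infty[OF V(1)])
  thus "F dvd f"
    using irreducible_dvd_of_common_root[OF F(2) root_F] by blast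
qed (auto simp: nu_eq root_F is_valuationD(1)[OF V(1)] elim!: dvdE)

lemma delta_F: "delta F = Infty"
  using V_le_delta[OF _ root_F] F(3) by (cases "F = 0") (auto simp: is_valuationD(1)[OF V(1)])

text \<open>No nonconstant polynomial of smaller degree has a root as close to \<theta>. The
  identification of truncations and augmentations with ball valuations rests on this
  property.\<close>

definition optimal :: "'k poly \<Rightarrow> bool" where
  "optimal \<phi> \<longleftrightarrow> monic \<phi> \<and> irreducible \<phi> \<and> degree \<phi> > 0 \<and>
     (\<forall>g. 0 < degree g \<and> degree g < degree \<phi> \<longrightarrow> delta g < delta \<phi>)"

lemma optimal_nonzero: "optimal \<phi> \<Longrightarrow> \<phi> \<noteq> 0"
  by (auto simp: optimal_def)

context
  fixes \<phi> :: "'k poly" and \<alpha> :: "'k alg_closure"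
  assumes \<phi>: "optimal \<phi>" and \<alpha>: "poly (ac_poly \<phi>) \<alpha> = 0" "V (\<theta> - \<alpha>) = delta \<phi>"
begin

lemma root_close:
  assumes "a \<noteq> 0" "degree a < degree \<phi>" "poly (ac_poly a) \<beta> = 0"
  shows "V (\<theta> - \<beta>) < delta \<phi>"
proof -
  have "degree a > 0"
    using assms(1,3) by (auto intro!: Nat.gr0I elim!: degree_eq_zeroE)
  hence "delta a < delta \<phi>"
    using \<phi> assms(2) by (auto simp: optimal_def)
  thus ?thesis
    using V_le_delta[OF assms(1,3)] by simp
qed

lemma eval_close:
  assumes "a \<noteq> 0" "degree a < degree \<phi>"
  shows "V (poly (ac_poly a) \<theta>) < V (poly (ac_poly a) \<theta> - poly (ac_poly a) \<alpha>)"
  using root_close[OF assms] assms by (intro eval_diff_less[OF V(1)]) (auto simp: \<alpha>)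

text \<open>All roots of a are farther from \<theta> than \<alpha>, so passing from \<theta> to
  \<alpha> does not affect the value.\<close>

lemma eval_eq_nu: "degree a < degree \<phi> \<Longrightarrow> V (poly (ac_poly a) \<alpha>) = nu a"
  using eval_close[of a] valuation_less_add(3)[OF V(1), of "poly (ac_poly a) \<theta>" "poly (ac_poly a) \<theta> - poly (ac_poly a) \<alpha>"]
  by (cases "a = 0") (auto simp: nu_eq)

lemma ball_eq_nu_small: "degree a < degree \<phi> \<Longrightarrow> ball (delta \<phi>) a = nu a"
  using \<phi> by (intro ball_eq_nu) (auto simp: optimal_def intro: less_imp_le)

lemma ball_le_eval: "ball (delta \<phi>) f \<le> V (poly (ac_poly f) \<alpha>)"
  unfolding ball_def \<alpha>(2)[symmetric]
  using is_valuationD(5)[OF V(1), of "\<theta> - \<alpha>"] by (intro ball_val_le_eval[OF V(1)]) simp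

text \<open>This is the hypothesis of \<open>augment_self\<close>: f and its remainder agree at
  \<alpha>, where the remainder has its ball value.\<close>

lemma ball_le_mod: "ball (delta \<phi>) f \<le> ball (delta \<phi>) (f mod \<phi>)"
proof -
  have small: "degree (f mod \<phi>) < degree \<phi>"
    using degree_mod_less[OF optimal_nonzero[OF \<phi>], of f] \<phi> by (auto simp: optimal_def)
  have "ac_poly f = ac_poly (f div \<phi>) * ac_poly \<phi> + ac_poly (f mod \<phi>)"
    by (simp flip: ac_poly_simps(1,2))
  hence "poly (ac_poly f) \<alpha> = poly (ac_poly (f mod \<phi>)) \<alpha>"
    by (simp add: \<alpha>)
  thus ?thesis
    using ball_le_eval[of f] by (simp add: eval_eq_nu small ball_eq_nu_small)
qed

text \<open>The comparison is with evaluation at \<alpha> instead of \<theta>: the two valuations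
  agree below the degree of \<phi>, and \<phi> jumps to \<open>Infty\<close>.\<close>

lemma optimal_in_KP:
  assumes "delta \<phi> \<noteq> Infty"
  shows "\<phi> \<in> KP (ball (delta \<phi>))"
proof (rule in_KP[OF is_valuation_ball])
  show "is_valuation (\<lambda>f. V (poly (ac_poly f) \<alpha>))"
    using valuation_over_ball_val[of \<alpha> Infty] by (simp add: ball_val_Infty[OF V(1)] valuation_over_def)
  show "ball (delta \<phi>) f \<le> V (poly (ac_poly f) \<alpha>)" for f
    by (rule ball_le_eval)
  show fin: "ball (delta \<phi>) f \<noteq> Infty" if "f \<noteq> 0" for f
    using that assms by (simp add: ball_eq_Infty)
  show "ball (delta \<phi>) \<phi> < V (poly (ac_poly \<phi>) \<alpha>)"
    using fin[OF optimal_nonzero[OF \<phi>]]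
    by (cases "ball (delta \<phi>) \<phi>") (auto simp: \<alpha> is_valuationD(1)[OF V(1)])
  show "ball (delta \<phi>) a = V (poly (ac_poly a) \<alpha>)" if "degree a < degree \<phi>" for a
    using that by (simp add: eval_eq_nu ball_eq_nu_small)
  show "monic \<phi>"
    using \<phi> by (simp add: optimal_def)
qed

text \<open>Divide \<phi> by a key polynomial \<psi> of smaller degree, with quotient s and
  remainder r, which is nonzero as \<phi> is irreducible. The parts s * \<psi> and r cancel at
  \<alpha>, hence cancel to leading order at \<theta>. Thus \<psi> divides r in the graded algebra,
  against minimality.\<close>

lemma degree_le_KP:
  assumes "delta \<phi> \<noteq> Infty" "\<psi> \<in> KP (ball (delta \<phi>))"
  shows "degree \<phi> \<le> degree \<psi>"
proof (rule ccontr)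
  assume "\<not> degree \<phi> \<le> degree \<psi>"
  hence less: "degree \<psi> < degree \<phi>"
    by simp
  have monic: "monic \<psi>"
    using assms(2) by (simp add: KP_def)
  have "\<psi> \<noteq> 1"
    using assms(2) one_notin_KP[OF is_valuation_ball] by blast
  hence pos: "degree \<psi> > 0"
    using monic by (auto intro!: Nat.gr0I elim!: degree_eq_zeroE)
  have \<psi>: "\<psi> \<noteq> 0"
    using pos by auto
  define s r where "s = \<phi> div \<psi>" and "r = \<phi> mod \<psi>"
  have \<phi>_eq: "\<phi> = s * \<psi> + r"
    by (simp add: s_def r_def)
  have "r \<noteq> 0"
  proof
    assume "r = 0"
    hence "\<psi> dvd \<phi>"
      by (simp add: r_def dvd_eq_mod_eq_0)
    hence "\<phi> dvd \<psi> \<or> is_unit \<psi>"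
      using \<phi> irreducibleD' by (auto simp: optimal_def)
    thus False
      using dvd_imp_degree_le[of \<phi> \<psi>] less pos \<psi> by (auto simp: is_unit_iff_degree)
  qed
  have degs: "degree r < degree \<psi>"
    using degree_mod_less[OF \<psi>, of \<phi>] \<open>r \<noteq> 0\<close> by (simp add: r_def)
  have "s \<noteq> 0"
    using \<phi>_eq degs less by auto
  have "degree \<phi> = degree (s * \<psi>)"
    using degs \<open>s \<noteq> 0\<close> \<psi> unfolding \<phi>_eq by (subst degree_add_eq_left) (auto simp: degree_mult_eq)
  hence deg_s: "degree s < degree \<phi>"
    using pos \<open>s \<noteq> 0\<close> \<psi> by (simp add: degree_mult_eq)
  let ?f = "ac_poly (s * \<psi>)" and ?r = "ac_poly r"
  have 1: "V (poly ?f \<theta>) < V (poly ?f \<theta> - poly ?f \<alpha>)"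
    using root_close[of s] root_close[of \<psi>] deg_s less \<open>s \<noteq> 0\<close> \<psi>
    by (intro eval_diff_less[OF V(1)]) (auto simp: \<alpha>)
  have 2: "V (poly ?r \<theta>) < V (poly ?r \<theta> - poly ?r \<alpha>)"
    using degs less \<open>r \<noteq> 0\<close> by (intro eval_close) auto
  have "ac_poly \<phi> = ?f + ?r"
    by (simp only: \<phi>_eq ac_poly_simps(1))
  hence \<phi>_poly: "poly (ac_poly \<phi>) x = poly ?f x + poly ?r x" for x
    by simp
  have "poly ?f \<alpha> = - poly ?r \<alpha>"
    using \<alpha>(1) \<phi>_poly[of \<alpha>] by (simp add: eq_neg_iff_add_eq_0 del: ac_poly_simps)
  hence "V (poly ?f \<alpha>) = V (poly ?r \<alpha>)"
    using is_valuationD(5)[OF V(1)] by metis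
  moreover have "V (poly ?f \<alpha>) = V (poly ?f \<theta>)"
    using valuation_less_add(3)[OF V(1) 1] by simp
  moreover have "V (poly ?r \<alpha>) = V (poly ?r \<theta>)"
    using valuation_less_add(3)[OF V(1) 2] by simp
  \<comment> \<open>As \<phi>(\<alpha>) = 0, both parts have the same value at \<theta>, and
    \<phi>(\<theta>) is the sum of their changes between \<theta> and \<alpha>, each of larger
    value.\<close>
  ultimately have "V (poly ?r \<theta>) < min (V (poly ?f \<theta> - poly ?f \<alpha>)) (V (poly ?r \<theta> - poly ?r \<alpha>))"
    using 1 2 by simp
  also have "\<dots> \<le> V ((poly ?f \<theta> - poly ?f \<alpha>) + (poly ?r \<theta> - poly ?r \<alpha>))"
    by (rule is_valuationD(4)[OF V(1)])
  also have "(poly ?f \<theta> - poly ?f \<alpha>) + (poly ?r \<theta> - poly ?r \<alpha>) = poly (ac_poly \<phi>) \<theta>"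
    unfolding \<phi>_poly \<open>poly ?f \<alpha> = - poly ?r \<alpha>\<close> by simp
  finally have "nu r < nu \<phi>"
    by (simp add: nu_eq)
  moreover have "ball (delta \<phi>) r = nu r"
    using degs less by (intro ball_eq_nu_small) simp
  moreover have "ball (delta \<phi>) \<phi> = nu \<phi>"
    by (intro ball_eq_nu) simp
  ultimately have "ball (delta \<phi>) r < ball (delta \<phi>) (r - (- s) * \<psi>)"
    by (simp add: \<phi>_eq add.commute)
  hence "val_dvd (ball (delta \<phi>)) \<psi> r"
    using \<open>r \<noteq> 0\<close> assms(1) by (intro val_dvdI[OF is_valuation_ball, of _ _ "- s"]) (simp_all add: ball_eq_Infty)
  thus False
    using assms(2) \<open>r \<noteq> 0\<close> degs by (auto simp: KP_def val_minimal_def)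
qed

end

lemma optimalE:
  assumes "optimal \<phi>"
  obtains \<alpha> where "poly (ac_poly \<phi>) \<alpha> = 0" "V (\<theta> - \<alpha>) = delta \<phi>"
  using assms delta_attained[of \<phi>] by (auto simp: optimal_def)

text \<open>Only values of \<mu> below the degree of \<phi> enter an augmentation, so truncations,
  ordinary and limit augmentations are identified by one argument.\<close>

lemma augment_optimal:
  assumes "optimal \<phi>" "\<And>a. degree a < degree \<phi> \<Longrightarrow> \<mu> a = nu a"
  shows "augment \<mu> \<phi> (nu \<phi>) = ball (delta \<phi>)"
proof -
  obtain \<alpha> where \<alpha>: "poly (ac_poly \<phi>) \<alpha> = 0" "V (\<theta> - \<alpha>) = delta \<phi>"
    by (rule optimalE[OF assms(1)])
  have deg: "degree \<phi> > 0"
    using assms(1) by (simp add: optimal_def)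
  have "augment \<mu> \<phi> (nu \<phi>) = augment (ball (delta \<phi>)) \<phi> (nu \<phi>)"
    using assms(2) ball_eq_nu_small[OF assms(1) \<alpha>] by (intro augment_cong deg) simp
  also have "\<dots> = augment (ball (delta \<phi>)) \<phi> (ball (delta \<phi>) \<phi>)"
    by (simp add: ball_eq_nu)
  also have "\<dots> = ball (delta \<phi>)"
    by (intro augment_self is_valuation_ball deg ball_le_mod[OF assms(1) \<alpha>])
  finally show ?thesis .
qed

lemma truncation_optimal: "optimal \<phi> \<Longrightarrow> truncation nu \<phi> = ball (delta \<phi>)"
  by (simp add: truncation_eq_augment[OF is_valuation_nu] augment_optimal)

lemma vdeg_ball:
  assumes "optimal \<phi>" "delta \<phi> \<noteq> Infty"
  shows "vdeg (ball (delta \<phi>)) = enat (degree \<phi>)"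
proof -
  obtain \<alpha> where \<alpha>: "poly (ac_poly \<phi>) \<alpha> = 0" "V (\<theta> - \<alpha>) = delta \<phi>"
    by (rule optimalE[OF assms(1)])
  have "support (ball (delta \<phi>)) = {0}"
    using assms(2) by (auto simp: support_def infinity_vinf_def ball_eq_Infty)
  moreover have "(INF \<psi>\<in>KP (ball (delta \<phi>)). enat (degree \<psi>)) = enat (degree \<phi>)"
  proof (rule order_antisym)
    show "(INF \<psi>\<in>KP (ball (delta \<phi>)). enat (degree \<psi>)) \<le> enat (degree \<phi>)"
      by (intro INF_lower optimal_in_KP[OF assms(1) \<alpha> assms(2)])
    show "enat (degree \<phi>) \<le> (INF \<psi>\<in>KP (ball (delta \<phi>)). enat (degree \<psi>))"
      using degree_le_KP[OF assms(1) \<alpha> assms(2)] by (intro INF_greatest) simp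
  qed
  ultimately show ?thesis
    by (simp add: vdeg_def)
qed

text \<open>The support consists of the multiples of F, whose monic generator is unique, so the
  infimum runs over F alone.\<close>

lemma vdeg_nu: "vdeg nu = enat (degree F)"
proof -
  have supp: "support nu = {f. F dvd f}"
    by (auto simp: support_def infinity_vinf_def nu_eq_Infty)
  have "G = F" if "monic G" "{f. F dvd f} = {f. G dvd f}" for G
  proof -
    have "G dvd F" "F dvd G"
      using equalityD1[OF that(2)] equalityD2[OF that(2)] dvd_refl by blast+
    have "G \<noteq> 0" "F \<noteq> 0"
      using that(1) F(1) by auto
    obtain c where c: "G = F * c"
      using \<open>F dvd G\<close> by (rule dvdE)
    have "c \<noteq> 0"
      using c \<open>G \<noteq> 0\<close> by auto
    moreover have "degree G \<le> degree F"
      using \<open>G dvd F\<close> \<open>F \<noteq> 0\<close> by (rule dvd_imp_degree_le)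
    ultimately have "degree c = 0"
      using \<open>F \<noteq> 0\<close> by (simp add: c degree_mult_eq)
    moreover have "lead_coeff c = 1"
      using that(1) F(1) lead_coeff_mult[of F c] by (simp add: c)
    ultimately have "c = 1"
      by (auto elim!: degree_eq_zeroE)
    thus ?thesis
      by (simp add: c)
  qed
  hence eq: "{G. monic G \<and> irreducible G \<and> support nu = {f. G dvd f}} = {F}"
    unfolding supp using F by blast
  have "F \<in> support nu" "F \<noteq> 0"
    using F by (auto simp: supp)
  hence "support nu \<noteq> {0}"
    by blast
  thus ?thesis
    unfolding vdeg_def eq by simp
qed

text \<open>Here \<psi> is a monic polynomial of least degree at which \<open>ball d\<close> is
  strictly below \<open>nu\<close>.\<close>

lemma next_in_KP:
  assumes "monic \<psi>" "degree \<psi> > 0" "d < delta \<psi>" "\<And>g. 0 < degree g \<Longrightarrow> degree g < degree \<psi> \<Longrightarrow> delta g \<le> d"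
  shows "\<psi> \<in> KP (ball d)"
proof (rule in_KP[OF is_valuation_ball is_valuation_nu])
  show "ball d f \<noteq> Infty" if "f \<noteq> 0" for f
    using that vinf_less_not_Infty[OF assms(3)] by (simp add: ball_eq_Infty)
qed (use assms in \<open>auto simp: ball_le_nu ball_less_nu intro: ball_eq_nu\<close>)


subsection \<open>Weights\<close>

text \<open>By conjugation the inner sums of the double count are constant in either order. Roots
  are counted with multiplicity, which covers the inseparable case.\<close>

lemma weight_reciprocity:
  assumes g: "monic g" "irreducible g" "degree g > 0"
  shows "nmult (degree F) (nu g) = nmult (degree g) (ball (delta g) F)"
proof -
  note v = is_valuationD[OF V(1)]
  have nz: "ac_poly g \<noteq> 0" "ac_poly F \<noteq> 0"
    using g F by auto
  have lc: "V (lead_coeff (ac_poly g)) = 0" "V (lead_coeff (ac_poly F)) = 0"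
    using g F by (auto simp: coeff_map_poly v(2))
  obtain B where B: "size B = degree (ac_poly g)" "\<And>\<beta>. \<beta> \<in># B \<longleftrightarrow> poly (ac_poly g) \<beta> = 0"
    "\<And>x. V (poly (ac_poly g) x) = V (lead_coeff (ac_poly g)) + (\<Sum>\<beta>\<in>#B. V (x - \<beta>))"
    by (rule ball_val_eq_sum[OF V(1) nz(1)]) (rule that)
  obtain T where T: "size T = degree (ac_poly F)" "\<And>t. t \<in># T \<longleftrightarrow> poly (ac_poly F) t = 0"
    "\<And>\<theta> d. ball_val V \<theta> d (ac_poly F) = V (lead_coeff (ac_poly F)) + (\<Sum>t\<in>#T. min (V (\<theta> - t)) d)"
    "\<And>x. V (poly (ac_poly F) x) = V (lead_coeff (ac_poly F)) + (\<Sum>t\<in>#T. V (x - t))"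
    by (rule ball_val_eq_sum[OF V(1) nz(2)]) (rule that)
  have B': "V (poly (ac_poly g) x) = (\<Sum>\<beta>\<in>#B. V (x - \<beta>))" for x
    unfolding B(3) lc by simp
  have T': "V (poly (ac_poly F) x) = (\<Sum>t\<in>#T. V (x - t))"
    "ball_val V \<theta> d (ac_poly F) = (\<Sum>t\<in>#T. min (V (\<theta> - t)) d)" for x \<theta> d
    unfolding T(3,4) lc by simp_all
  obtain b where b: "poly (ac_poly g) b = 0" "V (\<theta> - b) = delta g"
    by (rule delta_attained[OF g(3)])
  have conj_F: "V (poly (ac_poly g) t) = nu g" if "t \<in># T" for t
  proof -
    obtain \<sigma> where \<sigma>: "\<And>a b. \<sigma> (a - b) = \<sigma> a - \<sigma> b" "\<And>f z. \<sigma> (poly (ac_poly f) z) = poly (ac_poly f) (\<sigma> z)"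
      "\<sigma> t = \<theta>" "\<And>z. V (\<sigma> z) = V z"
      by (rule vbar_conjugate[OF henselian F(2) iffD1[OF T(2) \<open>t \<in># T\<close>] root_F]) (rule that)
    show ?thesis
      using \<sigma>(2)[of g t] \<sigma>(3) \<sigma>(4)[of "poly (ac_poly g) t"] by (simp add: nu_eq)
  qed
  have conj_g: "V (poly (ac_poly F) b') = V (poly (ac_poly F) b)" if "b' \<in># B" for b'
  proof -
    obtain \<sigma> where \<sigma>: "\<And>a b. \<sigma> (a - b) = \<sigma> a - \<sigma> b" "\<And>f z. \<sigma> (poly (ac_poly f) z) = poly (ac_poly f) (\<sigma> z)"
      "\<sigma> b' = b" "\<And>z. V (\<sigma> z) = V z"
      by (rule vbar_conjugate[OF henselian g(2) iffD1[OF B(2) \<open>b' \<in># B\<close>] b(1)]) (rule that)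
    show ?thesis
      using \<sigma>(2)[of F b'] \<sigma>(3) \<sigma>(4)[of "poly (ac_poly F) b'"] by simp
  qed
  \<comment> \<open>A conjugation taking t to \<theta> takes b to a root of g, so V (b - t) is at
    most \<open>delta g\<close>. The ultrametric inequality for \<theta>, b and t then leaves only
    the stated minimum.\<close>
  have dist: "V (b - t) = min (V (\<theta> - t)) (delta g)" if "t \<in># T" for t
  proof -
    obtain \<sigma> where \<sigma>: "\<And>a b. \<sigma> (a - b) = \<sigma> a - \<sigma> b" "\<And>f z. \<sigma> (poly (ac_poly f) z) = poly (ac_poly f) (\<sigma> z)"
      "\<sigma> t = \<theta>" "\<And>z. V (\<sigma> z) = V z"
      by (rule vbar_conjugate[OF henselian F(2) iffD1[OF T(2) \<open>t \<in># T\<close>] root_F]) (rule that)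
    have "\<sigma> 0 = 0"
      using \<sigma>(1)[of 0 0] by simp
    hence "poly (ac_poly g) (\<sigma> b) = 0"
      using \<sigma>(2)[of g b] b(1) by simp
    hence "V (\<theta> - \<sigma> b) \<le> delta g"
      using g by (intro V_le_delta) auto
    moreover have "V (\<theta> - \<sigma> b) = V (b - t)"
      using \<sigma>(1)[of t b] \<sigma>(3) \<sigma>(4)[of "t - b"] v(5)[of "t - b"] by simp
    ultimately have le: "V (b - t) \<le> delta g"
      by simp
    have *: "b - t = (\<theta> - t) - (\<theta> - b)"
      by simp
    consider "V (\<theta> - t) < delta g" | "delta g < V (\<theta> - t)" | "V (\<theta> - t) = delta g"
      by fastforce
    thus ?thesis
    proof cases
      case 1
      thus ?thesis
        unfolding * using valuation_less_add(3)[OF V(1), of "\<theta> - t" "\<theta> - b"] b(2) by simp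
    next
      case 2
      thus ?thesis
        unfolding * using valuation_less_add(4)[OF V(1), of "\<theta> - b" "\<theta> - t"] b(2) by simp
    next
      case 3
      thus ?thesis
        using v(6)[of "\<theta> - t" "\<theta> - b"] b(2) le by simp
    qed
  qed
  have "nmult (degree F) (nu g) = (\<Sum>t\<in>#T. nu g)"
    using T(1) by (simp add: sum_mset_const_nmult)
  also have "\<dots> = (\<Sum>t\<in>#T. \<Sum>\<beta>\<in>#B. V (t - \<beta>))"
    using conj_F by (intro arg_cong[where f = sum_mset] image_mset_cong) (simp add: B'[symmetric])
  also have "\<dots> = (\<Sum>\<beta>\<in>#B. \<Sum>t\<in>#T. V (t - \<beta>))"
    by (rule sum_mset.swap)
  also have "\<dots> = (\<Sum>\<beta>\<in>#B. \<Sum>t\<in>#T. V (\<beta> - t))"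
  proof -
    have "V (t - \<beta>) = V (\<beta> - t)" for t \<beta>
      using v(5)[of "t - \<beta>"] by simp
    thus ?thesis
      by simp
  qed
  also have "\<dots> = (\<Sum>\<beta>\<in>#B. V (poly (ac_poly F) b))"
    using conj_g by (intro arg_cong[where f = sum_mset] image_mset_cong) (simp add: T'(1)[symmetric])
  also have "\<dots> = nmult (degree g) (V (poly (ac_poly F) b))"
    using B(1) by (simp add: sum_mset_const_nmult)
  also have "V (poly (ac_poly F) b) = (\<Sum>t\<in>#T. min (V (\<theta> - t)) (delta g))"
    unfolding T'(1) using dist by (intro arg_cong[where f = sum_mset] image_mset_cong)
  also have "\<dots> = ball (delta g) F"
    by (simp add: ball_def T'(2))
  finally show ?thesis .
qed

text \<open>Since \<theta> is a root of F, every increase of the radius is felt by F.\<close>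

lemma ball_F_le_iff: "ball d F \<le> ball d' F \<longleftrightarrow> d \<le> d'"
proof
  assume le: "ball d F \<le> ball d' F"
  show "d \<le> d'"
  proof (rule ccontr)
    assume "\<not> d \<le> d'"
    hence "d' < d"
      by simp
    hence "ball d' F < ball d F"
      using F(3) by (intro ball_less) (cases d'; simp add: delta_F)+
    thus False
      using le by simp
  qed
qed (rule ball_mono)

lemma nu_le_iff_delta:
  assumes "monic g" "irreducible g" "monic h" "irreducible h" "degree g = degree h" "degree g > 0"
  shows "nu g \<le> nu h \<longleftrightarrow> delta g \<le> delta h"
proof -
  have "nu g \<le> nu h \<longleftrightarrow> nmult (degree F) (nu g) \<le> nmult (degree F) (nu h)"
    using F(3) by (simp add: nmult_le_iff)
  also have "\<dots> \<longleftrightarrow> delta g \<le> delta h"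
    using assms by (simp add: weight_reciprocity nmult_le_iff ball_F_le_iff)
  finally show ?thesis .
qed

text \<open>The degree of g cancels in the reciprocity formula, so the weight depends on g only
  through \<open>delta g\<close>.\<close>

lemma nmult_wt:
  assumes "monic g" "irreducible g" "degree g > 0"
  shows "nmult (degree F) (wt nu g) = ball (delta g) F"
proof -
  have "nmult (degree g) (wt nu g) = nu g"
    unfolding wt_def using assms(3) divisible
    by (intro nmult_ndiv) (auto simp: values_in_divisible_hull_def)
  hence "nmult (degree g) (nmult (degree F) (wt nu g)) = nmult (degree F) (nu g)"
    by (metis nmult_mult mult.commute)
  thus ?thesis
    using assms by (simp add: weight_reciprocity nmult_eq_iff)
qed

lemma wt_le_iff_delta:
  assumes "monic g" "irreducible g" "degree g > 0" "monic h" "irreducible h" "degree h > 0"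
  shows "wt nu g \<le> wt nu h \<longleftrightarrow> delta g \<le> delta h"
proof -
  have "wt nu g \<le> wt nu h \<longleftrightarrow> nmult (degree F) (wt nu g) \<le> nmult (degree F) (wt nu h)"
    using F(3) by (simp add: nmult_le_iff)
  also have "\<dots> \<longleftrightarrow> delta g \<le> delta h"
    using assms by (simp add: nmult_wt ball_F_le_iff)
  finally show ?thesis .
qed

text \<open>The minimal polynomial of a root of g closest to \<theta>. It reduces statements on
  arbitrary g to irreducible ones, where weight and \<open>delta\<close> are linked.\<close>

lemma irreducible_with_delta:
  assumes "degree g > 0"
  obtains h where "monic h" "irreducible h" "degree h > 0" "degree h \<le> degree g" "delta g \<le> delta h"
proof -
  obtain b where b: "poly (ac_poly g) b = 0" "V (\<theta> - b) = delta g"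
    by (rule delta_attained[OF assms])
  have "g \<noteq> 0"
    using assms by auto
  then obtain h where h: "h \<noteq> 0" "poly (ac_poly h) b = 0"
    and least: "\<And>g. g \<noteq> 0 \<Longrightarrow> poly (ac_poly g) b = 0 \<Longrightarrow> degree h \<le> degree g"
    using ex_has_least_nat[of "\<lambda>h. h \<noteq> 0 \<and> poly (ac_poly h) b = 0" g degree] b(1) by blast
  have pos: "degree h > 0"
    using h by (auto intro!: Nat.gr0I elim!: degree_eq_zeroE)
  have factor: "is_unit q" if "h = p * q" "poly (ac_poly p) b = 0" for p q
  proof -
    have "p \<noteq> 0" "q \<noteq> 0"
      using h(1) that(1) by auto
    hence "degree q = 0"
      using least[OF _ that(2)] that(1) by (simp add: degree_mult_eq)
    thus ?thesis
      using \<open>q \<noteq> 0\<close> by (simp add: is_unit_iff_degree)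
  qed
  have irr: "irreducible h"
  proof (rule irreducibleI)
    show "\<not> is_unit h"
      using pos h(1) by (simp add: is_unit_iff_degree)
    fix p q assume pq: "h = p * q"
    hence "poly (ac_poly p) b = 0 \<or> poly (ac_poly q) b = 0"
      using h(2) by simp
    thus "is_unit p \<or> is_unit q"
      using factor[of p q] factor[of q p] pq by (auto simp: mult.commute)
  qed (rule h(1))
  let ?h = "smult (inverse (lead_coeff h)) h"
  have unit: "?h = [:inverse (lead_coeff h):] * h" "is_unit [:inverse (lead_coeff h):]"
    using h(1) by (auto simp: is_unit_iff_degree)
  have "irreducible ?h"
    unfolding unit(1) using irr unit(2) by (simp only: irreducible_mult_unit_left)
  moreover have "V (\<theta> - b) \<le> delta ?h"
    using h by (intro V_le_delta) (simp_all add: unit(1) del: mult_pCons_left)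
  moreover have "degree h \<le> degree g"
    using least \<open>g \<noteq> 0\<close> b(1) by blast
  ultimately show ?thesis
    using h(1) pos b(2) by (intro that[of ?h]) auto
qed


subsection \<open>Limit steps\<close>

text \<open>In the application, S is \<open>frame_indices (A l)\<close>, e gives the
  \<open>delta\<close> of the frame member at an index, n is the degree of the level and \<psi> is
  the chosen member of the next level.\<close>

context
  fixes S :: "'j::linorder set" and \<rho> :: "'j \<Rightarrow> 'k poly \<Rightarrow> 'g vinf" and e :: "'j \<Rightarrow> 'g vinf"
    and n :: nat and \<psi> :: "'k poly"
  assumes \<rho>: "\<And>x. x \<in> S \<Longrightarrow> \<rho> x = ball (e x)"
    and order: "\<And>x y. x \<in> S \<Longrightarrow> y \<in> S \<Longrightarrow> x < y \<longleftrightarrow> e x < e y"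
    and nonempty: "S \<noteq> {}" and no_max: "\<And>x. x \<in> S \<Longrightarrow> \<exists>y\<in>S. x < y"
    and vdeg: "\<And>x. x \<in> S \<Longrightarrow> vdeg (\<rho> x) = enat n"
    and \<psi>: "optimal \<psi>" "n < degree \<psi>" "\<And>x. x \<in> S \<Longrightarrow> e x < delta \<psi>"
    and cofinal: "\<And>g. 0 < degree g \<Longrightarrow> degree g < degree \<psi> \<Longrightarrow> \<exists>x\<in>S. delta g \<le> e x"
begin

lemma stable_small:
  assumes "degree g < degree \<psi>"
  obtains x where "x \<in> S" "\<And>y. y \<in> S \<Longrightarrow> x \<le> y \<Longrightarrow> \<rho> y g = nu g"
proof -
  obtain x where x: "x \<in> S" "degree g > 0 \<Longrightarrow> delta g \<le> e x"
    using cofinal[of g] assms nonempty by (cases "degree g > 0") auto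
  have "\<rho> y g = nu g" if y: "y \<in> S" "x \<le> y" for y
  proof -
    have "e x \<le> e y"
      using order[OF y(1) x(1)] y(2) leD leI by blast
    thus ?thesis
      unfolding \<rho>[OF y(1)] using x(2) by (intro ball_eq_nu) (auto intro: order_trans)
  qed
  thus ?thesis
    using that x(1) by blast
qed

lemma stable_if_small:
  assumes "degree g < degree \<psi>"
  shows "stable S \<rho> g"
proof -
  obtain x where "x \<in> S" "\<And>y. y \<in> S \<Longrightarrow> x \<le> y \<Longrightarrow> \<rho> y g = nu g"
    by (rule stable_small[OF assms]) (rule that)
  thus ?thesis
    unfolding stable_def by (intro bexI[of _ x]) auto
qed

lemma stable_val_small:
  assumes "degree g < degree \<psi>"
  shows "stable_val S \<rho> g = nu g"
proof -
  obtain x where x: "x \<in> S" "\<And>y. y \<in> S \<Longrightarrow> x \<le> y \<Longrightarrow> \<rho> y g = nu g"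
    by (rule stable_small[OF assms]) (rule that)
  show ?thesis
    unfolding stable_val_def
  proof (rule the_equality)
    show "\<exists>i\<in>S. \<rho> i g = nu g \<and> (\<forall>j\<in>S. i < j \<longrightarrow> \<rho> j g = nu g)"
      using x by (intro bexI[of _ x]) auto
    fix w assume "\<exists>i\<in>S. \<rho> i g = w \<and> (\<forall>j\<in>S. i < j \<longrightarrow> \<rho> j g = w)"
    then obtain i where i: "i \<in> S" "\<And>j. j \<in> S \<Longrightarrow> i < j \<Longrightarrow> \<rho> j g = w"
      by blast
    \<comment> \<open>Two eventually constant values are compared at an index beyond both
      thresholds, which exists because S has no maximum.\<close>
    have "max i x \<in> S"
      using i(1) x(1) by (simp add: max_def)
    then obtain j where j: "j \<in> S" "max i x < j"
      using no_max by blast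
    have "\<rho> j g = w" "\<rho> j g = nu g"
      using i(2)[of j] x(2)[of j] j by auto
    thus "w = nu g"
      by simp
  qed
qed

text \<open>All radii stay below \<open>delta \<psi>\<close>, so each increase of the radius
  increases the value of \<psi>.\<close>

lemma not_stable: "\<not> stable S \<rho> \<psi>"
proof
  assume "stable S \<rho> \<psi>"
  then obtain x where x: "x \<in> S" "\<And>y. y \<in> S \<Longrightarrow> x < y \<Longrightarrow> \<rho> x \<psi> = \<rho> y \<psi>"
    unfolding stable_def by blast
  obtain y where y: "y \<in> S" "x < y"
    using no_max[OF x(1)] by blast
  have "ball (e x) \<psi> < ball (e y) \<psi>"
    using order[OF x(1) y(1)] y(2) \<psi>(1) \<psi>(3)[OF x(1)] by (intro ball_less) (auto simp: optimal_def)
  thus False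
    using x(2)[OF y] \<rho> x(1) y(1) by simp
qed

lemma in_KP_inf: "\<psi> \<in> KP_inf S \<rho>"
proof -
  have "degree \<psi> \<le> degree g" if "\<not> stable S \<rho> g" for g
    using that stable_if_small[of g] by (rule contrapos_np) simp
  moreover have "monic \<psi>"
    using \<psi>(1) by (simp add: optimal_def)
  ultimately show ?thesis
    using not_stable by (simp add: KP_inf_def)
qed

lemma deg_inf_eq: "deg_inf S \<rho> = enat (degree \<psi>)"
  unfolding deg_inf_def
proof (rule order_antisym)
  show "(INF \<phi>\<in>KP_inf S \<rho>. enat (degree \<phi>)) \<le> enat (degree \<psi>)"
    by (rule INF_lower[OF in_KP_inf])
  show "enat (degree \<psi>) \<le> (INF \<phi>\<in>KP_inf S \<rho>. enat (degree \<phi>))"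
  proof (rule INF_greatest)
    fix \<phi> assume "\<phi> \<in> KP_inf S \<rho>"
    hence "\<not> stable S \<rho> \<phi>"
      by (simp add: KP_inf_def)
    thus "enat (degree \<psi>) \<le> enat (degree \<phi>)"
      using stable_if_small[of \<phi>] by (cases "degree \<phi> < degree \<psi>") simp_all
  qed
qed

lemma family_deg: "family_deg S \<rho> (enat n)"
  unfolding family_deg_def using vdeg nonempty by blast

lemma essential: "essential_continuous_family v S \<rho>"
proof -
  have "i \<le> j \<longleftrightarrow> \<rho> i \<le> \<rho> j" if ij: "i \<in> S" "j \<in> S" for i j
  proof
    assume "i \<le> j"
    hence "e i \<le> e j"
      using order[OF ij(2,1)] leD leI by blast
    thus "\<rho> i \<le> \<rho> j"
      using ij by (auto simp: \<rho> le_fun_def ball_mono)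
  next
    assume le: "\<rho> i \<le> \<rho> j"
    show "i \<le> j"
    proof (rule ccontr)
      assume "\<not> i \<le> j"
      hence "e j < e i"
        using order[OF ij(2,1)] by auto
      hence "ball (e j) \<psi> < ball (e i) \<psi>"
        using \<psi>(1) \<psi>(3)[OF ij(2)] by (intro ball_less) (auto simp: optimal_def)
      thus False
        using le_funD[OF le, of \<psi>] ij by (simp add: \<rho>)
    qed
  qed
  moreover have "valuation_over v (\<rho> i)" if "i \<in> S" for i
    using that by (simp add: \<rho> valuation_over_ball)
  ultimately have "valuation_family v S \<rho>"
    unfolding valuation_family_def using nonempty no_max by simp
  thus ?thesis
    unfolding essential_continuous_family_def using family_deg \<psi>(2) by (auto simp: deg_inf_eq)
qed

lemma limit_augmentation: "limit_augmentation S \<rho> \<psi> (nu \<psi>) (ball (delta \<psi>))"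
proof -
  have "\<rho> x \<psi> < nu \<psi>" if "x \<in> S" for x
    using \<rho> that \<psi>(1) \<psi>(3)[OF that] by (auto simp: optimal_def intro: ball_less_nu)
  thus ?thesis
    unfolding limit_augmentation_def
    using in_KP_inf augment_optimal[OF \<psi>(1), of "stable_val S \<rho>"] stable_val_small by auto
qed

end

end


subsection \<open>Okutsu frames\<close>

context henselian_poly
begin

text \<open>Translates the frame conditions from weights to \<open>delta\<close>. The weights of
  frame members are comparable through \<open>wt_le_iff_delta\<close>; any other g is first replaced
  by an irreducible polynomial at least as close to \<theta>.\<close>

lemma okutsu_frame_delta:
  assumes "okutsu_frame v F r \<Phi>"
  obtains m where "m 0 = 1" "\<And>l. l \<le> r \<Longrightarrow> m l < m (Suc l)"
    "\<And>l \<phi>. l \<le> Suc r \<Longrightarrow> \<phi> \<in> \<Phi> l \<Longrightarrow> degree \<phi> = m l"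
    "\<And>l \<phi>. l \<le> Suc r \<Longrightarrow> \<phi> \<in> \<Phi> l \<Longrightarrow> optimal \<phi>"
    "\<And>l \<phi> \<psi>. l \<le> r \<Longrightarrow> \<phi> \<in> \<Phi> l \<Longrightarrow> \<psi> \<in> \<Phi> (Suc l) \<Longrightarrow> delta \<phi> < delta \<psi>"
    "\<And>l g. l \<le> r \<Longrightarrow> 0 < degree g \<Longrightarrow> degree g < m (Suc l) \<Longrightarrow> \<exists>\<phi>\<in>\<Phi> l. delta g \<le> delta \<phi>"
    "\<And>l \<phi>. l \<le> r \<Longrightarrow> \<not> is_singleton (\<Phi> l) \<Longrightarrow> \<phi> \<in> \<Phi> l \<Longrightarrow> \<exists>\<phi>'\<in>\<Phi> l. delta \<phi> < delta \<phi>'"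
proof -
  obtain m where fr: "\<forall>l\<le>Suc r. \<Phi> l \<noteq> {} \<and> (\<forall>\<phi>\<in>\<Phi> l. monic \<phi> \<and> irreducible \<phi>)"
    "m 0 = 1" "\<forall>l\<le>r. m l < m (Suc l)" "\<forall>l\<le>Suc r. \<forall>\<phi>\<in>\<Phi> l. degree \<phi> = m l"
    "\<forall>l\<le>r. \<forall>g. monic g \<and> 0 < degree g \<and> degree g < m (Suc l) \<longrightarrow> (\<exists>\<phi>\<in>\<Phi> l. wt nu g \<le> wt nu \<phi>)"
    "\<forall>l\<le>r. has_max (weights nu (m (Suc l))) \<longrightarrow> is_singleton (\<Phi> l)"
    "\<forall>l\<le>r. \<forall>\<phi>\<in>\<Phi> l. \<forall>\<psi>\<in>\<Phi> (Suc l). wt nu \<phi> < wt nu \<psi>"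
    using assms unfolding okutsu_frame_def Let_def by (elim conjE exE) (rule that)
  have m: "m l < m (Suc l)" if "l \<le> r" for l
    using fr(3) that by blast
  have deg: "degree \<phi> = m l" if "l \<le> Suc r" "\<phi> \<in> \<Phi> l" for l \<phi>
    using fr(4) that by blast
  have dom: "\<exists>\<phi>\<in>\<Phi> l. wt nu g \<le> wt nu \<phi>"
    if "l \<le> r" "monic g" "0 < degree g" "degree g < m (Suc l)" for l g
    using fr(5) that by blast
  have of1: "is_singleton (\<Phi> l)" if "l \<le> r" "has_max (weights nu (m (Suc l)))" for l
    using fr(6) that by blast
  have of3: "wt nu \<phi> < wt nu \<psi>" if "l \<le> r" "\<phi> \<in> \<Phi> l" "\<psi> \<in> \<Phi> (Suc l)" for l \<phi> \<psi>
    using fr(7) that by blast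
  have mono: "l \<le> Suc r \<Longrightarrow> \<phi> \<in> \<Phi> l \<Longrightarrow> monic \<phi>" "l \<le> Suc r \<Longrightarrow> \<phi> \<in> \<Phi> l \<Longrightarrow> irreducible \<phi>" for l \<phi>
    using fr(1) by blast+
  have pos: "degree \<phi> > 0" if "l \<le> Suc r" "\<phi> \<in> \<Phi> l" for l \<phi>
    using mono[OF that] is_unit_iff_degree[of \<phi>] by (cases "\<phi> = 0") (auto simp: irreducible_def)
  have delta: "delta \<phi> < delta \<psi>"
    if "wt nu \<phi> < wt nu \<psi>" "\<phi> \<in> \<Phi> l" "\<psi> \<in> \<Phi> l'" "l \<le> Suc r" "l' \<le> Suc r" for \<phi> \<psi> l l'
  proof -
    have "\<not> wt nu \<psi> \<le> wt nu \<phi>"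
      using that(1) by simp
    thus ?thesis
      using that mono pos by (subst (asm) wt_le_iff_delta) auto
  qed
  have less: "delta \<phi> < delta \<psi>" if "l \<le> r" "\<phi> \<in> \<Phi> l" "\<psi> \<in> \<Phi> (Suc l)" for l \<phi> \<psi>
    using of3[OF that] that by (intro delta[of \<phi> \<psi> l "Suc l"]) auto
  have bound: "\<exists>\<phi>\<in>\<Phi> l. delta g \<le> delta \<phi>" if l: "l \<le> r" "0 < degree g" "degree g < m (Suc l)" for l g
  proof -
    obtain h where h: "monic h" "irreducible h" "degree h > 0" "degree h \<le> degree g" "delta g \<le> delta h"
      by (rule irreducible_with_delta[OF l(2)])
    obtain \<phi> where \<phi>: "\<phi> \<in> \<Phi> l" "wt nu h \<le> wt nu \<phi>"
      using dom[OF l(1) h(1,3)] h(4) l(3) by auto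
    have "l \<le> Suc r"
      using l(1) by simp
    have "delta h \<le> delta \<phi>"
      using \<phi>(2) by (subst (asm) wt_le_iff_delta) (use h mono pos \<phi>(1) \<open>l \<le> Suc r\<close> in auto)
    thus ?thesis
      using h(5) \<phi>(1) by (meson order_trans)
  qed
  have optimal: "optimal \<phi>" if "l \<le> Suc r" "\<phi> \<in> \<Phi> l" for l \<phi>
  proof -
    have "delta g < delta \<phi>" if g: "0 < degree g" "degree g < degree \<phi>" for g
    \<comment> \<open>At level 0 the degree is 1 and no such g exists; otherwise the previous level
      dominates g and is itself dominated strictly.\<close>
    proof (cases l)
      case 0
      thus ?thesis
        using g deg[OF \<open>l \<le> Suc r\<close> \<open>\<phi> \<in> \<Phi> l\<close>] fr(2) by simp
    next
      case (Suc l')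
      hence "l' \<le> r"
        using \<open>l \<le> Suc r\<close> by simp
      obtain \<psi> where "\<psi> \<in> \<Phi> l'" "delta g \<le> delta \<psi>"
        using bound[OF \<open>l' \<le> r\<close> g(1)] g(2) deg[OF \<open>l \<le> Suc r\<close> \<open>\<phi> \<in> \<Phi> l\<close>] Suc by auto
      thus ?thesis
        using less[OF \<open>l' \<le> r\<close>] \<open>\<phi> \<in> \<Phi> l\<close> Suc by (meson le_less_trans)
    qed
    thus ?thesis
      using mono[OF that] pos[OF that] by (simp add: optimal_def)
  qed
  have no_max: "\<exists>\<phi>'\<in>\<Phi> l. delta \<phi> < delta \<phi>'" if l: "l \<le> r" "\<not> is_singleton (\<Phi> l)" "\<phi> \<in> \<Phi> l" for l \<phi>
  proof -
    have l': "l \<le> Suc r"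
      using l(1) by simp
    have "\<not> has_max (weights nu (m (Suc l)))"
      using of1 l by blast
    \<comment> \<open>As \<phi> has degree below that of the next level, its weight belongs to a set
      without maximum; a polynomial of larger weight is in turn dominated by a frame member.\<close>
    moreover have "wt nu \<phi> \<in> weights nu (m (Suc l))"
      unfolding weights_def using mono(1)[OF l' l(3)] pos[OF l' l(3)] deg[OF l' l(3)] m[OF l(1)] by auto
    ultimately obtain w where "w \<in> weights nu (m (Suc l))" "wt nu \<phi> < w"
      unfolding has_max_def by (meson not_le)
    then obtain g where g: "monic g" "0 < degree g" "degree g < m (Suc l)" "wt nu \<phi> < wt nu g"
      unfolding weights_def by blast
    obtain \<phi>' where \<phi>': "\<phi>' \<in> \<Phi> l" "wt nu g \<le> wt nu \<phi>'"
      using dom[OF l(1) g(1-3)] by blast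
    have "wt nu \<phi> < wt nu \<phi>'"
      using g(4) \<phi>'(2) by simp
    thus ?thesis
      using delta[OF _ l(3) \<phi>'(1) l' l'] \<phi>'(1) by blast
  qed
  show ?thesis
    by (rule that[of m]) (fact fr(2) m deg optimal less bound no_max)+
qed

end


section \<open>Assembly of the chain from ball valuations with radii given by the frame\<close>

theorem theorem4p5:
  fixes v :: "'k::field \<Rightarrow> 'g::linordered_ab_group_add vinf"
    and F :: "'k poly"
    and r :: nat
    and \<Phi> :: "nat \<Rightarrow> 'k poly set"
    and I :: "nat \<Rightarrow> 'i::linorder set"
    and \<chi> :: "nat \<Rightarrow> 'i \<Rightarrow> 'k poly"
    and \<phi> :: "nat \<Rightarrow> 'k poly"
    and vF :: "'k poly \<Rightarrow> 'g vinf"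
    and \<gamma> :: "nat \<Rightarrow> 'g vinf"
    and \<mu> :: "nat \<Rightarrow> 'k poly \<Rightarrow> 'g vinf"
    and A :: "nat \<Rightarrow> 'i set"
  assumes "henselian v"
    and "values_in_divisible_hull v"
    and "monic F" and "irreducible F" and "degree F > 1"
    and "okutsu_frame v F r \<Phi>"
    and "\<And>l. l \<le> r \<Longrightarrow> \<not> is_singleton (\<Phi> l) \<Longrightarrow> indexes (val_of_poly v F) (I l) (\<chi> l) (\<Phi> l)"
    and "\<And>l. l \<le> Suc r \<Longrightarrow> \<phi> l \<in> \<Phi> l"
  defines "vF \<equiv> val_of_poly v F"
    and "\<gamma> \<equiv> \<lambda>l. vF (\<phi> l)"
    and "\<mu> \<equiv> \<lambda>l. truncation vF (\<phi> l)"
    and "A \<equiv> \<lambda>l. {i \<in> I l. vF (\<chi> l i) > \<gamma> l}"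
  shows "(\<forall>l\<le>Suc r. valuation_over v (\<mu> l)) \<and>
    MLV_chain v (Suc r) \<mu> \<phi> \<gamma>
      (\<lambda>l. if is_singleton (\<Phi> l) then Ordinary
           else Limit (frame_indices (A l)) (frame_family vF (\<chi> l) (\<mu> l)))
      vF \<and>
    \<phi> (Suc r) = F \<and> \<gamma> (Suc r) = \<infinity> \<and>
    (\<forall>l\<le>r. \<not> is_singleton (\<Phi> l) \<longrightarrow>
       (\<forall>i\<in>A l. ordinary_augmentation (\<mu> l) (\<chi> l i) (vF (\<chi> l i))
          (augment (\<mu> l) (\<chi> l i) (vF (\<chi> l i)))))"
proof -
  interpret henselian_poly v F
    using assms(1-5) by unfold_locales auto
  obtain m where m: "m 0 = 1" "\<And>l. l \<le> r \<Longrightarrow> m l < m (Suc l)"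
    and deg: "\<And>l \<phi>. l \<le> Suc r \<Longrightarrow> \<phi> \<in> \<Phi> l \<Longrightarrow> degree \<phi> = m l"
    and optimal: "\<And>l \<phi>. l \<le> Suc r \<Longrightarrow> \<phi> \<in> \<Phi> l \<Longrightarrow> optimal \<phi>"
    and less: "\<And>l \<phi> \<psi>. l \<le> r \<Longrightarrow> \<phi> \<in> \<Phi> l \<Longrightarrow> \<psi> \<in> \<Phi> (Suc l) \<Longrightarrow> delta \<phi> < delta \<psi>"
    and bound: "\<And>l g. l \<le> r \<Longrightarrow> 0 < degree g \<Longrightarrow> degree g < m (Suc l) \<Longrightarrow> \<exists>\<phi>\<in>\<Phi> l. delta g \<le> delta \<phi>"
    and no_max: "\<And>l \<phi>. l \<le> r \<Longrightarrow> \<not> is_singleton (\<Phi> l) \<Longrightarrow> \<phi> \<in> \<Phi> l \<Longrightarrow> \<exists>\<phi>'\<in>\<Phi> l. delta \<phi> < delta \<phi>'"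
    by (rule okutsu_frame_delta[OF assms(6)]) (rule that)
  have \<phi>: "\<phi> l \<in> \<Phi> l" if "l \<le> Suc r" for l
    using assms(8) that .
  have \<phi>F: "\<phi> (Suc r) = F"
    using assms(6) \<phi>[of "Suc r"] by (auto simp: okutsu_frame_def Let_def)
  have fin: "delta \<psi> \<noteq> Infty" if "l \<le> r" "\<psi> \<in> \<Phi> l" for l \<psi>
    using less[OF that \<phi>[of "Suc l"]] that(1) by (intro vinf_less_not_Infty) simp
  have \<mu>_eq: "\<mu> l = ball (delta (\<phi> l))" if "l \<le> Suc r" for l
    unfolding \<mu>_def vF_def using optimal[OF that \<phi>[OF that]] by (rule truncation_optimal)
  have \<mu>_last: "\<mu> (Suc r) = vF"
    using \<mu>_eq[of "Suc r"] by (simp add: \<phi>F delta_F vF_def nu_eq_ball)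
  have vdeg_\<mu>: "vdeg (\<mu> l) = enat (m l)" if "l \<le> Suc r" for l
  proof (cases "l = Suc r")
    case True
    thus ?thesis
      using \<mu>_last vdeg_nu deg[OF that \<phi>[OF that]] \<phi>F by (simp add: vF_def)
  next
    case False
    hence "l \<le> r"
      using that by simp
    thus ?thesis
      using vdeg_ball[OF optimal[OF that \<phi>[OF that]] fin[OF _ \<phi>[OF that]]]
        \<mu>_eq[OF that] deg[OF that \<phi>[OF that]] by simp
  qed
  have small: "\<mu> l a = nu a" if "l \<le> Suc r" "degree a < m l" for l a
    unfolding \<mu>_eq[OF that(1)] using optimal[OF that(1) \<phi>[OF that(1)]] deg[OF that(1) \<phi>[OF that(1)]] that(2)
    by (intro ball_eq_nu) (auto simp: optimal_def intro: less_imp_le)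
  \<comment> \<open>All members of one level have the same degree, and below it \<mu> l is
    \<open>nu\<close>.\<close>
  have augment_\<chi>: "augment (\<mu> l) \<psi> (vF \<psi>) = ball (delta \<psi>)" if "l \<le> r" "\<psi> \<in> \<Phi> l" for l \<psi>
    unfolding vF_def using that optimal[of l \<psi>] deg[of l \<psi>] small[of l]
    by (intro augment_optimal) auto
  have delta_less_iff: "delta \<psi> < delta \<psi>' \<longleftrightarrow> vF \<psi> < vF \<psi>'"
    if "l \<le> r" "\<psi> \<in> \<Phi> l" "\<psi>' \<in> \<Phi> l" for l \<psi> \<psi>'
  proof -
    have l: "l \<le> Suc r"
      using that(1) by simp
    have "vF \<psi>' \<le> vF \<psi> \<longleftrightarrow> delta \<psi>' \<le> delta \<psi>"
      unfolding vF_def using optimal[OF l that(2)] optimal[OF l that(3)] deg[OF l that(2)] deg[OF l that(3)]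
      by (intro nu_le_iff_delta) (auto simp: optimal_def)
    thus ?thesis
      by (auto simp flip: not_le)
  qed
  have ord: "ordinary_augmentation (\<mu> l) \<psi> (vF \<psi>) (augment (\<mu> l) \<psi> (vF \<psi>))"
    if "l \<le> r" "monic \<psi>" "degree \<psi> > 0" "delta (\<phi> l) < delta \<psi>"
      "\<And>g. 0 < degree g \<Longrightarrow> degree g < degree \<psi> \<Longrightarrow> delta g \<le> delta (\<phi> l)" for l \<psi>
    unfolding ordinary_augmentation_def using that next_in_KP[OF that(2-5)] ball_less_nu[OF that(3,4)]
    by (simp add: \<mu>_eq vF_def)
  have ord_\<chi>: "ordinary_augmentation (\<mu> l) \<psi> (vF \<psi>) (augment (\<mu> l) \<psi> (vF \<psi>))"
    if "l \<le> r" "\<psi> \<in> \<Phi> l" "vF (\<phi> l) < vF \<psi>" for l \<psi>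
  proof (rule ord[OF that(1)])
    have l: "l \<le> Suc r"
      using that(1) by simp
    note \<phi>l = \<phi>[OF l]
    show "delta (\<phi> l) < delta \<psi>"
      using delta_less_iff[OF that(1) \<phi>l that(2)] that(3) by simp
    show "monic \<psi>" "degree \<psi> > 0"
      using optimal[OF l that(2)] by (auto simp: optimal_def)
    show "delta g \<le> delta (\<phi> l)" if "0 < degree g" "degree g < degree \<psi>" for g
      using optimal[OF l \<phi>l] that deg[OF l \<phi>l] deg[OF l \<open>\<psi> \<in> \<Phi> l\<close>] by (auto simp: optimal_def less_imp_le)
  qed
  have \<chi>: "bij_betw (\<chi> l) (I l) (\<Phi> l)" "\<And>i j. i \<in> I l \<Longrightarrow> j \<in> I l \<Longrightarrow> i < j \<longleftrightarrow> vF (\<chi> l i) < vF (\<chi> l j)"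
    if "l \<le> r" "\<not> is_singleton (\<Phi> l)" for l
    using assms(7)[OF that] by (auto simp: indexes_def vF_def)
  have \<chi>_mem: "\<chi> l i \<in> \<Phi> l" if "l \<le> r" "\<not> is_singleton (\<Phi> l)" "i \<in> I l" for l i
    using \<chi>(1)[OF that(1,2)] that(3) by (auto simp: bij_betw_def)

  have step_ordinary: "ordinary_augmentation (\<mu> l) (\<phi> (Suc l)) (\<gamma> (Suc l)) (\<mu> (Suc l))"
    if l: "l \<le> r" "is_singleton (\<Phi> l)" for l
  proof -
    have l': "l \<le> Suc r" "Suc l \<le> Suc r"
      using l(1) by auto
    have \<Phi>: "\<Phi> l = {\<phi> l}"
      using l(2) \<phi>[OF l'(1)] by (auto simp: is_singleton_def)
    have opt: "optimal (\<phi> (Suc l))"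
      using optimal[OF l'(2) \<phi>[OF l'(2)]] .
    \<comment> \<open>The only frame member available as a bound is \<phi> l, so \<phi> (Suc l) has
      least degree beyond \<mu> l.\<close>
    have le: "delta g \<le> delta (\<phi> l)" if "0 < degree g" "degree g < degree (\<phi> (Suc l))" for g
      using bound[OF l(1) that(1)] that(2) deg[OF l'(2) \<phi>[OF l'(2)]] \<Phi> by auto
    have "augment (\<mu> l) (\<phi> (Suc l)) (vF (\<phi> (Suc l))) = \<mu> (Suc l)"
      unfolding vF_def \<mu>_eq[OF l'(1)] \<mu>_eq[OF l'(2)] using le
      by (intro augment_optimal opt ball_eq_nu)
    thus ?thesis
      using ord[OF l(1), of "\<phi> (Suc l)"] opt le less[OF l(1) \<phi>[OF l'(1)] \<phi>[OF l'(2)]]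
      by (simp add: optimal_def \<gamma>_def)
  qed

  have step_limit: "essential_continuous_family v (frame_indices (A l)) (frame_family vF (\<chi> l) (\<mu> l)) \<and>
      (\<exists>i\<in>frame_indices (A l). (\<forall>j\<in>frame_indices (A l). i \<le> j) \<and> frame_family vF (\<chi> l) (\<mu> l) i = \<mu> l) \<and>
      family_deg (frame_indices (A l)) (frame_family vF (\<chi> l) (\<mu> l)) (vdeg (\<mu> l)) \<and>
      \<phi> l \<notin> tset (\<mu> l) (\<mu> (Suc l)) \<and>
      limit_augmentation (frame_indices (A l)) (frame_family vF (\<chi> l) (\<mu> l)) (\<phi> (Suc l)) (\<gamma> (Suc l)) (\<mu> (Suc l))"
    if l: "l \<le> r" "\<not> is_singleton (\<Phi> l)" for l
  proof -
    have l': "l \<le> Suc r" "Suc l \<le> Suc r"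
      using l(1) by auto
    let ?S = "frame_indices (A l)" and ?\<rho> = "frame_family vF (\<chi> l) (\<mu> l)"
    \<comment> \<open>The index \<open>None\<close> carries \<phi> l, so every valuation of the
      family, the first one included, is the ball valuation of radius
      \<open>delta (p x)\<close>.\<close>
    define p where "p x = (case x of None \<Rightarrow> \<phi> l | Some i \<Rightarrow> \<chi> l i)" for x
    have p: "p x \<in> \<Phi> l" if "x \<in> ?S" for x
      using that \<phi>[OF l'(1)] \<chi>_mem[OF l] by (auto simp: p_def frame_indices_def A_def)
    have \<rho>: "?\<rho> x = ball (delta (p x))" if "x \<in> ?S" for x
      using augment_\<chi>[OF l(1) p[OF that]] \<mu>_eq[OF l'(1)]
      by (auto simp: frame_family_def p_def split: option.splits)
    have order: "x < y \<longleftrightarrow> delta (p x) < delta (p y)" if "x \<in> ?S" "y \<in> ?S" for x y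
    proof -
      have "x < y \<longleftrightarrow> vF (p x) < vF (p y)"
        using that \<chi>(2)[OF l] by (auto simp: frame_indices_def A_def p_def \<gamma>_def)
      thus ?thesis
        using delta_less_iff[OF l(1) p[OF that(1)] p[OF that(2)]] by simp
    qed
    have above: "\<exists>y\<in>?S. p y = \<psi>" if "\<psi> \<in> \<Phi> l" "delta (\<phi> l) < delta \<psi>" for \<psi>
    proof -
      have "\<psi> \<in> \<chi> l ` I l"
        using bij_betw_imp_surj_on[OF \<chi>(1)[OF l]] that(1) by simp
      then obtain i where i: "i \<in> I l" "\<chi> l i = \<psi>"
        by blast
      hence "i \<in> A l"
        using that delta_less_iff[OF l(1) \<phi>[OF l'(1)] that(1)] by (auto simp: A_def \<gamma>_def)
      thus ?thesis
        using i(2) by (intro bexI[of _ "Some i"]) (auto simp: p_def frame_indices_def)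
    qed
    have None: "None \<in> ?S"
      by (simp add: frame_indices_def)
    have ge: "delta (\<phi> l) \<le> delta (p x)" if "x \<in> ?S" for x
      using order[OF None that] by (cases x) (auto simp: p_def)
    have no_max': "\<exists>y\<in>?S. x < y" if x: "x \<in> ?S" for x
    proof -
      obtain \<psi> where \<psi>: "\<psi> \<in> \<Phi> l" "delta (p x) < delta \<psi>"
        using no_max[OF l p[OF x]] by blast
      obtain y where y: "y \<in> ?S" "p y = \<psi>"
        using above[OF \<psi>(1) le_less_trans[OF ge[OF x] \<psi>(2)]] by blast
      have "x < y"
        using order[OF x y(1)] \<psi>(2) y(2) by simp
      thus ?thesis
        using y(1) by blast
    qed
    have cofinal: "\<exists>x\<in>?S. delta g \<le> delta (p x)" if g: "0 < degree g" "degree g < degree (\<phi> (Suc l))" for g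
    proof -
      obtain \<psi> where \<psi>: "\<psi> \<in> \<Phi> l" "delta g \<le> delta \<psi>"
        using bound[OF l(1) g(1)] g(2) deg[OF l'(2) \<phi>[OF l'(2)]] by auto
      show ?thesis
      \<comment> \<open>A frame member not strictly closer to \<theta> than \<phi> l is not indexed
        by A l; then \<phi> l itself bounds g.\<close>
      proof (cases "delta (\<phi> l) < delta \<psi>")
        case True
        thus ?thesis
          using above[OF \<psi>(1)] \<psi>(2) by auto
      next
        case False
        hence "delta g \<le> delta (p None)"
          using \<psi>(2) by (simp add: p_def)
        thus ?thesis
          using None by blast
      qed
    qed
    have vdeg: "vdeg (?\<rho> x) = enat (m l)" if "x \<in> ?S" for x
      using vdeg_ball[OF optimal[OF l'(1) p[OF that]] fin[OF l(1) p[OF that]]] deg[OF l'(1) p[OF that]]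
      by (simp add: \<rho>[OF that])
    have opt: "optimal (\<phi> (Suc l))" "m l < degree (\<phi> (Suc l))"
      using optimal[OF l'(2) \<phi>[OF l'(2)]] deg[OF l'(2) \<phi>[OF l'(2)]] m(2)[OF l(1)] by auto
    have below: "delta (p x) < delta (\<phi> (Suc l))" if "x \<in> ?S" for x
      using less[OF l(1) p[OF that] \<phi>[OF l'(2)]] .
    have nonempty: "?S \<noteq> {}"
      using None by blast
    note family = \<rho> order nonempty no_max' vdeg opt below cofinal
    have "essential_continuous_family v ?S ?\<rho>"
      by (rule essential[where e = "\<lambda>x. delta (p x)"]) (fact family)+
    moreover have "family_deg ?S ?\<rho> (enat (m l))"
      by (rule family_deg[where e = "\<lambda>x. delta (p x)"]) (fact family)+
    moreover have "limit_augmentation ?S ?\<rho> (\<phi> (Suc l)) (nu (\<phi> (Suc l))) (ball (delta (\<phi> (Suc l))))"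
      by (rule limit_augmentation[where e = "\<lambda>x. delta (p x)"]) (fact family)+
    \<comment> \<open>\<mu> l already gives \<phi> l its full value, which \<mu> (Suc l) cannot
      exceed.\<close>
    moreover have "\<mu> l (\<phi> l) = nu (\<phi> l)" "\<mu> (Suc l) (\<phi> l) \<le> nu (\<phi> l)"
      using \<mu>_eq[OF l'(1)] \<mu>_eq[OF l'(2)] ball_eq_nu[of "\<phi> l"] ball_le_nu by simp_all
    hence "\<phi> l \<notin> tset (\<mu> l) (\<mu> (Suc l))"
      by (simp add: tset_def not_less)
    moreover have "\<exists>i\<in>?S. (\<forall>j\<in>?S. i \<le> j) \<and> ?\<rho> i = \<mu> l"
      using None by (intro bexI[of _ None]) (auto simp: frame_family_def)
    ultimately show ?thesis
      using vdeg_\<mu>[OF l'(1)] \<mu>_eq[OF l'(2)] by (simp add: \<gamma>_def vF_def)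
  qed

  have valuations: "valuation_over v (\<mu> l)" if "l \<le> Suc r" for l
    using \<mu>_eq[OF that] valuation_over_ball by simp
  have start: "vdeg (\<mu> 0) = 1" "\<phi> 0 \<in> KP (\<mu> 0)" "degree (\<phi> 0) = 1" "\<gamma> 0 = \<mu> 0 (\<phi> 0)"
  proof -
    have \<phi>0: "\<phi> 0 \<in> \<Phi> 0"
      by (rule \<phi>) simp
    show "vdeg (\<mu> 0) = 1"
      using vdeg_\<mu>[of 0] m(1) by (simp add: one_enat_def)
    obtain \<alpha> where \<alpha>: "poly (ac_poly (\<phi> 0)) \<alpha> = 0" "V (\<theta> - \<alpha>) = delta (\<phi> 0)"
      by (rule optimalE[OF optimal[OF _ \<phi>0]]) simp_all
    show "\<phi> 0 \<in> KP (\<mu> 0)"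
      using optimal_in_KP[OF optimal[OF _ \<phi>0] \<alpha> fin[OF _ \<phi>0]] \<mu>_eq[of 0] by simp
    show "degree (\<phi> 0) = 1"
      using deg[OF _ \<phi>0] m(1) by simp
    show "\<gamma> 0 = \<mu> 0 (\<phi> 0)"
      using \<mu>_eq[of 0] ball_eq_nu[of "\<phi> 0"] by (simp add: \<gamma>_def vF_def)
  qed
  have vdeg_step: "vdeg (\<mu> l) < vdeg (\<mu> (Suc l))" "vdeg (\<mu> (Suc l)) < \<infinity>" if "l \<le> r" for l
    using vdeg_\<mu>[of l] vdeg_\<mu>[of "Suc l"] m(2)[OF that] that by simp_all
  have "MLV_chain v (Suc r) \<mu> \<phi> \<gamma>
      (\<lambda>l. if is_singleton (\<Phi> l) then Ordinary
           else Limit (frame_indices (A l)) (frame_family vF (\<chi> l) (\<mu> l))) vF"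
    unfolding MLV_chain_def
  proof (intro conjI allI impI valuations start \<mu>_last)
    fix l assume "l < Suc r"
    hence l: "l \<le> r"
      by simp
    show "case if is_singleton (\<Phi> l) then Ordinary
        else Limit (frame_indices (A l)) (frame_family vF (\<chi> l) (\<mu> l)) of
        Ordinary \<Rightarrow> ordinary_augmentation (\<mu> l) (\<phi> (Suc l)) (\<gamma> (Suc l)) (\<mu> (Suc l)) \<and>
          vdeg (\<mu> l) < vdeg (\<mu> (Suc l)) \<and> vdeg (\<mu> (Suc l)) < \<infinity>
      | Limit A \<rho> \<Rightarrow> essential_continuous_family v A \<rho> \<and>
          (\<exists>i\<in>A. (\<forall>j\<in>A. i \<le> j) \<and> \<rho> i = \<mu> l) \<and> family_deg A \<rho> (vdeg (\<mu> l)) \<and>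
          \<phi> l \<notin> tset (\<mu> l) (\<mu> (Suc l)) \<and> limit_augmentation A \<rho> (\<phi> (Suc l)) (\<gamma> (Suc l)) (\<mu> (Suc l))"
      using step_ordinary[OF l] step_limit[OF l] vdeg_step[OF l] by (cases "is_singleton (\<Phi> l)") simp_all
  qed
  moreover have "\<gamma> (Suc r) = \<infinity>"
    by (simp add: \<gamma>_def vF_def \<phi>F infinity_vinf_def nu_eq_Infty)
  moreover have "ordinary_augmentation (\<mu> l) (\<chi> l i) (vF (\<chi> l i)) (augment (\<mu> l) (\<chi> l i) (vF (\<chi> l i)))"
    if "l \<le> r" "\<not> is_singleton (\<Phi> l)" "i \<in> A l" for l i
    using that ord_\<chi>[OF that(1) \<chi>_mem[OF that(1,2)]] by (simp add: A_def \<gamma>_def)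
  ultimately show ?thesis
    using valuations \<phi>F by blast
qed

end
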